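(* Let $\Omega\subset\mathbb{C}^n$ be a bounded domain and let $\psi\ge 0$ be a continuous function on $\overline{\Omega}$. Let $\Gamma$, $f$, $F$ be as in the context, and assume $$\lim_{R\to\infty}f(R,R,\dots,R)>\sup_{\Omega}\psi .$$ Then a function $u\in USC(\Omega)$ is a viscosity subsolution of $F(Hw)=\psi(z)$ in $\Omega$ if and only if for every open set $U\Subset\Omega$ there exists a decreasing sequence $\{u_j\}$ of smooth $\Gamma$-subharmonic functions on $U$ such that $u_j\to u$ on $U$ as $j\to\infty$ and $F(Hu_j(z))\ge\psi(z)$ for all $z\in U$ and every $j$.
   Context: Cone and operator. For $1\le k\le n$ let $\sigma_k(x)=\sum_{1\le j_1<\dots<j_k\le n}x_{j_1}\cdots x_{j_k}$ and $\Gamma_k=\{x\in\mathbb{R}^n:\sigma_1(x)>0,\dots,\sigma_k(x)>0\}$. $\Gamma\subsetneq\mathbb{R}^n$ is an open, convex, symmetric (permutation invariant) cone with vertex at the origin with $\Gamma_n\subseteq\Gamma\subseteq\Gamma_1$. $f:\overline{\Gamma}\to[0,\infty)$ is continuous, symmetric, concave, strictly increasing in each variable on $\Gamma$, with $f>0$ on $\Gamma$ and $f=0$ on $\partial\Gamma$. $\mathcal{H}^n$ is the set of $n\times n$ Hermitian matrices, $\lambda(H)\in\mathbb{R}^n$ denotes the eigenvalues of $H$, $M(\Gamma,n)=\{H\in\mathcal{H}^n:\lambda(H)\in\Gamma\}$, and $F:\mathcal{H}^n\to[-\infty,\infty)$ is $F(H)=f(\lambda(H))$ if $H\in\overline{M(\Gamma,n)}$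 and $F(H)=-\infty$ otherwise. $Hu=\left(\frac{\partial^2u}{\partial z_\alpha\partial\overline{z_\beta}}\right)$ is the complex Hessian. Viscosity subsolutions. $USC(\Omega)$ is the set of upper semicontinuous functions $\Omega\to[-\infty,\infty)$. An upper test function for $u$ at $z_0$ is a $C^2$ function $q$ near $z_0$ with $u(z_0)=q(z_0)$ and $u\le q$ near $z_0$ (there are none if $u(z_0)=-\infty$). $u\in USC(\Omega)$ is a viscosity subsolution of $F(Hw)=\psi(z)$ in $\Omega$ if $F(Hq(z_0))\ge\psi(z_0)$ for every $z_0\in\Omega$ and every upper test function $q$ for $u$ at $z_0$. A smooth function $w$ on an open set is $\Gamma$-subharmonic if $Hw(z)\in M(\Gamma,n)$ for every $z$. *)

theory Defs
  imports "HOL-Analysis.Analysis"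
begin

section \<open>Cones and operators on eigenvalues\<close>

definition sigma :: "nat \<Rightarrow> real ^ 'n \<Rightarrow> real"
  where "sigma k x = (\<Sum>J\<in>{J. card J = k}. \<Prod>j\<in>J. x $ j)"

definition Gam :: "nat \<Rightarrow> (real ^ 'n) set"
  where "Gam k = {x. \<forall>i\<in>{1..k}. sigma i x > 0}"

definition permute :: "('n \<Rightarrow> 'n) \<Rightarrow> real ^ 'n \<Rightarrow> real ^ 'n"
  where "permute p x = (\<chi> i. x $ p i)"

text \<open>The scaling factors are strictly positive: the library notions \<open>cone\<close> and \<open>conic\<close> allow
  the factor \<open>0\<close>, and so exclude every nonempty proper open cone.\<close>

definition admissible_cone :: "(real ^ 'n) set \<Rightarrow> bool"
  where "admissible_cone \<Gamma> \<longleftrightarrow>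
    open \<Gamma> \<and> convex \<Gamma> \<and> \<Gamma> \<noteq> UNIV \<and>
    (\<forall>x\<in>\<Gamma>. \<forall>c>0. c *\<^sub>R x \<in> \<Gamma>) \<and>
    (\<forall>p x. bij p \<longrightarrow> x \<in> \<Gamma> \<longrightarrow> permute p x \<in> \<Gamma>) \<and>
    Gam CARD('n) \<subseteq> \<Gamma> \<and> \<Gamma> \<subseteq> Gam 1"

definition admissible_fun :: "(real ^ 'n) set \<Rightarrow> (real ^ 'n \<Rightarrow> real) \<Rightarrow> bool"
  where "admissible_fun \<Gamma> f \<longleftrightarrow>
    (\<forall>x\<in>closure \<Gamma>. 0 \<le> f x) \<and>
    continuous_on (closure \<Gamma>) f \<and>
    (\<forall>p. \<forall>x\<in>closure \<Gamma>. bij p \<longrightarrow> f (permute p x) = f x) \<and>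
    concave_on (closure \<Gamma>) f \<and>
    (\<forall>x\<in>\<Gamma>. \<forall>i. \<forall>t>0. x + t *\<^sub>R axis i 1 \<in> \<Gamma> \<longrightarrow> f x < f (x + t *\<^sub>R axis i 1)) \<and>
    (\<forall>x\<in>\<Gamma>. f x > 0) \<and>
    (\<forall>x\<in>frontier \<Gamma>. f x = 0)"

definition hermitian :: "complex ^ 'n ^ 'n \<Rightarrow> bool"
  where "hermitian H \<longleftrightarrow> (\<forall>i j. H $ i $ j = cnj (H $ j $ i))"

text \<open>The eigenvalues of a Hermitian matrix with multiplicity, that is the roots of its
  characteristic polynomial, as a vector.  Their order is left unspecified; it is immaterial
  because the cone and the function applied to this vector are permutation invariant.\<close>

definition eigenvalue_vec :: "complex ^ 'n ^ 'n \<Rightarrow> real ^ 'n"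
  where "eigenvalue_vec H =
    (SOME l. \<forall>t. det (mat t - H) = (\<Prod>i\<in>UNIV. t - complex_of_real (l $ i)))"

definition M_cone :: "(real ^ 'n) set \<Rightarrow> (complex ^ 'n ^ 'n) set"
  where "M_cone \<Gamma> = {H. hermitian H \<and> eigenvalue_vec H \<in> \<Gamma>}"

text \<open>The closure is taken in the space of all matrices, in which the Hermitian ones form a closed
  subspace.\<close>

definition F_op :: "(real ^ 'n) set \<Rightarrow> (real ^ 'n \<Rightarrow> real) \<Rightarrow> complex ^ 'n ^ 'n \<Rightarrow> ereal"
  where "F_op \<Gamma> f H =
    (if H \<in> closure (M_cone \<Gamma>) then ereal (f (eigenvalue_vec H)) else -\<infinity>)"

section \<open>Differentiability and the complex Hessian\<close>

text \<open>Meaningful for open \<open>U\<close>.\<close>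

primrec Ck_on :: "nat \<Rightarrow> 'a set \<Rightarrow> ('a::real_normed_vector \<Rightarrow> 'b::real_normed_vector) \<Rightarrow> bool"
  where
    "Ck_on 0 U g \<longleftrightarrow> continuous_on U g"
  | "Ck_on (Suc k) U g \<longleftrightarrow>
       (\<forall>x\<in>U. g differentiable (at x)) \<and>
       (\<forall>v. Ck_on k U (\<lambda>x. frechet_derivative g (at x) v))"

definition smooth_on :: "'a set \<Rightarrow> ('a::real_normed_vector \<Rightarrow> 'b::real_normed_vector) \<Rightarrow> bool"
  where "smooth_on U g \<longleftrightarrow> (\<forall>k. Ck_on k U g)"

text \<open>Wirtinger derivatives: \<open>axis a 1\<close> and \<open>axis a \<i>\<close> are the real directions of the real and
  imaginary part of the coordinate \<open>a\<close>.\<close>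

definition d_z :: "'n \<Rightarrow> (complex ^ 'n \<Rightarrow> complex) \<Rightarrow> complex ^ 'n \<Rightarrow> complex"
  where "d_z a g z =
    (frechet_derivative g (at z) (axis a 1) - \<i> * frechet_derivative g (at z) (axis a \<i>)) / 2"

definition d_zbar :: "'n \<Rightarrow> (complex ^ 'n \<Rightarrow> complex) \<Rightarrow> complex ^ 'n \<Rightarrow> complex"
  where "d_zbar a g z =
    (frechet_derivative g (at z) (axis a 1) + \<i> * frechet_derivative g (at z) (axis a \<i>)) / 2"

definition complex_hessian :: "(complex ^ 'n \<Rightarrow> real) \<Rightarrow> complex ^ 'n \<Rightarrow> complex ^ 'n ^ 'n"
  where "complex_hessian w z =
    (\<chi> a b. d_z a (d_zbar b (\<lambda>x. complex_of_real (w x))) z)"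

definition Gamma_subharmonic_on ::
    "(real ^ 'n) set \<Rightarrow> (complex ^ 'n) set \<Rightarrow> (complex ^ 'n \<Rightarrow> real) \<Rightarrow> bool"
  where "Gamma_subharmonic_on \<Gamma> U w \<longleftrightarrow>
    smooth_on U w \<and> (\<forall>z\<in>U. complex_hessian w z \<in> M_cone \<Gamma>)"

section \<open>Viscosity subsolutions\<close>

definition USC :: "'a::topological_space set \<Rightarrow> ('a \<Rightarrow> ereal) set"
  where "USC \<Omega> = {u. (\<forall>z\<in>\<Omega>. u z \<noteq> \<infinity>) \<and>
    (\<forall>a. openin (top_of_set \<Omega>) {z\<in>\<Omega>. u z < a})}"

definition upper_test_function ::
    "(complex ^ 'n) set \<Rightarrow> (complex ^ 'n \<Rightarrow> ereal) \<Rightarrow> complex ^ 'n \<Rightarrow> (complex ^ 'n \<Rightarrow> real) \<Rightarrow> bool"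
  where "upper_test_function \<Omega> u z0 q \<longleftrightarrow>
    (\<exists>N. open N \<and> z0 \<in> N \<and> N \<subseteq> \<Omega> \<and> Ck_on 2 N q \<and>
      u z0 = ereal (q z0) \<and> (\<forall>z\<in>N. u z \<le> ereal (q z)))"

definition viscosity_subsolution ::
    "(complex ^ 'n ^ 'n \<Rightarrow> ereal) \<Rightarrow> (complex ^ 'n \<Rightarrow> real) \<Rightarrow> (complex ^ 'n) set
      \<Rightarrow> (complex ^ 'n \<Rightarrow> ereal) \<Rightarrow> bool"
  where "viscosity_subsolution F \<psi> \<Omega> u \<longleftrightarrow> u \<in> USC \<Omega> \<and>
    (\<forall>z0\<in>\<Omega>. \<forall>q. upper_test_function \<Omega> u z0 q \<longrightarrow>
      F (complex_hessian q z0) \<ge> ereal (\<psi> z0))"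

end

theory Submission
  imports Defs "HOL-Computational_Algebra.Polynomial" "HOL-Combinatorics.Permutations"
begin

text \<open>Both implications rest on one linear-algebra fact.  A closed convex permutation invariant set
contains the eigenvalues of a Hermitian matrix \<open>H\<close> if and only if it contains the diagonal of \<open>H\<close>
in every orthonormal basis (\<open>eigenvalue_vec_in_symmetric_convex_iff\<close>).  Applied to the sets
\<open>{x \<in> closure \<Gamma>. c \<le> f x}\<close>, it replaces the inequality \<open>F H \<ge> c\<close> by conditions that are linear in
\<open>H\<close> (\<open>F_op_ge_iff\<close>); concavity, monotonicity and semicontinuity of the operator become visible, and
since every such set is an intersection of half-spaces with nonnegative normals, the inequality for
a complex Hessian becomes a family of linear inequalities \<open>L w \<ge> b\<close>, where \<open>L\<close> is a sum of second
derivatives along finitely many real directions.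

A decreasing limit of smooth subsolutions is a viscosity subsolution by a Dini argument: if \<open>q\<close>
touches the limit from above, then \<open>q\<close> plus a small strictly convex quadratic touches, up to a
constant, some approximant from above at a nearby point, where the Hessians are ordered
(\<open>decreasing_limit_touching\<close>).

For the converse, let \<open>u\<close> be a viscosity subsolution and choose \<open>A\<close> with \<open>f (A, \<dots>, A) > sup \<psi>\<close>.  The
maximum of \<open>u\<close> and \<open>A |z|\<^sup>2 - j\<close> is again a subsolution, is real valued, and decreases to \<open>u\<close>.  Its
\<open>k\<close>-Lipschitz envelope is continuous, and it is a subsolution with a slightly smaller right-hand
side, because translates of test functions are test functions (\<open>envelope_subsol\<close>).  Mollifying the
envelope preserves the inequality with a locally constant right-hand side (\<open>mollify_subsol\<close>).  This
is the heart of the matter, and by the reduction above it is a statement on the linear operators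
\<open>L\<close>: a continuous function \<open>g\<close> that satisfies \<open>L g \<ge> - \<beta>\<close> in the viscosity sense satisfies it after
mollification (\<open>diffusion_conv_lower\<close>).  It is proved by comparing \<open>g\<close> with the discrete heat flow
generated by \<open>L\<close>: if \<open>T\<close> averages over the steps \<open>\<plusminus>h b\<^sub>k\<close> of a random walk, the maximum principle
gives \<open>g \<le> T\<^sup>m g + t \<beta> + o(1)\<close> when \<open>h\<close> tends to \<open>0\<close> and \<open>m\<close> steps take the time \<open>t\<close>.  Convolution
commutes with \<open>T\<close>, and for the smooth function \<open>g * \<rho>\<close> the flow is \<open>g * \<rho> + t L (g * \<rho>) + O(t\<^sup>2)\<close>.

Finally, a convex combination with the quadratic \<open>A |z|\<^sup>2 + C\<close>,
  for which \<open>F\<close> exceeds \<open>sup \<psi>\<close>, absorbs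
the loss in the right-hand side by concavity, puts the Hessian into the open cone, and keeps the
sequence decreasing (\<open>viscosity_imp_smooth_approximation\<close>).\<close>

section \<open>Unitary diagonalization of Hermitian matrices\<close>

definition adj :: "complex ^ 'n ^ 'n \<Rightarrow> complex ^ 'n ^ 'n"
  where "adj U = (\<chi> i j. cnj (U $ j $ i))"

definition unitary :: "complex ^ 'n ^ 'n \<Rightarrow> bool"
  where "unitary U \<longleftrightarrow> adj U ** U = mat 1"

text \<open>The diagonal of the form \<open>H\<close> in the basis of the columns of \<open>U\<close>.  For Hermitian \<open>H\<close> these
entries are real.\<close>

definition diag_in :: "complex ^ 'n ^ 'n \<Rightarrow> complex ^ 'n ^ 'n \<Rightarrow> real ^ 'n"
  where "diag_in U H = (\<chi> i. Re ((adj U ** H ** U) $ i $ i))"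

lemma adj_mult: "adj (A ** B) = adj B ** adj A"
  by (simp add: adj_def matrix_matrix_mult_def vec_eq_iff mult.commute)

lemma adj_adj [simp]: "adj (adj A) = A"
  by (simp add: adj_def vec_eq_iff)

lemma hermitian_iff_adj: "hermitian H \<longleftrightarrow> adj H = H"
  by (simp add: hermitian_def adj_def vec_eq_iff) metis

lemma hermitian_conjugate: "hermitian H \<Longrightarrow> hermitian (adj U ** H ** U)"
  by (simp add: hermitian_iff_adj adj_mult matrix_mul_assoc)

lemma unitary_mult: "unitary U \<Longrightarrow> unitary V \<Longrightarrow> unitary (U ** V)"
  unfolding unitary_def adj_mult
  by (metis matrix_mul_assoc matrix_mul_lid)

lemma unitary_adj_right: "unitary U \<Longrightarrow> U ** adj U = mat 1"
  by (simp add: unitary_def matrix_left_right_inverse)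

lemma unitary_adj: "unitary U \<Longrightarrow> unitary (adj U)"
  by (simp add: unitary_def matrix_left_right_inverse)

lemma unitary_mat_1: "unitary (mat 1)"
  by (simp add: unitary_def) (simp add: adj_def mat_def vec_eq_iff)

lemma diag_in_eq:
  "diag_in U H $ i = Re (\<Sum>k\<in>UNIV. \<Sum>l\<in>UNIV. cnj (U $ k $ i) * H $ k $ l * U $ l $ i)"
proof -
  have "(adj U ** H ** U) $ i $ i = (\<Sum>l\<in>UNIV. \<Sum>k\<in>UNIV. cnj (U $ k $ i) * H $ k $ l * U $ l $ i)"
    by (simp add: matrix_matrix_mult_def adj_def sum_distrib_right)
  also have "\<dots> = (\<Sum>k\<in>UNIV. \<Sum>l\<in>UNIV. cnj (U $ k $ i) * H $ k $ l * U $ l $ i)"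
    by (rule sum.swap)
  finally show ?thesis by (simp add: diag_in_def)
qed

lemma unitary_column_norm: 
  assumes "unitary U" shows "(\<Sum>k\<in>UNIV. (cmod (U $ k $ i))\<^sup>2) = 1"
proof -
  have "(adj U ** U) $ i $ i = 1"
    using assms by (simp add: unitary_def mat_def)
  then have "(\<Sum>k\<in>UNIV. cnj (U $ k $ i) * U $ k $ i) = 1"
    by (simp add: matrix_matrix_mult_def adj_def)
  moreover have "cnj z * z = of_real ((cmod z)\<^sup>2)" for z
    by (metis complex_norm_square mult.commute)
  ultimately have "complex_of_real (\<Sum>k\<in>UNIV. (cmod (U $ k $ i))\<^sup>2) = 1"
    by simp
  then show ?thesis using of_real_eq_1_iff by blast
qed

lemma unitary_row_norm: 
  assumes "unitary U" shows "(\<Sum>k\<in>UNIV. (cmod (U $ i $ k))\<^sup>2) = 1"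
  using unitary_column_norm[OF unitary_adj[OF assms], of i] by (simp add: adj_def)

lemma unitary_entry_le: assumes "unitary U" shows "cmod (U $ k $ i) \<le> 1"
proof -
  have "(cmod (U $ k $ i))\<^sup>2 \<le> (\<Sum>k\<in>UNIV. (cmod (U $ k $ i))\<^sup>2)"
    by (rule member_le_sum) auto
  then show ?thesis
    unfolding unitary_column_norm[OF assms] using power2_le_imp_le[of _ 1] by simp
qed

lemma compact_unitary: "compact {U :: complex ^ 'n ^ 'n. unitary U}"
proof -
  have "bounded {U :: complex ^ 'n ^ 'n. unitary U}"
    unfolding bounded_iff
  proof (intro exI ballI)
    fix U :: "complex ^ 'n ^ 'n" assume "U \<in> {U. unitary U}"
    then have *: "cmod (U $ k $ i) \<le> 1" for k i by (simp add: unitary_entry_le)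
    have "norm U \<le> (\<Sum>k\<in>UNIV. norm (U $ k))" by (simp add: norm_vec_def L2_set_le_sum)
    also have "\<dots> \<le> (\<Sum>k\<in>UNIV. \<Sum>i\<in>UNIV. cmod (U $ k $ i))"
      by (intro sum_mono) (simp add: norm_vec_def L2_set_le_sum)
    also have "\<dots> \<le> (\<Sum>k\<in>(UNIV::'n set). \<Sum>i\<in>(UNIV::'n set). 1)"
      using * by (intro sum_mono) auto
    finally show "norm U \<le> (\<Sum>k\<in>(UNIV::'n set). \<Sum>i\<in>(UNIV::'n set). 1)" .
  qed
  moreover have "closed {U :: complex ^ 'n ^ 'n. unitary U}"
    unfolding unitary_def adj_def matrix_matrix_mult_def vec_eq_iff
    by (intro closed_Collect_all closed_Collect_eq continuous_intros)
  ultimately show ?thesis by (simp add: compact_eq_bounded_closed)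
qed

lemma continuous_on_diag_in [continuous_intros]:
  "continuous_on S (\<lambda>U. diag_in U H $ i)"
  unfolding diag_in_eq by (intro continuous_intros)

definition sesq :: "complex ^ 'n ^ 'n \<Rightarrow> complex ^ 'n \<Rightarrow> complex ^ 'n \<Rightarrow> complex"
  where "sesq H x y = (\<Sum>k\<in>UNIV. \<Sum>l\<in>UNIV. cnj (x $ k) * H $ k $ l * y $ l)"

lemma sesq_simps:
  "sesq H (x + x') y = sesq H x y + sesq H x' y"
  "sesq H x (y + y') = sesq H x y + sesq H x y'"
  "sesq H (x - x') y = sesq H x y - sesq H x' y"
  "sesq H x (y - y') = sesq H x y - sesq H x y'"
  "sesq H (a *s x) y = cnj a * sesq H x y"
  "sesq H x (a *s y) = a * sesq H x y"
  by (simp_all add: sesq_def algebra_simps sum.distrib sum_subtractf sum_distrib_left)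

lemma sesq_axis: "sesq H (axis i 1) (axis j 1) = H $ i $ j"
proof -
  have "cnj (axis i 1 $ k) * H $ k $ l * axis j 1 $ l =
      (if l = j then (if k = i then H $ k $ l else 0) else 0)" for k l
    by (simp add: axis_def)
  then have "sesq H (axis i 1) (axis j 1) = (\<Sum>k\<in>UNIV. if k = i then H $ k $ j else 0)"
    unfolding sesq_def by (simp only: sum.delta finite UNIV_I if_True)
  then show ?thesis by simp
qed

lemma conjugate_entry: "(adj U ** H ** U) $ i $ j = sesq H (column i U) (column j U)"
proof -
  have "(adj U ** H ** U) $ i $ j = (\<Sum>l\<in>UNIV. \<Sum>k\<in>UNIV. cnj (U $ k $ i) * H $ k $ l * U $ l $ j)"
    by (simp add: matrix_matrix_mult_def adj_def sum_distrib_right)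
  also have "\<dots> = sesq H (column i U) (column j U)"
    unfolding sesq_def column_def by (subst sum.swap) simp
  finally show ?thesis .
qed

lemma unitary_iff_columns:
  "unitary U \<longleftrightarrow> (\<forall>i j. sesq (mat 1) (column i U) (column j U) = (if i = j then 1 else 0))"
  unfolding unitary_def conjugate_entry[symmetric]
  by (simp only: matrix_mul_rid vec_eq_iff) (simp add: mat_def)

text \<open>The identity outside the plane of the coordinates \<open>i\<close> and \<open>j\<close>;
  for a unit vector \<open>(c, s)\<close> it is
a rotation of this plane.\<close>

definition plane_rotation :: "'n \<Rightarrow> 'n \<Rightarrow> complex \<Rightarrow> complex \<Rightarrow> complex ^ 'n ^ 'n"
  where "plane_rotation i j c s = (\<chi> k m.
     (if m = i then c *s axis i 1 + s *s axis j 1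
      else if m = j then (- cnj s) *s axis i 1 + cnj c *s axis j 1
      else axis m 1) $ k)"

lemma column_plane_rotation:
  "column m (plane_rotation i j c s) =
     (if m = i then c *s axis i 1 + s *s axis j 1
      else if m = j then (- cnj s) *s axis i 1 + cnj c *s axis j 1
      else axis m 1)"
  by (simp add: column_def plane_rotation_def vec_eq_iff)

lemma unitary_plane_rotation:
  assumes "i \<noteq> j" and "cnj c * c + cnj s * s = 1"
  shows "unitary (plane_rotation i j c s)"
  unfolding unitary_iff_columns column_plane_rotation using assms
  by (auto simp: sesq_simps sesq_axis mat_def algebra_simps)

lemma diag_in_plane_rotation:
  assumes "i \<noteq> j"
  shows "diag_in (plane_rotation i j c s) B $ m =
    (if m = i then Re (cnj c * c * B $ i $ i + cnj s * s * B $ j $ j + cnj c * s * B $ i $ j + cnj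
      s * c * B $ j $ i)
     else if m = j then Re (cnj s * s * B $ i $ i + cnj c * c * B $ j $ j - s * cnj c * B $ i $ j
       - c * cnj s * B $ j $ i)
     else Re (B $ m $ m))"
proof -
  have "diag_in (plane_rotation i j c s) B $ m =
     Re (sesq B (column m (plane_rotation i j c s)) (column m (plane_rotation i j c s)))"
    by (simp add: diag_in_def conjugate_entry)
  then show ?thesis
    using assms unfolding column_plane_rotation
    by (auto simp: sesq_simps sesq_axis algebra_simps)
qed

lemma diag_in_mult: "diag_in (U ** R) H = diag_in R (adj U ** H ** U)"
  by (simp add: diag_in_def adj_mult matrix_mul_assoc)

text \<open>In the plane of \<open>i\<close> and \<open>j\<close> the matrix is a Hermitian block with diagonal entries \<open>x\<close>, \<open>y\<close>
  and an
off-diagonal entry of modulus \<open>b\<close>.  A rotation that diagonalizes the block keeps \<open>x + y\<close> and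
enlarges the difference from \<open>\<bar>x - y\<bar>\<close> to the gap \<open>A = sqrt ((x - y)\<^sup>2 + 4 b\<^sup>2)\<close> of its eigenvalues;
hence it enlarges the sum of the squares of the diagonal entries.\<close>

lemma rotation_increases_diagonal:
  fixes B :: "complex ^ 'n ^ 'n"
  assumes "hermitian B" "i \<noteq> j" "B $ i $ j \<noteq> 0"
  shows "\<exists>R. unitary R \<and> (\<Sum>m\<in>UNIV. (Re (B $ m $ m))\<^sup>2) < (\<Sum>m\<in>UNIV. (diag_in R B $ m)\<^sup>2)"
proof -
  define b where "b = cmod (B $ i $ j)"
  define d where "d = Re (B $ i $ i) - Re (B $ j $ j)"
  define A where "A = sqrt (d\<^sup>2 + (2 * b)\<^sup>2)"
  have b: "b > 0" using assms by (simp add: b_def)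
  then have A2: "A\<^sup>2 = d\<^sup>2 + (2 * b)\<^sup>2" and A0: "A > 0"
    unfolding A_def by (auto simp: add_nonneg_pos)
  have "(d / A)\<^sup>2 + (2 * b / A)\<^sup>2 = 1"
    using A0 unfolding power_divide A2[symmetric] add_divide_distrib[symmetric] by simp
  \<comment> \<open>half of the angle \<open>t\<close> is the rotation angle, by the double angle formulas for \<open>cs\<close> below\<close>
  then obtain t where t: "d / A = cos t" "2 * b / A = sin t"
    using sincos_total_2pi_le[of "d / A" "2 * b / A"] by blast
  define c s where "c = cos (t / 2)" and "s = sin (t / 2)"
  have cs: "c\<^sup>2 - s\<^sup>2 = d / A" "2 * c * s = 2 * b / A" "c\<^sup>2 + s\<^sup>2 = 1"
    unfolding c_def s_def t using cos_double[of "t / 2"] sin_double[of "t / 2"] by auto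
  \<comment> \<open>a unit factor that makes the off-diagonal entry positive\<close>
  define e where "e = cnj (B $ i $ j) / b"
  have ee: "cnj e * e = 1"
    unfolding e_def b_def using assms(3) complex_norm_square[of "B $ i $ j"]
    by (simp add: field_simps power2_eq_square)
  have eB: "e * B $ i $ j = b"
    unfolding e_def b_def using assms(3) complex_norm_square[of "B $ i $ j"]
    by (simp add: field_simps power2_eq_square)
  have Bji: "B $ j $ i = cnj (B $ i $ j)"
    using assms(1) unfolding hermitian_def by blast
  have eB': "cnj e * B $ j $ i = b"
    unfolding Bji using arg_cong[OF eB, of cnj] by simp
  define R where "R = plane_rotation i j (of_real c) (of_real s * e)"
  have "cnj (of_real c) * of_real c + cnj (of_real s * e) * (of_real s * e) =
        of_real (c\<^sup>2) + of_real (s\<^sup>2) * (cnj e * e)"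
    by (simp add: power2_eq_square algebra_simps)
  also have "\<dots> = 1" using cs(3) unfolding ee by (metis mult.right_neutral of_real_1 of_real_add)
  finally have U: "unitary R"
    unfolding R_def using unitary_plane_rotation[OF assms(2)] by blast
  define x y where "x = Re (B $ i $ i)" and "y = Re (B $ j $ j)"
  have x': "diag_in R B $ i = c\<^sup>2 * x + s\<^sup>2 * y + 2 * c * s * b"
  proof -
    have "diag_in R B $ i = Re (of_real (c\<^sup>2) * B $ i $ i + of_real (s\<^sup>2) * (cnj e * e) * B $ j $ j
        + of_real (c * s) * (e * B $ i $ j) + of_real (c * s) * (cnj e * B $ j $ i))"
      unfolding R_def diag_in_plane_rotation[OF assms(2)]
      by (simp add: power2_eq_square algebra_simps)
    also have "\<dots> = c\<^sup>2 * x + s\<^sup>2 * y + 2 * c * s * b"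
      unfolding ee eB eB' by (simp add: x_def y_def flip: of_real_power)
    finally show ?thesis .
  qed
  have y': "diag_in R B $ j = s\<^sup>2 * x + c\<^sup>2 * y - 2 * c * s * b"
  proof -
    have "diag_in R B $ j = Re (of_real (s\<^sup>2) * (cnj e * e) * B $ i $ i + of_real (c\<^sup>2) * B $ j $ j
        - of_real (c * s) * (e * B $ i $ j) - of_real (c * s) * (cnj e * B $ j $ i))"
      unfolding R_def diag_in_plane_rotation[OF assms(2)] using assms(2)
      by (simp add: power2_eq_square algebra_simps)
    also have "\<dots> = s\<^sup>2 * x + c\<^sup>2 * y - 2 * c * s * b"
      unfolding ee eB eB' by (simp add: x_def y_def flip: of_real_power)
    finally show ?thesis .
  qed
  have sum: "diag_in R B $ i + diag_in R B $ j = x + y"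
  proof -
    have "diag_in R B $ i + diag_in R B $ j = (c\<^sup>2 + s\<^sup>2) * (x + y)"
      unfolding x' y' by (simp add: algebra_simps)
    then show ?thesis using cs(3) by simp
  qed
  have diff: "diag_in R B $ i - diag_in R B $ j = A"
  proof -
    have "diag_in R B $ i - diag_in R B $ j = (c\<^sup>2 - s\<^sup>2) * d + 2 * (2 * c * s) * b"
      unfolding x' y' d_def x_def[symmetric] y_def[symmetric] by (simp add: algebra_simps)
    also have "\<dots> = (d\<^sup>2 + (2 * b)\<^sup>2) / A"
      unfolding cs by (simp add: power2_eq_square add_divide_distrib)
    also have "\<dots> = A" using A0 A2 by (simp add: power2_eq_square field_simps)
    finally show ?thesis .
  qed
  have "(x - y)\<^sup>2 < A\<^sup>2" unfolding A2 d_def x_def y_def using b by simp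
  then have gt: "x\<^sup>2 + y\<^sup>2 < (diag_in R B $ i)\<^sup>2 + (diag_in R B $ j)\<^sup>2"
  proof -
    have eq: "p\<^sup>2 + q\<^sup>2 = ((p + q)\<^sup>2 + (p - q)\<^sup>2) / 2" for p q :: real
      by (simp add: power2_eq_square field_simps)
    show ?thesis
      unfolding eq[of x y] eq[of "diag_in R B $ i"] sum diff using \<open>(x - y)\<^sup>2 < A\<^sup>2\<close> by simp
  qed
  have split: "(\<Sum>m\<in>UNIV. g m) = g i + g j + (\<Sum>m\<in>UNIV - {i, j}. g m)" for g :: "'n \<Rightarrow> real"
    using assms(2) sum.subset_diff[of "{i, j}" UNIV g] by simp
  have "(\<Sum>m\<in>UNIV - {i, j}. (diag_in R B $ m)\<^sup>2) = (\<Sum>m\<in>UNIV - {i, j}. (Re (B $ m $ m))\<^sup>2)"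
    by (rule sum.cong) (auto simp: R_def diag_in_plane_rotation[OF assms(2)])
  then show ?thesis
    using gt U split[of "\<lambda>m. (diag_in R B $ m)\<^sup>2"] split[of "\<lambda>m. (Re (B $ m $ m))\<^sup>2"]
    by (intro exI[of _ R]) (simp add: x_def y_def)
qed

text \<open>The unitary group is compact, so some \<open>U\<close> maximizes the sum of the squares of the diagonal
entries.  An off-diagonal entry that does not vanish would contradict maximality by the previous
lemma.\<close>

lemma hermitian_diagonalizable:
  fixes H :: "complex ^ 'n ^ 'n"
  assumes "hermitian H"
  obtains U where "unitary U" "\<And>i j. i \<noteq> j \<Longrightarrow> (adj U ** H ** U) $ i $ j = 0"
proof -
  have "\<exists>U\<in>{U. unitary U}. \<forall>V\<in>{U. unitary U}.
      (\<Sum>m\<in>UNIV. (diag_in V H $ m)\<^sup>2) \<le> (\<Sum>m\<in>UNIV. (diag_in U H $ m)\<^sup>2)"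
    using unitary_mat_1
    by (intro continuous_attains_sup compact_unitary continuous_intros) auto
  then obtain U where U: "unitary U" and
    max: "\<And>V. unitary V \<Longrightarrow> (\<Sum>m\<in>UNIV. (diag_in V H $ m)\<^sup>2) \<le> (\<Sum>m\<in>UNIV. (diag_in U H $ m)\<^sup>2)"
    by auto
  have "(adj U ** H ** U) $ i $ j = 0" if "i \<noteq> j" for i j
  proof (rule ccontr)
    assume "(adj U ** H ** U) $ i $ j \<noteq> 0"
    from rotation_increases_diagonal[OF hermitian_conjugate[OF assms] that this]
    obtain R where "unitary R" "(\<Sum>m\<in>UNIV. (diag_in U H $ m)\<^sup>2) < (\<Sum>m\<in>UNIV. (diag_in (U ** R) H $
      m)\<^sup>2)"
      unfolding diag_in_mult by (auto simp: diag_in_def)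
    then show False using max[OF unitary_mult[OF U \<open>unitary R\<close>]] by simp
  qed
  with U show thesis by (rule that)
qed

lemma eigenvalue_vec_charpoly:
  fixes H :: "complex ^ 'n ^ 'n"
  assumes U: "unitary U" and "hermitian H" and off: "\<And>i j. i \<noteq> j \<Longrightarrow> (adj U ** H ** U) $ i $ j = 0"
  shows "det (mat t - H) = (\<Prod>i\<in>UNIV. t - complex_of_real (diag_in U H $ i))"
proof -
  define B where "B = adj U ** H ** U"
  have B: "B $ i $ i = complex_of_real (diag_in U H $ i)" for i
  proof -
    have "B $ i $ i = cnj (B $ i $ i)"
      using hermitian_conjugate[OF assms(2), of U] unfolding B_def hermitian_def by blast
    then show ?thesis unfolding diag_in_def B_def[symmetric] by (simp add: complex_eq_iff)
  qed
  have X: "(adj U ** (mat t - H) ** U) $ i $ j = (if i = j then t else 0) - B $ i $ j" for i j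
  proof -
    have "sesq (mat t - H) x y = sesq (mat t) x y - sesq H x y" for x y :: "complex ^ 'n"
      by (simp add: sesq_def algebra_simps sum_subtractf)
    moreover have "sesq (mat t) x y = t * sesq (mat 1) x y" for x y :: "complex ^ 'n"
      by (simp add: sesq_def mat_def sum_distrib_left if_distrib if_distribR cong: if_cong)
         (simp add: algebra_simps)
    moreover have "sesq (mat 1) (column i U) (column j U) = (if i = j then 1 else 0)"
      using U by (simp add: unitary_iff_columns)
    ultimately show ?thesis by (simp add: conjugate_entry B_def)
  qed
  have "det (mat t - H) = det (adj U ** (mat t - H) ** U)"
  proof -
    have "det (adj U) * det U = 1"
      using arg_cong[OF U[unfolded unitary_def], of det] by (simp add: det_mul)
    then show ?thesis by (simp add: det_mul algebra_simps)
  qed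
  also have "\<dots> = (\<Prod>i\<in>UNIV. (adj U ** (mat t - H) ** U) $ i $ i)"
    by (rule det_diagonal) (simp add: X off[folded B_def])
  finally show ?thesis by (simp add: X B)
qed

text \<open>The choice made in \<open>eigenvalue_vec\<close> is thus unique up to a permutation, which symmetric data
cannot detect.\<close>

lemma prod_linear_factors_unique:
  fixes l l' :: "real ^ 'n"
  assumes "\<And>t. (\<Prod>i\<in>UNIV. t - complex_of_real (l $ i)) = (\<Prod>i\<in>UNIV. t - complex_of_real (l' $ i))"
  shows "\<exists>p. bij p \<and> l = permute p l'"
proof -
  define P where "P l = (\<Prod>i\<in>UNIV. [:- complex_of_real (l $ i), 1:])" for l :: "real ^ 'n"
  have "poly (P l) t = (\<Prod>i\<in>UNIV. t - complex_of_real (l $ i))" for l t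
    by (simp add: P_def poly_prod algebra_simps)
  then have "P l = P l'" using assms by (simp add: poly_eq_poly_eq_iff[symmetric] fun_eq_iff)
  moreover have "proots (P l) = image_mset (\<lambda>i. complex_of_real (l $ i)) (mset_set UNIV)" for l
    unfolding P_def by (subst proots_prod) (auto simp: sum_unfold_sum_mset)
  ultimately have "image_mset (\<lambda>i. complex_of_real (l $ i)) (mset_set UNIV) =
     image_mset (\<lambda>i. complex_of_real (l' $ i)) (mset_set UNIV)" by metis
  then obtain p where "p permutes (UNIV :: 'n set)" "\<forall>i\<in>UNIV. complex_of_real (l $ i) =
    complex_of_real (l' $ p i)"
    by (rule image_mset_eq_implies_permutes[OF finite])
  then show ?thesis
    by (intro exI[of _ p]) (auto simp: permute_def vec_eq_iff permutes_bij)
qed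

section \<open>Diagonals and symmetric convex sets\<close>

text \<open>The rearrangement inequality for a doubly stochastic matrix \<open>D\<close>.  Lowering the largest value
  of \<open>a\<close>
to the next one removes a multiple of the indicator of the set \<open>S\<close> where \<open>a\<close> is largest, so it
suffices to treat that indicator.  All values of \<open>x\<close> on \<open>S\<close> are at least \<open>m = Min (x ` S)\<close> and all
others at most \<open>m\<close>; averaging with \<open>D\<close> replaces some of the former by some of the latter.\<close>

lemma similarly_ordered_sum:
  fixes D :: "'n::finite \<Rightarrow> 'n \<Rightarrow> real"
  assumes D0: "\<And>i j. D i j \<ge> 0" and row: "\<And>i. (\<Sum>j\<in>UNIV. D i j) = 1"
    and col: "\<And>j. (\<Sum>i\<in>UNIV. D i j) = 1"
  assumes "\<And>i j. a i < a j \<Longrightarrow> x i \<le> x j"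
  shows "(\<Sum>i\<in>UNIV. a i * (\<Sum>j\<in>UNIV. D i j * x j)) \<le> (\<Sum>i\<in>UNIV. a i * x i)"
  using assms(4)
proof (induction "card (range a)" arbitrary: a rule: less_induct)
  case less
  define \<alpha> where "\<alpha> = Max (range a)"
  have le: "a i \<le> \<alpha>" for i by (simp add: \<alpha>_def)
  have in_range: "\<alpha> \<in> range a" unfolding \<alpha>_def by (rule Max_in) auto
  define S where "S = {i. a i = \<alpha>}"
  have S: "S \<noteq> {}" using in_range by (auto simp: S_def)
  have tot: "(\<Sum>i\<in>UNIV. \<Sum>j\<in>UNIV. D i j * x j) = (\<Sum>j\<in>UNIV. x j)"
    by (subst sum.swap) (simp add: sum_distrib_right[symmetric] col)
  have top: "(\<Sum>i\<in>S. \<Sum>j\<in>UNIV. D i j * x j) \<le> (\<Sum>i\<in>S. x i)"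
  proof -
    define m where "m = Min (x ` S)"
    have m: "m \<le> x j" if "j \<in> S" for j using that by (simp add: m_def)
    have "m \<in> x ` S" unfolding m_def by (rule Min_in) (use S in auto)
    then obtain i0 where i0: "i0 \<in> S" "m = x i0" by blast
    have m': "x j \<le> m" if "j \<notin> S" for j
      using that less.prems[of j i0] i0 le[of j] by (auto simp: S_def)
    have "(\<Sum>i\<in>S. \<Sum>j\<in>UNIV. D i j * (x j - m)) \<le> (\<Sum>i\<in>S. \<Sum>j\<in>S. D i j * (x j - m))"
    proof (rule sum_mono)
      fix i
      have "(\<Sum>j\<in>UNIV. D i j * (x j - m)) = (\<Sum>j\<in>UNIV - S. D i j * (x j - m)) + (\<Sum>j\<in>S. D i j * (x j
        - m))"
        by (rule sum.subset_diff) auto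
      moreover have "(\<Sum>j\<in>UNIV - S. D i j * (x j - m)) \<le> 0"
        by (rule sum_nonpos) (auto intro!: mult_nonneg_nonpos D0 simp: m')
      ultimately show "(\<Sum>j\<in>UNIV. D i j * (x j - m)) \<le> (\<Sum>j\<in>S. D i j * (x j - m))" by simp
    qed
    also have "\<dots> = (\<Sum>j\<in>S. (\<Sum>i\<in>S. D i j) * (x j - m))"
      by (subst sum.swap) (simp add: sum_distrib_right)
    also have "\<dots> \<le> (\<Sum>j\<in>S. 1 * (x j - m))"
    proof (intro sum_mono mult_right_mono)
      fix j assume "j \<in> S"
      then show "0 \<le> x j - m" using m by simp
      show "(\<Sum>i\<in>S. D i j) \<le> 1"
        unfolding col[of j, symmetric] by (rule sum_mono2) (auto simp: D0)
    qed
    finally have "(\<Sum>i\<in>S. (\<Sum>j\<in>UNIV. D i j * x j) - (\<Sum>j\<in>UNIV. D i j) * m) \<le> (\<Sum>j\<in>S. x j - m)"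
      by (simp add: algebra_simps sum_subtractf sum_distrib_left sum_distrib_right)
    then show ?thesis unfolding row by (simp add: sum_subtractf)
  qed
  show ?case
  proof (cases "range a = {\<alpha>}")
    case True
    then have "a i = \<alpha>" for i by auto
    then show ?thesis using tot by (simp add: sum_distrib_left[symmetric])
  next
    case False
    define \<beta> where "\<beta> = Max (range a - {\<alpha>})"
    have ne: "range a - {\<alpha>} \<noteq> {}" using False in_range by auto
    have \<beta>: "\<beta> \<in> range a - {\<alpha>}" unfolding \<beta>_def by (rule Max_in) (use ne in auto)
    then obtain i1 where "\<beta> = a i1" "\<beta> \<noteq> \<alpha>" by auto
    then have \<beta>\<alpha>: "\<beta> < \<alpha>" using le[of i1] by simp
    have le\<beta>: "a i \<le> \<beta>" if "i \<notin> S" for i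
      unfolding \<beta>_def using that by (intro Max_ge) (auto simp: S_def)
    define a' where "a' i = min (a i) \<beta>" for i
    have a': "a i = a' i + (if i \<in> S then \<alpha> - \<beta> else 0)" for i
      using le\<beta>[of i] \<beta>\<alpha> by (auto simp: a'_def S_def)
    have "range a' \<subseteq> range a - {\<alpha>}"
      using \<beta> \<beta>\<alpha> by (auto simp: a'_def min_def)
    then have "card (range a') \<le> card (range a - {\<alpha>})" by (intro card_mono) auto
    also have "\<dots> < card (range a)" using in_range by (intro card_Diff1_less) auto
    finally have "(\<Sum>i\<in>UNIV. a' i * (\<Sum>j\<in>UNIV. D i j * x j)) \<le> (\<Sum>i\<in>UNIV. a' i * x i)"
    proof (rule less.hyps)
      fix i j assume "a' i < a' j"
      then have "a i < a j" by (auto simp: a'_def)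
      then show "x i \<le> x j" by (rule less.prems)
    qed
    moreover have split: "(\<Sum>i\<in>UNIV. a i * y i) = (\<Sum>i\<in>UNIV. a' i * y i) + (\<alpha> - \<beta>) * (\<Sum>i\<in>S. y i)"
      for y
    proof -
      have "(\<Sum>i\<in>UNIV. a i * y i) = (\<Sum>i\<in>UNIV. a' i * y i + (if i \<in> S then (\<alpha> - \<beta>) * y i else 0))"
        by (intro sum.cong refl) (subst a', simp add: algebra_simps)
      also have "\<dots> = (\<Sum>i\<in>UNIV. a' i * y i) + (\<Sum>i\<in>S. (\<alpha> - \<beta>) * y i)"
        by (simp add: sum.distrib sum.If_cases)
      finally show ?thesis by (simp add: sum_distrib_left)
    qed
    moreover have "(\<alpha> - \<beta>) * (\<Sum>i\<in>S. \<Sum>j\<in>UNIV. D i j * x j) \<le> (\<alpha> - \<beta>) * (\<Sum>i\<in>S. x i)"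
      using top \<beta>\<alpha> by (intro mult_left_mono) auto
    ultimately show ?thesis unfolding split by linarith
  qed
qed

text \<open>If \<open>D x\<close> were outside \<open>C\<close>, a linear functional \<open>a\<close> would be smaller at \<open>D x\<close> than at all
permutations of \<open>x\<close>.  A permutation of \<open>x\<close> that minimizes \<open>a\<close> is ordered oppositely to \<open>a\<close>, since
otherwise a transposition would lower the value; now the rearrangement inequality says the
opposite.\<close>

lemma doubly_stochastic_in_symmetric_convex:
  fixes C :: "(real ^ 'n) set"
  assumes "closed C" "convex C" and sym: "\<And>p x. bij p \<Longrightarrow> x \<in> C \<Longrightarrow> permute p x \<in> C"
    and D0: "\<And>i j. D i j \<ge> 0" and row: "\<And>i. (\<Sum>j\<in>UNIV. D i j) = 1"
      and col: "\<And>j. (\<Sum>i\<in>UNIV. D i j) = 1"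
    and "x \<in> C"
  shows "(\<chi> i. \<Sum>j\<in>UNIV. D i j * x $ j) \<in> C"
proof (rule ccontr)
  let ?y = "\<chi> i. \<Sum>j\<in>UNIV. D i j * x $ j"
  assume "?y \<notin> C"
  from separating_hyperplane_closed_point[OF assms(2,1) this]
  obtain a b where ab: "inner a ?y < b" "\<And>z. z \<in> C \<Longrightarrow> b < inner a z" by blast
  have "\<exists>p\<in>{p. bij p}. \<forall>q\<in>{p. bij p}. inner a (permute p x) \<le> inner a (permute q x)"
  proof -
    have "finite {p :: 'n \<Rightarrow> 'n. bij p}" by simp
    moreover have "{p :: 'n \<Rightarrow> 'n. bij p} \<noteq> {}" using bij_id by blast
    ultimately show ?thesis
      using arg_min_least[of "{p. bij p}" _ "\<lambda>p. inner a (permute p x)"]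
        arg_min_if_finite(1)[of "{p. bij p}" "\<lambda>p. inner a (permute p x)"] by blast
  qed
  then obtain p where p: "bij p" "\<And>q. bij q \<Longrightarrow> inner a (permute p x) \<le> inner a (permute q x)"
    by auto
  have inner_eq: "inner a z = (\<Sum>i\<in>UNIV. a $ i * z $ i)" for z by (simp add: inner_vec_def)
  have ord: "- (x $ p i) \<le> - (x $ p j)" if "a $ i < a $ j" for i j
  proof (rule ccontr)
    assume *: "\<not> - (x $ p i) \<le> - (x $ p j)"
    have ij: "i \<noteq> j" using that by auto
    let ?q = "p \<circ> Transposition.transpose i j"
    have "inner a (permute p x) \<le> inner a (permute ?q x)"
      by (intro p(2) bij_comp bij_transpose p(1))
    moreover have split: "(\<Sum>m\<in>UNIV. g m) = (\<Sum>m\<in>UNIV - {i, j}. g m) + (g i + g j)"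
      for g :: "'n \<Rightarrow> real"
      using ij sum.subset_diff[of "{i, j}" UNIV g] by simp
    have "(\<Sum>m\<in>UNIV - {i, j}. a $ m * permute ?q x $ m) = (\<Sum>m\<in>UNIV - {i, j}. a $ m * permute p x $
      m)"
      by (rule sum.cong) (auto simp: permute_def transpose_def)
    then have "inner a (permute ?q x) - inner a (permute p x) =
      (a $ i - a $ j) * (x $ p j - x $ p i)"
      unfolding inner_eq split[of "\<lambda>m. a $ m * permute ?q x $ m"] split[of "\<lambda>m. a $ m * permute p
        x $ m"]
      by (simp add: permute_def algebra_simps)
    ultimately have "0 \<le> (a $ i - a $ j) * (x $ p j - x $ p i)" by simp
    moreover have "(a $ i - a $ j) * (x $ p j - x $ p i) < 0"
      using that * by (intro mult_neg_pos) auto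
    ultimately show False by simp
  qed
  have re: "(\<Sum>j\<in>UNIV. g (p j)) = (\<Sum>j\<in>UNIV. g j)" for g :: "'n \<Rightarrow> real"
    using p(1) by (intro sum.reindex_bij_betw) auto
  have "(\<Sum>i\<in>UNIV. a $ i * (\<Sum>j\<in>UNIV. D i (p j) * - (x $ p j))) \<le> (\<Sum>i\<in>UNIV. a $ i * - (x $ p i))"
    by (rule similarly_ordered_sum) (use ord in \<open>auto simp: D0 col re row\<close>)
  then have "inner a (permute p x) \<le> inner a ?y"
    unfolding inner_eq by (simp add: permute_def sum_negf re[of "\<lambda>j. D _ j * x $ j"])
  then show False using ab(1) ab(2)[OF sym[OF p(1) assms(7)]] by simp
qed

text \<open>Schur's observation: two orthonormal bases are related by a unitary matrix, and the squared
moduli of its entries form a doubly stochastic matrix.\<close>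

lemma diag_in_doubly_stochastic:
  assumes U: "unitary U" and V: "unitary V" and "hermitian H"
    and off: "\<And>i j. i \<noteq> j \<Longrightarrow> (adj U ** H ** U) $ i $ j = 0"
  shows "diag_in V H $ i = (\<Sum>k\<in>UNIV. (cmod ((adj U ** V) $ k $ i))\<^sup>2 * diag_in U H $ k)"
proof -
  define B where "B = adj U ** H ** U"
  have herm: "hermitian B" unfolding B_def by (rule hermitian_conjugate) fact
  have B: "B $ k $ l = (if l = k then complex_of_real (diag_in U H $ k) else 0)" for k l
  proof (cases "k = l")
    case True
    have "B $ k $ k = cnj (B $ k $ k)"
      using herm unfolding hermitian_def by blast
    then show ?thesis using True unfolding diag_in_def B_def[symmetric]
      by (simp add: complex_eq_iff)
  qed (use off B_def in auto)
  define W where "W = adj U ** V"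
  have V_eq: "V = U ** W" unfolding W_def matrix_mul_assoc unitary_adj_right[OF U] by simp
  have "diag_in V H $ i = diag_in W B $ i"
    unfolding V_eq diag_in_mult B_def ..
  also have "\<dots> = (\<Sum>k\<in>UNIV. Re (cnj (W $ k $ i) * complex_of_real (diag_in U H $ k) * W $ k $ i))"
    unfolding diag_in_eq[of W] B by (simp add: if_distrib if_distribR cong: if_cong)
  also have "\<dots> = (\<Sum>k\<in>UNIV. (cmod (W $ k $ i))\<^sup>2 * diag_in U H $ k)"
    by (intro sum.cong refl) (simp add: cmod_power2, simp add: power2_eq_square algebra_simps)
  finally show ?thesis unfolding W_def .
qed

lemma eigenvalue_vec_permute_diag_in:
  fixes H :: "complex ^ 'n ^ 'n"
  assumes "unitary U" "hermitian H" "\<And>i j. i \<noteq> j \<Longrightarrow> (adj U ** H ** U) $ i $ j = 0"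
  shows "\<exists>p. bij p \<and> eigenvalue_vec H = permute p (diag_in U H)"
proof -
  have charpoly: "\<And>t. det (mat t - H) = (\<Prod>i\<in>UNIV. t - complex_of_real (diag_in U H $ i))"
    by (rule eigenvalue_vec_charpoly) (use assms in auto)
  then have "\<exists>l :: real ^ 'n. \<forall>t. det (mat t - H) = (\<Prod>i\<in>UNIV. t - complex_of_real (l $ i))"
    by blast
  then have "\<forall>t. det (mat t - H) = (\<Prod>i\<in>UNIV. t - complex_of_real (eigenvalue_vec H $ i))"
    unfolding eigenvalue_vec_def by (rule someI_ex)
  then show ?thesis
    by (intro prod_linear_factors_unique) (metis charpoly)
qed

text \<open>The eigenvalues are one of the diagonals, and every diagonal is a doubly stochastic average of
them.  The right-hand side is an intersection of preimages of \<open>C\<close> under linear maps of \<open>H\<close>, so it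
passes convexity, closedness and monotonicity on to \<open>H\<close>.\<close>

lemma eigenvalue_vec_in_symmetric_convex_iff:
  fixes C :: "(real ^ 'n) set"
  assumes "closed C" "convex C" and sym: "\<And>p x. bij p \<Longrightarrow> x \<in> C \<Longrightarrow> permute p x \<in> C"
    and "hermitian H"
  shows "eigenvalue_vec H \<in> C \<longleftrightarrow> (\<forall>V. unitary V \<longrightarrow> diag_in V H \<in> C)"
proof -
  obtain U where U: "unitary U" and off: "\<And>i j. i \<noteq> j \<Longrightarrow> (adj U ** H ** U) $ i $ j = 0"
    using hermitian_diagonalizable[OF assms(4)] by blast
  obtain p where p: "bij p" "eigenvalue_vec H = permute p (diag_in U H)"
    using eigenvalue_vec_permute_diag_in[OF U assms(4) off] by blast
  have "diag_in V H \<in> C" if C: "eigenvalue_vec H \<in> C" and V: "unitary V" for V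
  proof -
    have "diag_in U H = permute (inv p) (eigenvalue_vec H)"
      using p by (simp add: permute_def vec_eq_iff bij_is_surj surj_f_inv_f)
    then have "diag_in U H \<in> C" using sym[OF bij_imp_bij_inv[OF p(1)] C] by simp
    moreover have W: "unitary (adj U ** V)" by (intro unitary_mult unitary_adj U V)
    ultimately have "(\<chi> i. \<Sum>k\<in>UNIV. (cmod ((adj U ** V) $ k $ i))\<^sup>2 * diag_in U H $ k) \<in> C"
      by (intro doubly_stochastic_in_symmetric_convex[OF assms(1,2) sym])
         (auto simp: unitary_row_norm unitary_column_norm)
    also have "(\<chi> i. \<Sum>k\<in>UNIV. (cmod ((adj U ** V) $ k $ i))\<^sup>2 * diag_in U H $ k) = diag_in V H"
      by (simp add: vec_eq_iff diag_in_doubly_stochastic[OF U V assms(4) off])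
    finally show ?thesis .
  qed
  then show ?thesis using U p sym by auto
qed

section \<open>Superlevel sets of the operator\<close>

locale cone_operator =
  fixes \<Gamma> :: "(real ^ 'n) set" and f :: "real ^ 'n \<Rightarrow> real"
  assumes cone: "admissible_cone \<Gamma>" and fn: "admissible_fun \<Gamma> f"
begin

lemma open_cone: "open \<Gamma>" and convex_cone: "convex \<Gamma>"
  and scale_cone: "\<And>x c. x \<in> \<Gamma> \<Longrightarrow> c > 0 \<Longrightarrow> c *\<^sub>R x \<in> \<Gamma>"
  and permute_cone: "\<And>p x. bij p \<Longrightarrow> x \<in> \<Gamma> \<Longrightarrow> permute p x \<in> \<Gamma>"
  using cone unfolding admissible_cone_def by blast+

lemma f_nonneg: "x \<in> closure \<Gamma> \<Longrightarrow> 0 \<le> f x"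
  and continuous_f: "continuous_on (closure \<Gamma>) f"
  and f_permute: "x \<in> closure \<Gamma> \<Longrightarrow> bij p \<Longrightarrow> f (permute p x) = f x"
  and concave_f: "concave_on (closure \<Gamma>) f"
  and f_less: "x \<in> \<Gamma> \<Longrightarrow> t > 0 \<Longrightarrow> x + t *\<^sub>R axis i 1 \<in> \<Gamma> \<Longrightarrow> f x < f (x + t *\<^sub>R axis i 1)"
  using fn unfolding admissible_fun_def by blast+

lemma positive_orthant_subset: 
  assumes "\<And>i. x $ i > 0" shows "x \<in> \<Gamma>"
proof -
  have "sigma k x > 0" if "k \<in> {1..CARD('n)}" for k
  proof -
    obtain J :: "'n set" where "card J = k"
      using obtain_subset_with_card_n[of k "UNIV :: 'n set"] \<open>k \<in> {1..CARD('n)}\<close> atLeastAtMost_iff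
        by blast
    then show ?thesis
      unfolding sigma_def using assms by (intro sum_pos2[of _ J] prod_pos prod_nonneg) (auto
        intro: less_imp_le)
  qed
  then have "x \<in> Gam CARD('n)" by (simp add: Gam_def)
  then show ?thesis using cone by (auto simp: admissible_cone_def)
qed

text \<open>In a convex set, the midpoint of a point of the closure
  and an interior point is interior; a cone
may be rescaled by \<open>2\<close>.\<close>

lemma add_closure_cone: 
  assumes "x \<in> closure \<Gamma>" "y \<in> \<Gamma>" shows "x + y \<in> \<Gamma>"
proof -
  have "x - (1/2) *\<^sub>R (x - y) \<in> interior \<Gamma>"
    using assms open_cone convex_cone
    by (intro mem_interior_closure_convex_shrink) (auto simp: interior_open)
  then have "2 *\<^sub>R (x - (1/2) *\<^sub>R (x - y)) \<in> \<Gamma>"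
    using scale_cone interior_subset by force
  then show ?thesis by (simp add: algebra_simps scaleR_2)
qed

lemma shift_tendsto: "(\<lambda>n. x + (1 / real (Suc n)) *\<^sub>R z) \<longlonglongrightarrow> (x :: real ^ 'n)"
proof -
  have "(\<lambda>n. x + (1 / real (Suc n)) *\<^sub>R z) \<longlonglongrightarrow> x + 0 *\<^sub>R z"
    by (intro tendsto_intros LIMSEQ_Suc[OF lim_1_over_n])
  then show ?thesis by simp
qed

lemma nonneg_orthant_subset: 
  assumes "\<And>i. x $ i \<ge> 0" shows "x \<in> closure \<Gamma>"
proof -
  have "x + (1 / real (Suc n)) *\<^sub>R 1 \<in> \<Gamma>" for n
    by (rule positive_orthant_subset) (use assms in \<open>auto simp: add_nonneg_pos\<close>)
  with shift_tendsto[of x 1] show ?thesis unfolding closure_sequential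
    by (intro exI[of _ "\<lambda>n. x + (1 / real (Suc n)) *\<^sub>R 1"]) auto
qed

lemma permute_closure: 
  assumes "bij p" "x \<in> closure \<Gamma>" shows "permute p x \<in> closure \<Gamma>"
proof -
  have "continuous_on UNIV (permute p :: real ^ 'n \<Rightarrow> _)"
    unfolding permute_def by (intro continuous_intros)
  then have "permute p ` closure \<Gamma> \<subseteq> closure (permute p ` \<Gamma>)"
    by (intro image_closure_subset) (auto intro: continuous_on_subset closure_subset[THEN subsetD])
  also have "\<dots> \<subseteq> closure \<Gamma>" using permute_cone[OF assms(1)] by (intro closure_mono) auto
  finally show ?thesis using assms by blast
qed

text \<open>Adding the coordinates of \<open>p\<close> one at a time reduces this to the monotonicity in one variable.\<close>

lemma f_mono_cone:
  assumes "x \<in> \<Gamma>" "\<And>i. p $ i \<ge> 0" shows "x + p \<in> \<Gamma> \<and> f x \<le> f (x + p)"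
proof -
  have "x + (\<Sum>i\<in>S. p $ i *\<^sub>R axis i 1) \<in> \<Gamma> \<and> f x \<le> f (x + (\<Sum>i\<in>S. p $ i *\<^sub>R axis i 1))"
    if "finite S" for S
    using that
  proof induction
    case (insert j S)
    let ?y = "x + (\<Sum>i\<in>S. p $ i *\<^sub>R axis i 1)"
    have eq: "x + (\<Sum>i\<in>insert j S. p $ i *\<^sub>R axis i 1) = ?y + p $ j *\<^sub>R axis j 1"
      using insert by (simp add: algebra_simps)
    have "p $ j *\<^sub>R axis j 1 \<in> closure \<Gamma>"
      by (rule nonneg_orthant_subset) (use assms in \<open>auto simp: axis_def\<close>)
    then have *: "?y + p $ j *\<^sub>R axis j 1 \<in> \<Gamma>"
      using add_closure_cone insert by (metis add.commute)
    show ?case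
    proof (cases "p $ j = 0")
      case False
      then have "p $ j > 0" using assms(2)[of j] by simp
      then have "f ?y < f (?y + p $ j *\<^sub>R axis j 1)" using insert * by (intro f_less) auto
      then show ?thesis unfolding eq using * insert.IH by auto
    qed (use insert * eq in auto)
  qed (use assms in auto)
  from this[of UNIV] show ?thesis
    using basis_expansion[of p] by (simp add: scalar_mult_eq_scaleR)
qed

text \<open>The boundary case follows by shifting \<open>x\<close> into the cone along \<open>(1, \<dots>, 1)\<close>.\<close>

lemma f_mono:
  assumes x: "x \<in> closure \<Gamma>" and p: "\<And>i. p $ i \<ge> 0" 
  shows "x + p \<in> closure \<Gamma>" "f x \<le> f (x + p)"
proof -
  define e where "e n = (1 / real (Suc n)) *\<^sub>R (1 :: real ^ 'n)" for n
  have in_cone: "x + e n \<in> \<Gamma>" for n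
    by (intro add_closure_cone x positive_orthant_subset) (auto simp: e_def)
  have in_cone': "x + e n + p \<in> \<Gamma> \<and> f (x + e n) \<le> f (x + e n + p)" for n
    by (intro f_mono_cone in_cone p)
  have lim: "(\<lambda>n. x + e n) \<longlonglongrightarrow> x" unfolding e_def by (rule shift_tendsto)
  then have lim': "(\<lambda>n. x + e n + p) \<longlonglongrightarrow> x + p" by (intro tendsto_intros)
  show cl: "x + p \<in> closure \<Gamma>" unfolding closure_sequential using in_cone' lim'
    by (intro exI[of _ "\<lambda>n. x + e n + p"]) auto
  have "(\<lambda>n. f (x + e n)) \<longlonglongrightarrow> f x"
    using continuous_on_tendsto_compose[OF continuous_f lim x] in_cone closure_subset[of \<Gamma>]
      by (simp add: subset_eq)
  moreover have "(\<lambda>n. f (x + e n + p)) \<longlonglongrightarrow> f (x + p)"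
    using continuous_on_tendsto_compose[OF continuous_f lim' cl] in_cone' closure_subset[of \<Gamma>]
      by (simp add: subset_eq)
  ultimately show "f x \<le> f (x + p)" using in_cone' by (intro LIMSEQ_le) auto
qed

definition superlevel :: "real \<Rightarrow> (real ^ 'n) set"
  where "superlevel c = {x \<in> closure \<Gamma>. c \<le> f x}"

lemma closed_superlevel: "closed (superlevel c)"
proof -
  have "superlevel c = closure \<Gamma> \<inter> f -` {c..}" by (auto simp: superlevel_def)
  then show ?thesis using continuous_f continuous_on_closed_vimage[OF closed_closure[of \<Gamma>], of f]
    by (auto simp: Int_commute)
qed

lemma convex_superlevel: "convex (superlevel c)"
proof (rule convexI)
  fix x y u v assume *: "x \<in> superlevel c" "y \<in> superlevel c" "0 \<le> u" "0 \<le> v" "u + v = (1::real)"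
  then have "u * f x + v * f y \<le> f (u *\<^sub>R x + v *\<^sub>R y)"
    using concave_f unfolding concave_on_iff superlevel_def by auto
  moreover have "u * c + v * c \<le> u * f x + v * f y"
    using * by (intro add_mono mult_left_mono) (auto simp: superlevel_def)
  moreover have "u * c + v * c = c" using * by (metis distrib_right mult_1)
  moreover have "u *\<^sub>R x + v *\<^sub>R y \<in> closure \<Gamma>"
    using * convex_closure[OF convex_cone] by (auto simp: superlevel_def convex_def)
  ultimately show "u *\<^sub>R x + v *\<^sub>R y \<in> superlevel c" by (auto simp: superlevel_def)
qed

lemma permute_superlevel: "bij p \<Longrightarrow> x \<in> superlevel c \<Longrightarrow> permute p x \<in> superlevel c"
  by (simp add: superlevel_def permute_closure f_permute)

lemma superlevel_mono: "x \<in> superlevel c \<Longrightarrow> (\<And>i. x $ i \<le> y $ i) \<Longrightarrow> y \<in> superlevel c"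
  using f_mono[of x "y - x"] by (simp add: superlevel_def)

lemma superlevel_antimono: "c \<le> d \<Longrightarrow> superlevel d \<subseteq> superlevel c"
  by (auto simp: superlevel_def)

lemma eigenvalue_vec_superlevel_iff:
  "hermitian H \<Longrightarrow> eigenvalue_vec H \<in> superlevel c \<longleftrightarrow> (\<forall>V. unitary V \<longrightarrow> diag_in V H \<in> superlevel c)"
  by (intro eigenvalue_vec_in_symmetric_convex_iff closed_superlevel convex_superlevel
    permute_superlevel)

lemma diag_in_add_mat:
  fixes H :: "complex ^ 'n ^ 'n"
  assumes "unitary U" shows "diag_in U (H + mat (complex_of_real e)) = diag_in U H + e *\<^sub>R 1"
proof -
  have "sesq (mat t) x y = t * sesq (mat 1) x y" for t and x y :: "complex ^ 'n"
    by (simp add: sesq_def mat_def sum_distrib_left if_distrib if_distribR cong: if_cong)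
       (simp add: algebra_simps)
  from this[of "complex_of_real e"]
  have "sesq (mat (complex_of_real e)) (column i U) (column i U) = complex_of_real e" for i
    using assms unfolding unitary_iff_columns by simp
  moreover have "sesq (H + K) x y = sesq H x y + sesq K x y" for K :: "complex ^ 'n ^ 'n" and x y
    by (simp add: sesq_def algebra_simps sum.distrib)
  ultimately show ?thesis
    by (simp add: diag_in_def conjugate_entry vec_eq_iff)
qed

lemma hermitian_add_mat: "hermitian H \<Longrightarrow> hermitian (H + mat (complex_of_real e))"
proof -
  assume "hermitian H"
  moreover have "adj (H + mat (complex_of_real e)) = adj H + mat (complex_of_real e)"
    by (simp add: vec_eq_iff adj_def mat_def)
  ultimately show ?thesis by (simp add: hermitian_iff_adj)
qed

text \<open>In a basis of eigenvectors the diagonal is a permutation of the eigenvalues.\<close>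

lemma M_coneI:
  assumes "hermitian H" "\<And>U. unitary U \<Longrightarrow> diag_in U H \<in> \<Gamma>" shows "H \<in> M_cone \<Gamma>"
proof -
  obtain U where "unitary U" "\<And>i j. i \<noteq> j \<Longrightarrow> (adj U ** H ** U) $ i $ j = 0"
    using hermitian_diagonalizable[OF assms(1)] by blast
  then show ?thesis
    using assms eigenvalue_vec_permute_diag_in[of U H] permute_cone by (auto simp: M_cone_def)
qed

lemma closed_hermitian: "closed {H :: complex ^ 'n ^ 'n. hermitian H}"
proof -
  have "continuous_on UNIV (\<lambda>H :: complex ^ 'n ^ 'n. adj H)"
    unfolding adj_def by (intro continuous_intros)
  then show ?thesis
    unfolding hermitian_iff_adj by (intro closed_Collect_eq continuous_on_id)
qed

text \<open>The right-hand side is closed by the description with diagonals.  A matrix in it is the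
  limit of
its shifts by positive multiples of the identity, whose diagonals lie in the open cone.\<close>

lemma closure_M_cone:
  "closure (M_cone \<Gamma>) = {H. hermitian H \<and> eigenvalue_vec H \<in> closure \<Gamma>}"
proof -
  have sl: "superlevel 0 = closure \<Gamma>" using f_nonneg by (auto simp: superlevel_def)
  have eq: "{H. hermitian H \<and> eigenvalue_vec H \<in> closure \<Gamma>} =
      {H. hermitian H} \<inter> (\<Inter>V\<in>{V. unitary V}. {H. diag_in V H \<in> superlevel 0})"
    using eigenvalue_vec_superlevel_iff[of _ 0] unfolding sl by blast
  have cont: "continuous_on UNIV (\<lambda>H. diag_in V H)" for V :: "complex ^ 'n ^ 'n"
    unfolding diag_in_def matrix_matrix_mult_def by (intro continuous_intros)
  have "closed {H. diag_in V H \<in> superlevel 0}" for V :: "complex ^ 'n ^ 'n"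
    using closed_vimage[OF closed_superlevel cont] by (simp add: vimage_def)
  then have "closed {H. hermitian H \<and> eigenvalue_vec H \<in> closure \<Gamma>}"
    unfolding eq by (intro closed_Int closed_hermitian closed_INT) auto
  moreover have "M_cone \<Gamma> \<subseteq> {H. hermitian H \<and> eigenvalue_vec H \<in> closure \<Gamma>}"
    using closure_subset by (auto simp: M_cone_def)
  ultimately have "closure (M_cone \<Gamma>) \<subseteq> {H. hermitian H \<and> eigenvalue_vec H \<in> closure \<Gamma>}"
    by (intro closure_minimal)
  moreover have "H \<in> closure (M_cone \<Gamma>)" if H: "hermitian H" "eigenvalue_vec H \<in> closure \<Gamma>" for H
  proof -
    define e where "e n = 1 / real (Suc n)" for n
    have "H + mat (complex_of_real (e n)) \<in> M_cone \<Gamma>" for n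
    proof (rule M_coneI)
      show "hermitian (H + mat (complex_of_real (e n)))" by (rule hermitian_add_mat) fact
      fix U :: "complex ^ 'n ^ 'n" assume U: "unitary U"
      then have "diag_in U H \<in> closure \<Gamma>"
        using eigenvalue_vec_superlevel_iff[OF H(1), of 0] H(2) by (simp add: sl)
      then show "diag_in U (H + mat (complex_of_real (e n))) \<in> \<Gamma>"
        unfolding diag_in_add_mat[OF U]
        by (intro add_closure_cone positive_orthant_subset) (auto simp: e_def)
    qed
    moreover have "(\<lambda>n. H + mat (complex_of_real (e n))) \<longlonglongrightarrow> H"
    proof (intro vec_tendstoI)
      fix i j
      have lim: "(\<lambda>n. complex_of_real (e n)) \<longlonglongrightarrow> of_real 0"
        unfolding e_def by (intro tendsto_of_real LIMSEQ_Suc[OF lim_1_over_n])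
      then have "(\<lambda>n. H $ i $ j + (if i = j then complex_of_real (e n) else 0)) \<longlonglongrightarrow> H $ i $ j + 0"
        using tendsto_add[OF tendsto_const[of "H $ i $ j"] lim] by (cases "i = j") auto
      then show "(\<lambda>n. (H + mat (complex_of_real (e n))) $ i $ j) \<longlonglongrightarrow> H $ i $ j"
        by (simp add: mat_def)
    qed
    ultimately show ?thesis unfolding closure_sequential
      by (intro exI[of _ "\<lambda>n. H + mat (complex_of_real (e n))"]) auto
  qed
  ultimately show ?thesis by blast
qed

text \<open>For a real bound \<open>c\<close> the value \<open>-\<infinity>\<close> outside the closed cone makes the inequality fail there,
  which
agrees with the right-hand side because \<open>superlevel c\<close> is a subset of \<open>closure \<Gamma>\<close>.\<close>

lemma F_op_ge_iff:
  assumes "hermitian H"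
  shows "F_op \<Gamma> f H \<ge> ereal c \<longleftrightarrow> (\<forall>V. unitary V \<longrightarrow> diag_in V H \<in> superlevel c)"
  unfolding eigenvalue_vec_superlevel_iff[OF assms, symmetric]
  using assms by (simp add: F_op_def closure_M_cone superlevel_def)

end

section \<open>Directional derivatives\<close>

definition dir_deriv :: "'a::real_normed_vector \<Rightarrow> ('a \<Rightarrow> 'b::real_normed_vector) \<Rightarrow> 'a \<Rightarrow> 'b"
  where "dir_deriv v g x = frechet_derivative g (at x) v"

lemma Ck_on_Suc:
  "Ck_on (Suc k) U g \<longleftrightarrow> (\<forall>x\<in>U. g differentiable (at x)) \<and> (\<forall>v. Ck_on k U (dir_deriv v g))"
  by (simp add: dir_deriv_def[abs_def])

declare Ck_on.simps(2) [simp del]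

lemma dir_derivI: "(g has_derivative g') (at x) \<Longrightarrow> dir_deriv v g x = g' v"
  unfolding dir_deriv_def by (simp add: frechet_derivative_at[symmetric])

lemma has_derivative_dir_deriv: "g differentiable (at x) \<Longrightarrow> (g has_derivative (\<lambda>v. dir_deriv v g
  x)) (at x)"
  unfolding dir_deriv_def using frechet_derivative_works by blast

lemma linear_dir_deriv: "g differentiable (at x) \<Longrightarrow> linear (\<lambda>v. dir_deriv v g x)"
  unfolding dir_deriv_def by (rule linear_frechet_derivative)

lemma dir_deriv_cong:
  assumes "open U" "x \<in> U" "\<And>y. y \<in> U \<Longrightarrow> g y = h y"
  shows "dir_deriv v g x = dir_deriv v h x"
proof -
  have "(g has_derivative g') (at x) \<longleftrightarrow> (h has_derivative g') (at x)" for g'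
    using assms has_derivative_transform_within_open[of g g' x UNIV U h]
      has_derivative_transform_within_open[of h g' x UNIV U g] by auto
  then show ?thesis by (simp add: dir_deriv_def frechet_derivative_def)
qed

lemma Ck_on_cong:
  assumes "open U" "\<And>y. y \<in> U \<Longrightarrow> g y = h y" "Ck_on k U g"
  shows "Ck_on k U h"
  using assms(2,3)
proof (induction k arbitrary: g h)
  case 0
  then show ?case by (auto cong: continuous_on_cong_simp)
next
  case (Suc k)
  have "h differentiable (at x)" if "x \<in> U" for x
  proof -
    have "(g has_derivative (\<lambda>v. dir_deriv v g x)) (at x)"
      using Suc that by (intro has_derivative_dir_deriv) (auto simp: Ck_on_Suc)
    from has_derivative_transform_within_open[OF this assms(1) that] show ?thesis
      using Suc.prems(1) by (auto simp: differentiable_def)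
  qed
  moreover have "Ck_on k U (dir_deriv v h)" for v
    by (rule Suc.IH[of "dir_deriv v g"]) (use Suc.prems dir_deriv_cong[OF assms(1), of _ g h] in
      \<open>auto simp: Ck_on_Suc\<close>)
  ultimately show ?case by (simp add: Ck_on_Suc)
qed

lemma Ck_on_subset: "Ck_on k U g \<Longrightarrow> V \<subseteq> U \<Longrightarrow> Ck_on k V g"
proof (induction k arbitrary: g)
  case 0
  then show ?case using continuous_on_subset by auto
next
  case (Suc k)
  then show ?case by (simp add: Ck_on_Suc) blast
qed

lemma Ck_on_imp_differentiable: "Ck_on (Suc k) U g \<Longrightarrow> x \<in> U \<Longrightarrow> g differentiable (at x)"
  by (simp add: Ck_on_Suc)

lemma Ck_on_dir_deriv: "Ck_on (Suc k) U g \<Longrightarrow> Ck_on k U (dir_deriv v g)"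
  by (simp add: Ck_on_Suc)

lemma Ck_on_SucD: "Ck_on (Suc k) U g \<Longrightarrow> Ck_on k U g"
proof (induction k arbitrary: g)
  case 0
  then have "continuous_on U g"
    by (intro continuous_at_imp_continuous_on ballI differentiable_imp_continuous_within) (auto
      simp: Ck_on_Suc)
  then show ?case by simp
next
  case (Suc k)
  have "Ck_on k U (dir_deriv v g)" for v
    using Suc.prems by (intro Suc.IH) (auto simp: Ck_on_Suc[of "Suc k"])
  then show ?case using Suc.prems by (simp add: Ck_on_Suc)
qed

lemma Ck_on_imp_continuous_on: "Ck_on k U g \<Longrightarrow> continuous_on U g"
  by (induction k) (auto dest: Ck_on_SucD)

lemma Ck_on_const: "Ck_on k U (\<lambda>_. c)"
proof (induction k arbitrary: c)
  case (Suc k)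
  have "dir_deriv v (\<lambda>_. c) = (\<lambda>_. 0)" for v :: 'a and c :: 'b
    by (rule ext) (rule dir_derivI, rule has_derivative_const)
  then show ?case using Suc by (simp add: Ck_on_Suc)
qed simp

lemma dir_deriv_add:
  assumes "g differentiable (at x)" "h differentiable (at x)"
  shows "dir_deriv v (\<lambda>x. g x + h x) x = dir_deriv v g x + dir_deriv v h x"
  by (rule dir_derivI) (intro has_derivative_add has_derivative_dir_deriv assms)

lemma dir_deriv_scaleR:
  assumes "g differentiable (at x)"
  shows "dir_deriv v (\<lambda>x. c *\<^sub>R g x) x = c *\<^sub>R dir_deriv v g x"
  by (rule dir_derivI) (intro has_derivative_scaleR_right has_derivative_dir_deriv assms)

lemma Ck_on_add:
  assumes "open U" shows "Ck_on k U g \<Longrightarrow> Ck_on k U h \<Longrightarrow> Ck_on k U (\<lambda>x. g x + h x)"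
proof (induction k arbitrary: g h)
  case 0
  then show ?case by (simp add: continuous_on_add)
next
  case (Suc k)
  have "Ck_on k U (dir_deriv v (\<lambda>x. g x + h x))" for v
    by (rule Ck_on_cong[OF assms _ Suc.IH[of "dir_deriv v g" "dir_deriv v h"]])
       (use Suc.prems in \<open>auto simp: Ck_on_Suc dir_deriv_add\<close>)
  then show ?case using Suc.prems by (simp add: Ck_on_Suc)
qed

lemma Ck_on_scaleR:
  assumes "open U" shows "Ck_on k U g \<Longrightarrow> Ck_on k U (\<lambda>x. c *\<^sub>R g x)"
proof (induction k arbitrary: g)
  case 0
  then show ?case by (simp add: continuous_on_scaleR)
next
  case (Suc k)
  have "Ck_on k U (dir_deriv v (\<lambda>x. c *\<^sub>R g x))" for v
    by (rule Ck_on_cong[OF assms _ Suc.IH[of "dir_deriv v g"]])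
       (use Suc.prems in \<open>auto simp: Ck_on_Suc dir_deriv_scaleR\<close>)
  moreover have "(\<lambda>x. c *\<^sub>R g x) differentiable (at x)" if "x \<in> U" for x
    using has_derivative_scaleR_right[OF has_derivative_dir_deriv, of g x c] Suc.prems that
    by (auto simp: Ck_on_Suc differentiable_def)
  ultimately show ?case by (simp add: Ck_on_Suc)
qed

lemma has_derivative_translate:
  assumes "(g has_derivative g') (at (x + a))"
  shows "((\<lambda>y. g (y + a)) has_derivative g') (at x)"
proof -
  have "((\<lambda>y. y + a) has_derivative (\<lambda>h. h)) (at x)" by (auto intro!: derivative_eq_intros)
  from diff_chain_at[OF this assms] show ?thesis by (simp add: o_def)
qed

lemma dir_deriv_translate:
  assumes "g differentiable (at (x + a))"
  shows "dir_deriv v (\<lambda>y. g (y + a)) x = dir_deriv v g (x + a)"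
  by (intro dir_derivI has_derivative_translate has_derivative_dir_deriv assms)

lemma smooth_on_imp_Ck_on: "smooth_on U w \<Longrightarrow> Ck_on k U w"
  by (simp add: smooth_on_def)

lemma smooth_on_imp_differentiable: "smooth_on U g \<Longrightarrow> x \<in> U \<Longrightarrow> g differentiable (at x)"
  unfolding smooth_on_def using Ck_on_imp_differentiable by blast

lemma smooth_on_dir_deriv: "smooth_on U g \<Longrightarrow> smooth_on U (dir_deriv v g)"
  unfolding smooth_on_def using Ck_on_dir_deriv by blast

lemma smooth_on_subset: "smooth_on U g \<Longrightarrow> V \<subseteq> U \<Longrightarrow> smooth_on V g"
  unfolding smooth_on_def using Ck_on_subset by blast

lemma smooth_on_imp_continuous_on: "smooth_on U g \<Longrightarrow> continuous_on U g"
  unfolding smooth_on_def using Ck_on_imp_continuous_on by blast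

lemma smooth_on_add: "open U \<Longrightarrow> smooth_on U g \<Longrightarrow> smooth_on U h \<Longrightarrow> smooth_on U (\<lambda>x. g x + h x)"
  unfolding smooth_on_def using Ck_on_add by blast

lemma smooth_on_scaleR: "open U \<Longrightarrow> smooth_on U g \<Longrightarrow> smooth_on U (\<lambda>x. c *\<^sub>R g x)"
  unfolding smooth_on_def using Ck_on_scaleR by blast

lemma smooth_on_const: "smooth_on U (\<lambda>_. c)"
  unfolding smooth_on_def using Ck_on_const by blast

lemma smooth_on_cong: "open U \<Longrightarrow> (\<And>y. y \<in> U \<Longrightarrow> g y = h y) \<Longrightarrow> smooth_on U g \<Longrightarrow> smooth_on U h"
  unfolding smooth_on_def using Ck_on_cong by metis

text \<open>Smoothness by coinduction: it suffices to exhibit a class of differentiable functions that is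
closed under directional derivatives.\<close>

lemma smooth_on_UNIV_coinduct:
  assumes "g \<in> X" 
    and diff: "\<And>g x. g \<in> X \<Longrightarrow> g differentiable (at x)"
    and deriv: "\<And>g v. g \<in> X \<Longrightarrow> dir_deriv v g \<in> X"
  shows "smooth_on UNIV g"
proof -
  have "Ck_on k UNIV g" if "g \<in> X" for k g
    using that
  proof (induction k arbitrary: g)
    case 0
    then show ?case
      using diff by (auto intro!: continuous_at_imp_continuous_on
        differentiable_imp_continuous_within)
  qed (use diff deriv in \<open>auto simp: Ck_on_Suc\<close>)
  then show ?thesis using assms(1) by (auto simp: smooth_on_def)
qed

lemma smooth_on_translate: "smooth_on UNIV g \<Longrightarrow> smooth_on UNIV (\<lambda>x. g (x + a))"
proof (rule smooth_on_UNIV_coinduct[where X = "{\<lambda>x. g (x + a) | g. smooth_on UNIV g}"])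
  fix h :: "'a \<Rightarrow> 'b" and x v :: 'a
  assume "h \<in> {\<lambda>x. g (x + a) |g. smooth_on UNIV g}"
  then obtain g where g: "h = (\<lambda>x. g (x + a))" "smooth_on UNIV g" by blast
  note d = smooth_on_imp_differentiable[OF g(2) UNIV_I]
  show "h differentiable (at x)"
    using has_derivative_translate[OF has_derivative_dir_deriv[OF d]] g
      by (auto simp: differentiable_def)
  have "dir_deriv v h = (\<lambda>x. dir_deriv v g (x + a))"
    unfolding g using dir_deriv_translate[OF d] by auto
  then show "dir_deriv v h \<in> {\<lambda>x. g (x + a) |g. smooth_on UNIV g}"
    using smooth_on_dir_deriv[OF g(2)] by blast
qed auto

section \<open>Quadratic functions\<close>

lemma has_derivative_quadratic:
  "((\<lambda>x::'a::real_inner. a * (x \<bullet> x) + x \<bullet> c + d) has_derivative (\<lambda>v. 2 * a * (x \<bullet> v) + v \<bullet> c))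
    (at x)"
  by (auto intro!: derivative_eq_intros simp: inner_commute algebra_simps)

text \<open>The derivative is kept in the shape of a quadratic, so that the rule applies to it again.\<close>

lemma dir_deriv_quadratic:
  "dir_deriv v (\<lambda>x::'a::real_inner. a * (x \<bullet> x) + x \<bullet> c + d) =
    (\<lambda>x. 0 * (x \<bullet> x) + x \<bullet> ((2 * a) *\<^sub>R v) + v \<bullet> c)"
  by (rule ext) (simp add: dir_derivI[OF has_derivative_quadratic])

lemma smooth_on_quadratic: "smooth_on U (\<lambda>x::'a::real_inner. a * (x \<bullet> x) + x \<bullet> c + d)"
proof -
  have "smooth_on UNIV (\<lambda>x::'a. a * (x \<bullet> x) + x \<bullet> c + d)"
  proof (rule smooth_on_UNIV_coinduct[where X = "{\<lambda>x. a * (x \<bullet> x) + x \<bullet> c + d | a c d. True}"])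
    fix g :: "'a \<Rightarrow> real" and x v assume "g \<in> {\<lambda>x. a * (x \<bullet> x) + x \<bullet> c + d | a c d. True}"
    then obtain a c d where g: "g = (\<lambda>x. a * (x \<bullet> x) + x \<bullet> c + d)" by blast
    show "g differentiable (at x)" unfolding g differentiable_def
      using has_derivative_quadratic by blast
    show "dir_deriv v g \<in> {\<lambda>x. a * (x \<bullet> x) + x \<bullet> c + d | a c d. True}"
      unfolding g dir_deriv_quadratic by blast
  qed blast
  then show ?thesis by (rule smooth_on_subset) simp
qed

lemma dir_deriv2_quadratic:
  "dir_deriv u (dir_deriv v (\<lambda>x::'a::real_inner. a * (x \<bullet> x) + x \<bullet> c + d)) x = 2 * a * (u \<bullet> v)"
  unfolding dir_deriv_quadratic by simp

section \<open>Second derivatives\<close>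

lemma Ck_on_2D:
  assumes "Ck_on 2 U g"
  shows "x \<in> U \<Longrightarrow> g differentiable (at x)" "x \<in> U \<Longrightarrow> dir_deriv v g differentiable (at x)"
    "continuous_on U (dir_deriv u (dir_deriv v g))" "Ck_on (Suc 0) U (dir_deriv v g)"
  using assms by (auto simp: numeral_2_eq_2 Ck_on_Suc)

lemma dir_deriv2_add:
  assumes "open U" "Ck_on 2 U g" "Ck_on 2 U h" "x \<in> U"
  shows "dir_deriv u (dir_deriv v (\<lambda>x. g x + h x)) x = dir_deriv u (dir_deriv v g) x + dir_deriv u
    (dir_deriv v h) x"
proof -
  have "dir_deriv u (dir_deriv v (\<lambda>x. g x + h x)) x = dir_deriv u (\<lambda>x. dir_deriv v g x + dir_deriv
    v h x) x"
    by (rule dir_deriv_cong[OF assms(1,4)]) (use Ck_on_2D[OF assms(2)] Ck_on_2D[OF assms(3)] in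
      \<open>auto intro: dir_deriv_add\<close>)
  also have "\<dots> = dir_deriv u (dir_deriv v g) x + dir_deriv u (dir_deriv v h) x"
    using Ck_on_2D[OF assms(2)] Ck_on_2D[OF assms(3)] assms(4) by (intro dir_deriv_add)
  finally show ?thesis .
qed

lemma dir_deriv2_scaleR:
  assumes "open U" "Ck_on 2 U g" "x \<in> U"
  shows "dir_deriv u (dir_deriv v (\<lambda>x. c *\<^sub>R g x)) x = c *\<^sub>R dir_deriv u (dir_deriv v g) x"
proof -
  have "dir_deriv u (dir_deriv v (\<lambda>x. c *\<^sub>R g x)) x = dir_deriv u (\<lambda>x. c *\<^sub>R dir_deriv v g x) x"
    by (rule dir_deriv_cong[OF assms(1,3)]) (use Ck_on_2D[OF assms(2)] in \<open>auto intro: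
      dir_deriv_scaleR\<close>)
  also have "\<dots> = c *\<^sub>R dir_deriv u (dir_deriv v g) x"
    using Ck_on_2D[OF assms(2)] assms(3) by (intro dir_deriv_scaleR)
  finally show ?thesis .
qed

lemma dir_deriv2_cong:
  assumes "open U" "x \<in> U" "\<And>y. y \<in> U \<Longrightarrow> g y = h y"
  shows "dir_deriv u (dir_deriv v g) x = dir_deriv u (dir_deriv v h) x"
  by (rule dir_deriv_cong[OF assms(1,2)]) (rule dir_deriv_cong[OF assms(1) _ assms(3)])

lemma linear_dir_deriv2:
  assumes "open U" "Ck_on 2 U g" "x \<in> U"
  shows "linear (\<lambda>u. dir_deriv u (dir_deriv v g) x)" "linear (\<lambda>v. dir_deriv u (dir_deriv v g) x)"
proof -
  show "linear (\<lambda>u. dir_deriv u (dir_deriv v g) x)"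
    using Ck_on_2D[OF assms(2)] assms(3) by (intro linear_dir_deriv)
  have lin: "linear (\<lambda>v. dir_deriv v g y)" if "y \<in> U" for y
    using Ck_on_2D[OF assms(2)] that by (intro linear_dir_deriv)
  show "linear (\<lambda>v. dir_deriv u (dir_deriv v g) x)"
  proof (rule linearI)
    fix v w c
    have "dir_deriv u (dir_deriv (v + w) g) x = dir_deriv u (\<lambda>y. dir_deriv v g y + dir_deriv w g
      y) x"
      by (rule dir_deriv_cong[OF assms(1,3)]) (use lin in \<open>auto dest: linear_add\<close>)
    also have "\<dots> = dir_deriv u (dir_deriv v g) x + dir_deriv u (dir_deriv w g) x"
      using Ck_on_2D[OF assms(2)] assms(3) by (intro dir_deriv_add)
    finally show "dir_deriv u (dir_deriv (v + w) g) x = dir_deriv u (dir_deriv v g) x + dir_deriv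
      u (dir_deriv w g) x" .
    have "dir_deriv u (dir_deriv (c *\<^sub>R v) g) x = dir_deriv u (\<lambda>y. c *\<^sub>R dir_deriv v g y) x"
      by (rule dir_deriv_cong[OF assms(1,3)]) (use lin in \<open>auto dest: linear_scale\<close>)
    also have "\<dots> = c *\<^sub>R dir_deriv u (dir_deriv v g) x"
      using Ck_on_2D[OF assms(2)] assms(3) by (intro dir_deriv_scaleR)
    finally show "dir_deriv u (dir_deriv (c *\<^sub>R v) g) x = c *\<^sub>R dir_deriv u (dir_deriv v g) x" .
  qed
qed

lemma has_real_derivative_along_line:
  fixes g :: "'a::real_normed_vector \<Rightarrow> real"
  assumes "g differentiable (at (x + t *\<^sub>R v))"
  shows "((\<lambda>t. g (x + t *\<^sub>R v)) has_real_derivative dir_deriv v g (x + t *\<^sub>R v)) (at t)"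
proof -
  have "((\<lambda>t. x + t *\<^sub>R v) has_derivative (\<lambda>h. h *\<^sub>R v)) (at t)"
    by (auto intro!: derivative_eq_intros)
  from diff_chain_at[OF this has_derivative_dir_deriv[OF assms]]
  have "((\<lambda>t. g (x + t *\<^sub>R v)) has_derivative (\<lambda>h. dir_deriv (h *\<^sub>R v) g (x + t *\<^sub>R v))) (at t)"
    by (simp add: o_def)
  moreover have "dir_deriv (h *\<^sub>R v) g (x + t *\<^sub>R v) = dir_deriv v g (x + t *\<^sub>R v) * h" for h
    using linear_scale[OF linear_dir_deriv[OF assms]] by simp
  ultimately show ?thesis by (simp add: has_field_derivative_def mult.commute[of _ "dir_deriv v g
    (x + t *\<^sub>R v)"])
qed

text \<open>A negative second derivative along a line would make the first derivative, which vanishes at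
  the
minimum, negative on one side of it.\<close>

lemma local_min_imp_dir_deriv2_nonneg:
  fixes g :: "'a::real_normed_vector \<Rightarrow> real"
  assumes "open U" "Ck_on 2 U g" "x \<in> U" and min: "\<And>y. y \<in> U \<Longrightarrow> g x \<le> g y"
  shows "0 \<le> dir_deriv v (dir_deriv v g) x"
proof (rule ccontr)
  assume neg: "\<not> 0 \<le> dir_deriv v (dir_deriv v g) x"
  have "open ((\<lambda>t. x + t *\<^sub>R v) -` U)" 
    by (intro open_vimage assms(1) continuous_intros)
  moreover have "0 \<in> (\<lambda>t. x + t *\<^sub>R v) -` U" using assms(3) by simp
  ultimately obtain d where d: "d > 0" "\<And>t. \<bar>t\<bar> < d \<Longrightarrow> x + t *\<^sub>R v \<in> U"
    unfolding open_contains_ball by (metis (no_types, lifting) UNIV_I diff_0 dist_real_def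
      abs_minus_cancel mem_ball subset_eq vimageE)
  note D1 = has_real_derivative_along_line[OF Ck_on_2D(1)[OF assms(2)]]
  note D2 = has_real_derivative_along_line[OF Ck_on_2D(2)[OF assms(2)]]
  have D1_0: "((\<lambda>t. g (x + t *\<^sub>R v)) has_real_derivative dir_deriv v g x) (at 0)"
    using D1[of x 0 v] assms(3) by simp
  have zero: "dir_deriv v g x = 0"
    by (rule DERIV_local_min[OF D1_0 d(1)]) (use d(2) min in auto)
  have D2_0: "((\<lambda>t. dir_deriv v g (x + t *\<^sub>R v)) has_real_derivative dir_deriv v (dir_deriv v g)
    x) (at 0)"
    using D2[of x 0 v v] assms(3) by simp
  from DERIV_neg_dec_right[OF D2_0] neg
  obtain e where e: "e > 0" "\<And>h. h > 0 \<Longrightarrow> h < e \<Longrightarrow> dir_deriv v g (x + h *\<^sub>R v) < 0"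
    using zero by auto
  define s where "s = min d e / 2"
  have s: "0 < s" "s < d" "s < e" using d e by (auto simp: s_def)
  have "\<exists>t. 0 < t \<and> t < s \<and> g (x + s *\<^sub>R v) - g (x + 0 *\<^sub>R v) =
    (s - 0) * dir_deriv v g (x + t *\<^sub>R v)"
    using s d by (intro MVT2) (auto intro!: D1)
  then obtain t where "0 < t" "t < s" "g (x + s *\<^sub>R v) - g x = s * dir_deriv v g (x + t *\<^sub>R v)"
    by auto
  moreover have "s * dir_deriv v g (x + t *\<^sub>R v) < 0"
    using e(2)[of t] s \<open>0 < t\<close> \<open>t < s\<close> by (intro mult_pos_neg) auto
  ultimately show False using min[OF d(2)[of s]] s by simp
qed

text \<open>An exact mean value form of the symmetric second difference: its error against the second
derivative at \<open>x\<close> is controlled by the modulus of continuity of that derivative alone.\<close>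

lemma second_difference:
  fixes g :: "'a::real_normed_vector \<Rightarrow> real"
  assumes "Ck_on 2 UNIV g" "h > 0"
  obtains t where "0 < t" "t < h"
    "g (x + h *\<^sub>R v) + g (x - h *\<^sub>R v) - 2 * g x =
     h\<^sup>2 / 2 * (dir_deriv v (dir_deriv v g) (x + t *\<^sub>R v) + dir_deriv v (dir_deriv v g) (x - t *\<^sub>R
       v))"
proof -
  define p where "p k t = (if k = (0::nat) then g (x + t *\<^sub>R v) + g (x - t *\<^sub>R v)
    else if k = 1 then dir_deriv v g (x + t *\<^sub>R v) - dir_deriv v g (x - t *\<^sub>R v)
    else dir_deriv v (dir_deriv v g) (x + t *\<^sub>R v) + dir_deriv v (dir_deriv v g) (x - t *\<^sub>R v))"
      for k t
  note D1 = has_real_derivative_along_line[OF Ck_on_2D(1)[OF assms(1) UNIV_I]]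
  note D2 = has_real_derivative_along_line[OF Ck_on_2D(2)[OF assms(1) UNIV_I]]
  have D2': "((\<lambda>t. dir_deriv v g (x + t *\<^sub>R v)) has_real_derivative dir_deriv v (dir_deriv v g) (x
    + t *\<^sub>R v)) (at t)" for t
    by (rule D2)
  have D1': "((\<lambda>t. g (x + t *\<^sub>R v)) has_real_derivative dir_deriv v g (x + t *\<^sub>R v)) (at t)" for t
    by (rule D1)
  have reflect: "((\<lambda>t. q (- t)) has_real_derivative - q' (- t)) (at t)"
    if "\<And>t. (q has_real_derivative q' t) (at t)" for q q' :: "real \<Rightarrow> real" and t
  proof -
    have "((\<lambda>t. - t) has_real_derivative - 1) (at t)" by (auto intro!: derivative_eq_intros)
    from DERIV_chain2[OF that[of "- t"] this] show ?thesis by simp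
  qed
  have "(p 0 has_real_derivative p 1 t) (at t)" for t
    using DERIV_add[OF D1'[of t] reflect[OF D1', of t]] by (simp add: p_def[abs_def])
  moreover have "(p 1 has_real_derivative p 2 t) (at t)" for t
    using DERIV_diff[OF D2'[of t] reflect[OF D2', of t]] by (simp add: p_def[abs_def])
  ultimately have "\<forall>m t. m < 2 \<and> 0 \<le> t \<and> t \<le> h \<longrightarrow> (p m has_real_derivative p (Suc m) t) (at t)"
    by (metis One_nat_def less_2_cases_iff numeral_2_eq_2)
  from Maclaurin[OF assms(2) _ refl this]
  obtain t where "0 < t" "t < h" "p 0 h = (\<Sum>m<2. p m 0 / fact m * h ^ m) + p 2 t / fact 2 * h ^ 2"
    by auto
  moreover from this have "g (x + h *\<^sub>R v) + g (x - h *\<^sub>R v) - 2 * g x =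
     h\<^sup>2 / 2 * (dir_deriv v (dir_deriv v g) (x + t *\<^sub>R v) + dir_deriv v (dir_deriv v g) (x - t *\<^sub>R
       v))"
    by (simp add: p_def numeral_2_eq_2 field_simps)
  ultimately show thesis using that by blast
qed

text \<open>The left-hand side is symmetric in \<open>u\<close> and \<open>v\<close>, and the right-hand side is a mixed
  derivative at a
nearby point; hence the theorem of Schwarz below.\<close>

lemma mixed_difference:
  fixes g :: "'a::real_normed_vector \<Rightarrow> real"
  assumes "Ck_on 2 U g" "s > 0" and U: "\<And>q r. 0 \<le> q \<Longrightarrow> q \<le> s \<Longrightarrow> 0 \<le> r \<Longrightarrow> r \<le> s \<Longrightarrow>
    x + q *\<^sub>R u + r *\<^sub>R v \<in> U"
  obtains q r where "0 < q" "q < s" "0 < r" "r < s"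
    "g (x + s *\<^sub>R u + s *\<^sub>R v) - g (x + s *\<^sub>R u) - g (x + s *\<^sub>R v) + g x =
     s\<^sup>2 * dir_deriv u (dir_deriv v g) (x + q *\<^sub>R u + r *\<^sub>R v)"
proof -
  note D1 = has_real_derivative_along_line[OF Ck_on_2D(1)[OF assms(1)]]
  note D2 = has_real_derivative_along_line[OF Ck_on_2D(2)[OF assms(1)]]
  let ?p = "\<lambda>r. g ((x + s *\<^sub>R u) + r *\<^sub>R v) - g (x + r *\<^sub>R v)"
  have "\<exists>r. 0 < r \<and> r < s \<and> ?p s - ?p 0 = (s - 0) * (dir_deriv v g ((x + s *\<^sub>R u) + r *\<^sub>R v) -
    dir_deriv v g (x + r *\<^sub>R v))"
    using assms(2) U[of 0] U[of s]
    by (intro MVT2 DERIV_diff D1) auto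
  then obtain r where r: "0 < r" "r < s" 
    "?p s - ?p 0 = s * (dir_deriv v g ((x + s *\<^sub>R u) + r *\<^sub>R v) - dir_deriv v g (x + r *\<^sub>R v))"
      by auto
  have "\<exists>q. 0 < q \<and> q < s \<and> dir_deriv v g ((x + r *\<^sub>R v) + s *\<^sub>R u) - dir_deriv v g ((x + r *\<^sub>R v)
    + 0 *\<^sub>R u)
      = (s - 0) * dir_deriv u (dir_deriv v g) ((x + r *\<^sub>R v) + q *\<^sub>R u)"
    using r U[of _ r] assms(2) by (intro MVT2 D2) (auto simp: ac_simps)
  then obtain q where q: "0 < q" "q < s" "dir_deriv v g ((x + s *\<^sub>R u) + r *\<^sub>R v) - dir_deriv v g
    (x + r *\<^sub>R v)
      = s * dir_deriv u (dir_deriv v g) (x + q *\<^sub>R u + r *\<^sub>R v)" by (auto simp: ac_simps)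
  show thesis
    by (rule that[OF q(1,2) r(1,2)]) (use r(3) q(3) in \<open>simp add: power2_eq_square algebra_simps\<close>)
qed

lemma dir_deriv2_commute:
  fixes g :: "'a::real_normed_vector \<Rightarrow> real"
  assumes "open U" "Ck_on 2 U g" "x \<in> U"
  shows "dir_deriv u (dir_deriv v g) x = dir_deriv v (dir_deriv u g) x"
proof (rule ccontr)
  let ?A = "dir_deriv u (dir_deriv v g)" and ?B = "dir_deriv v (dir_deriv u g)"
  assume "?A x \<noteq> ?B x"
  define e where "e = \<bar>?A x - ?B x\<bar> / 2"
  have e: "e > 0" using \<open>?A x \<noteq> ?B x\<close> by (simp add: e_def)
  have "isCont ?A x" "isCont ?B x"
    using Ck_on_2D(3)[OF assms(2)] assms(1,3) by (auto simp: continuous_on_eq_continuous_at)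
  then obtain d1 d2 where d: "d1 > 0" "\<And>y. dist y x < d1 \<Longrightarrow> dist (?A y) (?A x) < e"
     "d2 > 0" "\<And>y. dist y x < d2 \<Longrightarrow> dist (?B y) (?B x) < e"
    using e unfolding continuous_at_eps_delta by (metis dist_commute)
  obtain d3 where d3: "d3 > 0" "ball x d3 \<subseteq> U" using assms open_contains_ball by metis
  define d where "d = min d3 (min d1 d2)"
  define s where "s = d / 2 / (norm u + norm v + 1)"
  have d0: "d > 0" using d d3 by (simp add: d_def)
  have pos: "norm u + norm v + 1 > 0" by (simp add: add_nonneg_pos)
  then have s: "s > 0" using d0 by (simp add: s_def)
  have near: "dist (x + q *\<^sub>R u + r *\<^sub>R v) x < d" if "0 \<le> q" "q \<le> s" "0 \<le> r" "r \<le> s" for q r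
  proof -
    have "dist (x + q *\<^sub>R u + r *\<^sub>R v) x \<le> norm (q *\<^sub>R u) + norm (r *\<^sub>R v)"
      using norm_triangle_ineq[of "q *\<^sub>R u" "r *\<^sub>R v"] by (simp add: dist_norm add.assoc)
    also have "\<dots> \<le> s * norm u + s * norm v"
      using that by (intro add_mono) (auto intro: mult_right_mono)
    also have "\<dots> \<le> s * (norm u + norm v + 1)" using s by (simp add: algebra_simps)
    also have "\<dots> = d / 2" unfolding s_def using pos by (subst nonzero_eq_divide_eq[symmetric]) auto
    also have "\<dots> < d" using d0 by simp
    finally show ?thesis .
  qed
  have inU: "x + q *\<^sub>R u + r *\<^sub>R v \<in> U" if "0 \<le> q" "q \<le> s" "0 \<le> r" "r \<le> s" for q r
    using near[OF that] d3(2) by (auto simp: d_def dist_commute)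
  have inU': "x + q *\<^sub>R v + r *\<^sub>R u \<in> U" if "0 \<le> q" "q \<le> s" "0 \<le> r" "r \<le> s" for q r
    using inU[of r q] that by (simp add: add.assoc add.commute[of "q *\<^sub>R v"])
  obtain q r where qr: "0 < q" "q < s" "0 < r" "r < s"
    "g (x + s *\<^sub>R u + s *\<^sub>R v) - g (x + s *\<^sub>R u) - g (x + s *\<^sub>R v) + g x =
      s\<^sup>2 * ?A (x + q *\<^sub>R u + r *\<^sub>R v)"
    using mixed_difference[OF assms(2) s inU] by blast
  obtain q' r' where qr': "0 < q'" "q' < s" "0 < r'" "r' < s"
    "g (x + s *\<^sub>R v + s *\<^sub>R u) - g (x + s *\<^sub>R v) - g (x + s *\<^sub>R u) + g x =
      s\<^sup>2 * ?B (x + q' *\<^sub>R v + r' *\<^sub>R u)"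
    using mixed_difference[OF assms(2) s, of x v u] inU' by blast
  have "s\<^sup>2 * ?A (x + q *\<^sub>R u + r *\<^sub>R v) = s\<^sup>2 * ?B (x + q' *\<^sub>R v + r' *\<^sub>R u)"
    unfolding qr(5)[symmetric] qr'(5)[symmetric] by (simp add: algebra_simps)
  then have eq: "?A (x + q *\<^sub>R u + r *\<^sub>R v) = ?B (x + q' *\<^sub>R v + r' *\<^sub>R u)" using s by simp
  have "dist (?A (x + q *\<^sub>R u + r *\<^sub>R v)) (?A x) < e"
    using near[of q r] qr by (intro d) (auto simp: d_def)
  moreover have "dist (?B (x + q' *\<^sub>R v + r' *\<^sub>R u)) (?B x) < e"
    using near[of r' q'] qr' by (intro d) (auto simp: d_def algebra_simps)
  ultimately have "\<bar>?A x - ?B x\<bar> < e + e" using eq unfolding dist_real_def by linarith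
  then show False by (simp add: e_def)
qed

section \<open>The complex Hessian\<close>

text \<open>The quadratic form of the complex Hessian in terms of real second derivatives.  The
  derivative in
the real direction \<open>\<xi>\<close> is \<open>P + cnj P\<close> with \<open>P = (\<Sum>a. \<xi>\<^sub>a \<partial>\<^sub>a)\<close>, and in the direction \<open>\<i> \<xi>\<close> it is
\<open>\<i> (P - cnj P)\<close>, so the sum of the two squares is \<open>4 P (cnj P)\<close>.\<close>

definition levi :: "(complex ^ 'n \<Rightarrow> real) \<Rightarrow> complex ^ 'n \<Rightarrow> complex ^ 'n \<Rightarrow> real"
  where "levi w z \<xi> =
    (dir_deriv \<xi> (dir_deriv \<xi> w) z + dir_deriv (\<i> *s \<xi>) (dir_deriv (\<i> *s \<xi>) w) z) / 4"

lemma dir_deriv_complex_of_real: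
  assumes "g differentiable (at x)" "h differentiable (at x)"
  shows "dir_deriv v (\<lambda>x. (complex_of_real (g x) + \<i> * complex_of_real (h x)) / 2) x =
    (complex_of_real (dir_deriv v g x) + \<i> * complex_of_real (dir_deriv v h x)) / 2"
proof (rule dir_derivI)
  show "((\<lambda>x. (complex_of_real (g x) + \<i> * complex_of_real (h x)) / 2) has_derivative
    (\<lambda>v. (complex_of_real (dir_deriv v g x) + \<i> * complex_of_real (dir_deriv v h x)) / 2)) (at x)"
    using has_derivative_dir_deriv[OF assms(1)] has_derivative_dir_deriv[OF assms(2)]
    by (auto intro!: derivative_eq_intros)
qed

lemma d_zbar_eq:
  assumes "w differentiable (at x)"
  shows "d_zbar b (\<lambda>x. complex_of_real (w x)) x =
    (complex_of_real (dir_deriv (axis b 1) w x) + \<i> * complex_of_real (dir_deriv (axis b \<i>) w x))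
      / 2"
proof -
  have "frechet_derivative (\<lambda>x. complex_of_real (w x)) (at x) v =
    complex_of_real (dir_deriv v w x)" for v
  proof -
    have "((\<lambda>x. complex_of_real (w x)) has_derivative (\<lambda>v. complex_of_real (dir_deriv v w x))) (at
      x)"
      using has_derivative_dir_deriv[OF assms] by (rule has_derivative_of_real)
    from dir_derivI[OF this] show ?thesis by (simp add: dir_deriv_def)
  qed
  then show ?thesis by (simp add: d_zbar_def)
qed

lemma complex_hessian_entry:
  fixes w :: "complex ^ 'n \<Rightarrow> real"
  assumes "open U" "Ck_on 2 U w" "z \<in> U"
  shows "complex_hessian w z $ a $ b =
    (complex_of_real (dir_deriv (axis a 1) (dir_deriv (axis b 1) w) z + dir_deriv (axis a \<i>)
      (dir_deriv (axis b \<i>) w) z)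
     + \<i> * complex_of_real (dir_deriv (axis a 1) (dir_deriv (axis b \<i>) w) z - dir_deriv (axis a \<i>)
       (dir_deriv (axis b 1) w) z)) / 4"
proof -
  have fd: "frechet_derivative (d_zbar b (\<lambda>x. complex_of_real (w x))) (at z) v =
    (complex_of_real (dir_deriv v (dir_deriv (axis b 1) w) z) + \<i> * complex_of_real (dir_deriv v
      (dir_deriv (axis b \<i>) w) z)) / 2" for v
  proof -
    have "dir_deriv v (d_zbar b (\<lambda>x. complex_of_real (w x))) z =
       dir_deriv v (\<lambda>x. (complex_of_real (dir_deriv (axis b 1) w x) + \<i> * complex_of_real
         (dir_deriv (axis b \<i>) w x)) / 2) z"
      using Ck_on_2D[OF assms(2)] by (intro dir_deriv_cong[OF assms(1,3)] d_zbar_eq)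
    also have "\<dots> = (complex_of_real (dir_deriv v (dir_deriv (axis b 1) w) z) + \<i> * complex_of_real
      (dir_deriv v (dir_deriv (axis b \<i>) w) z)) / 2"
      using Ck_on_2D[OF assms(2)] assms(3) by (intro dir_deriv_complex_of_real)
    finally show ?thesis by (simp add: dir_deriv_def)
  qed
  show ?thesis
    unfolding complex_hessian_def d_z_def vec_lambda_beta fd
      by (simp add: complex_eq_iff field_simps)
qed

lemma hermitian_complex_hessian:
  fixes w :: "complex ^ 'n \<Rightarrow> real"
  assumes "open U" "Ck_on 2 U w" "z \<in> U"
  shows "hermitian (complex_hessian w z)"
  unfolding hermitian_def complex_hessian_entry[OF assms]
proof (intro allI)
  fix i j :: 'n
  show "(complex_of_real (dir_deriv (axis i 1) (dir_deriv (axis j 1) w) z + dir_deriv (axis i \<i>)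
    (dir_deriv (axis j \<i>) w) z)
     + \<i> * complex_of_real (dir_deriv (axis i 1) (dir_deriv (axis j \<i>) w) z - dir_deriv (axis i \<i>)
       (dir_deriv (axis j 1) w) z)) / 4
    = cnj ((complex_of_real (dir_deriv (axis j 1) (dir_deriv (axis i 1) w) z + dir_deriv (axis j
      \<i>) (dir_deriv (axis i \<i>) w) z)
     + \<i> * complex_of_real (dir_deriv (axis j 1) (dir_deriv (axis i \<i>) w) z - dir_deriv (axis j \<i>)
       (dir_deriv (axis i 1) w) z)) / 4)"
    unfolding dir_deriv2_commute[OF assms, of "axis j _" "axis i _"]
    by (simp add: complex_eq_iff)
qed

lemma vec_complex_expansion:
  "\<xi> = (\<Sum>k\<in>UNIV. Re (\<xi> $ k) *\<^sub>R axis k 1 + Im (\<xi> $ k) *\<^sub>R axis k \<i>)"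
  by (simp add: vec_eq_iff axis_def if_distrib if_distribR sum.distrib complex_eq_iff cong: if_cong)

lemma bilinear_complex_expansion:
  fixes D :: "complex ^ 'n \<Rightarrow> complex ^ 'n \<Rightarrow> real"
  assumes "\<And>v. linear (\<lambda>u. D u v)" "\<And>u. linear (D u)"
  shows "D \<xi> \<xi> + D (\<i> *s \<xi>) (\<i> *s \<xi>) = (\<Sum>k\<in>UNIV. \<Sum>l\<in>UNIV.
     (Re (\<xi> $ k) * Re (\<xi> $ l) + Im (\<xi> $ k) * Im (\<xi> $ l)) * (D (axis k 1) (axis l 1) + D (axis k \<i>)
       (axis l \<i>))
   + (Re (\<xi> $ k) * Im (\<xi> $ l) - Im (\<xi> $ k) * Re (\<xi> $ l)) * (D (axis k 1) (axis l \<i>) - D (axis k \<i>)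
     (axis l 1)))"
proof -
  have expand: "D \<eta> \<eta> = (\<Sum>k\<in>UNIV. \<Sum>l\<in>UNIV.
     Re (\<eta> $ k) * Re (\<eta> $ l) * D (axis k 1) (axis l 1) + Re (\<eta> $ k) * Im (\<eta> $ l) * D (axis k 1)
       (axis l \<i>)
   + Im (\<eta> $ k) * Re (\<eta> $ l) * D (axis k \<i>) (axis l 1) + Im (\<eta> $ k) * Im (\<eta> $ l) * D (axis k \<i>)
     (axis l \<i>))" for \<eta>
  proof -
    have "D \<eta> \<eta> = D (\<Sum>k\<in>UNIV. Re (\<eta> $ k) *\<^sub>R axis k 1 + Im (\<eta> $ k) *\<^sub>R axis k \<i>) \<eta>"
      using vec_complex_expansion[of \<eta>] by simp
    also have "\<dots> = (\<Sum>k\<in>UNIV. Re (\<eta> $ k) * D (axis k 1) \<eta> + Im (\<eta> $ k) * D (axis k \<i>) \<eta>)"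
      by (simp add: linear_sum[OF assms(1)] linear_add[OF assms(1)] linear_scale[OF assms(1)])
    also have "\<dots> = (\<Sum>k\<in>UNIV. Re (\<eta> $ k) * D (axis k 1) (\<Sum>l\<in>UNIV. Re (\<eta> $ l) *\<^sub>R axis l 1 + Im (\<eta> $
      l) *\<^sub>R axis l \<i>)
        + Im (\<eta> $ k) * D (axis k \<i>) (\<Sum>l\<in>UNIV. Re (\<eta> $ l) *\<^sub>R axis l 1 + Im (\<eta> $ l) *\<^sub>R axis l \<i>))"
      using vec_complex_expansion[of \<eta>] by simp
    also have "\<dots> = (\<Sum>k\<in>UNIV. Re (\<eta> $ k) * (\<Sum>l\<in>UNIV. Re (\<eta> $ l) * D (axis k 1) (axis l 1) + Im (\<eta> $
      l) * D (axis k 1) (axis l \<i>))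
        + Im (\<eta> $ k) * (\<Sum>l\<in>UNIV. Re (\<eta> $ l) * D (axis k \<i>) (axis l 1) + Im (\<eta> $ l) * D (axis k \<i>)
          (axis l \<i>)))"
      by (simp add: linear_sum[OF assms(2)] linear_add[OF assms(2)] linear_scale[OF assms(2)])
    finally show ?thesis
      by (simp add: sum_distrib_left sum.distrib[symmetric] algebra_simps)
  qed
  show ?thesis
    unfolding expand[of \<xi>] expand[of "\<i> *s \<xi>"] sum.distrib[symmetric]
    by (intro sum.cong refl) (simp add: algebra_simps)
qed

text \<open>The Hessian pairs \<open>\<partial>\<^sub>a\<close> with \<open>\<xi>\<^sub>a\<close>, whereas \<open>adj V ** H ** V\<close> pairs it with the conjugate of
  the
entry of \<open>V\<close>; this accounts for the conjugation.\<close>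

definition cnj_column :: "complex ^ 'n ^ 'n \<Rightarrow> 'n \<Rightarrow> complex ^ 'n"
  where "cnj_column V i = (\<chi> k. cnj (V $ k $ i))"

lemma cnj_column_unit:
  assumes "unitary V" shows "cnj_column V i \<bullet> cnj_column V i = 1"
  using unitary_column_norm[OF assms, of i]
  by (simp add: cnj_column_def inner_vec_def cmod_power2 inner_complex_def) (simp add:
    power2_eq_square)

definition levi_diag :: "complex ^ 'n ^ 'n \<Rightarrow> (complex ^ 'n \<Rightarrow> real) \<Rightarrow> complex ^ 'n \<Rightarrow> real ^ 'n"
  where "levi_diag V w z = (\<chi> i. levi w z (cnj_column V i))"

lemma diag_in_hessian:
  fixes w :: "complex ^ 'n \<Rightarrow> real"
  assumes "open U" "Ck_on 2 U w" "z \<in> U"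
  shows "diag_in V (complex_hessian w z) = levi_diag V w z"
proof -
  have "diag_in V (complex_hessian w z) $ i = levi w z (cnj_column V i)" for i
  proof -
    let ?D = "\<lambda>u v. dir_deriv u (dir_deriv v w) z"
    have "levi w z (cnj_column V i) =
        (?D (cnj_column V i) (cnj_column V i) + ?D (\<i> *s cnj_column V i) (\<i> *s cnj_column V i)) / 4"
      by (simp add: levi_def)
    also have "\<dots> = diag_in V (complex_hessian w z) $ i"
      unfolding bilinear_complex_expansion[of ?D, OF linear_dir_deriv2[OF assms]] diag_in_eq
        complex_hessian_entry[OF assms] Re_sum sum_divide_distrib
      by (intro sum.cong refl) (simp add: cnj_column_def algebra_simps add_divide_distrib
        diff_divide_distrib)
    finally show ?thesis by simp
  qed
  then show ?thesis by (simp add: vec_eq_iff levi_diag_def)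
qed

lemma levi_add:
  assumes "open U" "Ck_on 2 U g" "Ck_on 2 U h" "x \<in> U"
  shows "levi (\<lambda>x. g x + h x) x \<xi> = levi g x \<xi> + levi h x \<xi>"
  by (simp add: levi_def dir_deriv2_add[OF assms] add_divide_distrib)

lemma levi_scale:
  assumes "open U" "Ck_on 2 U g" "x \<in> U"
  shows "levi (\<lambda>x. c * g x) x \<xi> = c * levi g x \<xi>"
  using dir_deriv2_scaleR[OF assms, of _ _ c] by (simp add: levi_def algebra_simps)

lemma levi_cong:
  assumes "open U" "x \<in> U" "\<And>y. y \<in> U \<Longrightarrow> g y = h y"
  shows "levi g x \<xi> = levi h x \<xi>"
  using dir_deriv2_cong[OF assms(1,2), of g h] assms(3) by (simp add: levi_def)

lemma inner_i_times [simp]: "(\<i> *s x) \<bullet> (\<i> *s y) = x \<bullet> (y :: complex ^ 'n)"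
  by (simp add: inner_vec_def inner_complex_def add.commute)

lemma levi_quadratic:
  "levi (\<lambda>x. a * (x \<bullet> x) + x \<bullet> c + d) x \<xi> = a * (\<xi> \<bullet> \<xi>)"
  by (simp add: levi_def dir_deriv2_quadratic)

lemma levi_mono_local:
  fixes g h :: "complex ^ 'n \<Rightarrow> real"
  assumes "open U" "Ck_on 2 U g" "Ck_on 2 U h" "x \<in> U" "\<And>y. y \<in> U \<Longrightarrow> g y - h y \<le> g x - h x"
  shows "levi g x \<xi> \<le> levi h x \<xi>"
proof -
  have ck: "Ck_on 2 U (\<lambda>y. (- 1) *\<^sub>R g y)" by (intro Ck_on_scaleR assms)
  have "0 \<le> dir_deriv v (dir_deriv v (\<lambda>y. h y + (- 1) *\<^sub>R g y)) x" for v
    by (rule local_min_imp_dir_deriv2_nonneg[OF assms(1) Ck_on_add[OF assms(1,3) ck] assms(4)])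
       (use assms(5) in force)
  then have "dir_deriv v (dir_deriv v g) x \<le> dir_deriv v (dir_deriv v h) x" for v
    unfolding dir_deriv2_add[OF assms(1,3) ck assms(4)] dir_deriv2_scaleR[OF assms(1,2,4)]
      by (simp add: algebra_simps)
  then show ?thesis by (simp add: levi_def add_mono divide_right_mono)
qed

lemma continuous_on_levi:
  assumes "Ck_on 2 U q" shows "continuous_on U (\<lambda>z. levi q z \<xi>)"
  unfolding levi_def by (intro continuous_intros Ck_on_2D(3)[OF assms]) auto

lemma levi_add_smooth:
  fixes g h :: "complex ^ 'n \<Rightarrow> real"
  assumes "smooth_on UNIV g" "smooth_on UNIV h"
  shows "levi (\<lambda>x. g x + h x) x \<xi> = levi g x \<xi> + levi h x \<xi>"
  by (rule levi_add[of UNIV]) (use assms in \<open>auto intro: smooth_on_imp_Ck_on\<close>)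

lemma levi_translate:
  fixes q :: "complex ^ 'n \<Rightarrow> real"
  assumes q: "smooth_on UNIV q" shows "levi (\<lambda>y. q (y + a)) x \<xi> = levi q (x + a) \<xi>"
proof -
  have "dir_deriv v (\<lambda>y. q (y + a)) = (\<lambda>y. dir_deriv v q (y + a))"
    if "smooth_on UNIV q" for v and q :: "complex ^ 'n \<Rightarrow> real"
    by (rule ext) (intro dir_deriv_translate smooth_on_imp_differentiable[OF that UNIV_I])
  then show ?thesis using q smooth_on_dir_deriv[OF q] by (simp add: levi_def)
qed

lemma levi_const: "levi (\<lambda>_. m) x \<xi> = 0"
  using levi_quadratic[of 0 0 m x \<xi>] by simp

section \<open>Test functions\<close>

definition test_fun :: "('a::euclidean_space \<Rightarrow> real) \<Rightarrow> bool"
  where "test_fun \<phi> \<longleftrightarrow> smooth_on UNIV \<phi> \<and> (\<exists>B. \<forall>x. norm x > B \<longrightarrow> \<phi> x = 0)"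

lemma test_fun_differentiable: "test_fun \<phi> \<Longrightarrow> \<phi> differentiable (at x)"
  by (auto simp: test_fun_def intro: smooth_on_imp_differentiable)

lemma test_fun_Ck_on: "test_fun \<phi> \<Longrightarrow> Ck_on k UNIV \<phi>"
  by (auto simp: test_fun_def smooth_on_def)

lemma test_fun_continuous: "test_fun \<phi> \<Longrightarrow> continuous_on S \<phi>"
  unfolding test_fun_def using smooth_on_imp_continuous_on continuous_on_subset by blast

lemma test_fun_add:
  assumes "test_fun \<phi>" "test_fun \<psi>" shows "test_fun (\<lambda>x. \<phi> x + \<psi> x)"
proof -
  obtain B B' where "\<And>x. norm x > B \<Longrightarrow> \<phi> x = 0" "\<And>x. norm x > B' \<Longrightarrow> \<psi> x = 0"
    using assms by (auto simp: test_fun_def)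
  then have "norm x > max B B' \<longrightarrow> \<phi> x + \<psi> x = 0" for x by auto
  then show ?thesis using assms unfolding test_fun_def by (blast intro: smooth_on_add)
qed

lemma test_fun_scale: "test_fun \<phi> \<Longrightarrow> test_fun (\<lambda>x. c * \<phi> x)"
  using smooth_on_scaleR[of UNIV \<phi> c] unfolding test_fun_def by auto

lemma test_fun_zero: "test_fun (\<lambda>_. 0)"
  by (simp add: test_fun_def smooth_on_const)

lemma test_fun_sum: "(\<And>k. k \<in> I \<Longrightarrow> test_fun (\<phi> k)) \<Longrightarrow> test_fun (\<lambda>x. \<Sum>k\<in>I. \<phi> k x)"
  by (induction I rule: infinite_finite_induct) (auto intro: test_fun_add test_fun_zero)

lemma test_fun_translate:
  assumes "test_fun \<phi>" shows "test_fun (\<lambda>x. \<phi> (x + a))"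
proof -
  obtain B where B: "\<And>x. norm x > B \<Longrightarrow> \<phi> x = 0" using assms by (auto simp: test_fun_def)
  have "norm x > B + norm a \<longrightarrow> \<phi> (x + a) = 0" for x
    using norm_triangle_ineq4[of "x + a" a] by (intro impI B) simp
  then show ?thesis using assms unfolding test_fun_def by (blast intro: smooth_on_translate)
qed

lemma test_fun_dir_deriv:
  assumes "test_fun \<phi>" shows "test_fun (dir_deriv v \<phi>)"
proof -
  obtain B where B: "\<And>x. norm x > B \<Longrightarrow> \<phi> x = 0" using assms by (auto simp: test_fun_def)
  have "dir_deriv v \<phi> x = 0" if "norm x > B" for x
  proof -
    have "dir_deriv v \<phi> x = dir_deriv v (\<lambda>_. 0) x"
    proof (rule dir_deriv_cong)
      show "open (- cball 0 B :: 'a set)" by (simp add: open_Compl)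
    qed (use that B in auto)
    also have "\<dots> = 0" by (rule dir_derivI) (rule has_derivative_const)
    finally show ?thesis .
  qed
  then show ?thesis using assms smooth_on_dir_deriv unfolding test_fun_def by blast
qed

lemma test_fun_bounded:
  assumes "test_fun \<phi>" obtains M where "M \<ge> 0" "\<And>x. \<bar>\<phi> x\<bar> \<le> M"
proof -
  obtain B where B: "\<And>x. norm x > B \<Longrightarrow> \<phi> x = 0" using assms by (auto simp: test_fun_def)
  have "compact (\<phi> ` cball 0 B)" by (intro compact_continuous_image test_fun_continuous assms) auto
  then obtain M where M: "\<And>x. x \<in> cball 0 B \<Longrightarrow> \<bar>\<phi> x\<bar> \<le> M"
    by (metis bounded_iff compact_imp_bounded image_eqI real_norm_def)
  have "\<bar>\<phi> x\<bar> \<le> max M 0" for x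
    using M[of x] B[of x] by (cases "norm x > B") auto
  then show thesis using that[of "max M 0"] by simp
qed

text \<open>By linearity in the direction, the finitely many basis directions give a bound that is
  uniform in
all directions.\<close>

lemma test_fun_dir_deriv_le:
  assumes "test_fun \<phi>" obtains M where "M \<ge> 0" "\<And>v x. \<bar>dir_deriv v \<phi> x\<bar> \<le> M * norm v"
proof -
  have "\<forall>i. \<exists>M\<ge>0. \<forall>x. \<bar>dir_deriv i \<phi> x\<bar> \<le> M"
    using test_fun_bounded[OF test_fun_dir_deriv[OF assms]] by metis
  then obtain M where M: "\<And>i. M i \<ge> 0" "\<And>i x. \<bar>dir_deriv i \<phi> x\<bar> \<le> M i" by metis
  show thesis
  proof (rule that[of "\<Sum>i\<in>Basis. M i"])
    fix v x
    have "dir_deriv v \<phi> x = dir_deriv (\<Sum>i\<in>Basis. (v \<bullet> i) *\<^sub>R i) \<phi> x"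
      by (simp add: euclidean_representation)
    also have "\<dots> = (\<Sum>i\<in>Basis. (v \<bullet> i) * dir_deriv i \<phi> x)"
      by (simp add: linear_sum[OF linear_dir_deriv[OF test_fun_differentiable[OF assms]]]
        linear_scale[OF linear_dir_deriv[OF test_fun_differentiable[OF assms]]])
    finally have "\<bar>dir_deriv v \<phi> x\<bar> \<le> (\<Sum>i\<in>Basis. \<bar>(v \<bullet> i) * dir_deriv i \<phi> x\<bar>)"
      by (simp add: sum_abs)
    also have "\<dots> \<le> (\<Sum>i\<in>Basis. norm v * M i)"
      unfolding abs_mult using M by (intro sum_mono mult_mono) (auto simp: Basis_le_norm)
    finally show "\<bar>dir_deriv v \<phi> x\<bar> \<le> (\<Sum>i\<in>Basis. M i) * norm v"
      by (simp add: sum_distrib_left mult.commute)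
  qed (auto intro: sum_nonneg M)
qed

lemma test_fun_lipschitz:
  assumes "test_fun \<phi>" obtains M where "M \<ge> 0" "\<And>x y. \<bar>\<phi> x - \<phi> y\<bar> \<le> M * norm (x - y)"
proof -
  obtain M where M: "M \<ge> 0" "\<And>v x. \<bar>dir_deriv v \<phi> x\<bar> \<le> M * norm v"
    using test_fun_dir_deriv_le[OF assms] by metis
  have "\<bar>\<phi> x - \<phi> y\<bar> \<le> M * norm (x - y)" for x y
  proof -
    have "\<exists>t. 0 < t \<and> t < 1 \<and> \<phi> (y + 1 *\<^sub>R (x - y)) - \<phi> (y + 0 *\<^sub>R (x - y)) =
      (1 - 0) * dir_deriv (x - y) \<phi> (y + t *\<^sub>R (x - y))"
      by (intro MVT2 has_real_derivative_along_line test_fun_differentiable assms) auto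
    then show ?thesis using M(2) by auto
  qed
  then show thesis using that M(1) by blast
qed

lemma test_fun_taylor:
  assumes "test_fun \<phi>" obtains M where "M \<ge> 0" "\<And>x h. \<bar>\<phi> (x + h) - \<phi> x - dir_deriv h \<phi> x\<bar> \<le>
    M * (norm h)\<^sup>2"
proof -
  have "\<forall>i. \<exists>M\<ge>0. \<forall>v x. \<bar>dir_deriv v (dir_deriv i \<phi>) x\<bar> \<le> M * norm v"
    using test_fun_dir_deriv_le[OF test_fun_dir_deriv[OF assms]] by metis
  then obtain M where M: "\<And>i. M i \<ge> 0" "\<And>i v x. \<bar>dir_deriv v (dir_deriv i \<phi>) x\<bar> \<le> M i * norm v"
    by metis
  define C where "C = (\<Sum>i\<in>Basis. M i)"
  have C: "\<bar>dir_deriv h (dir_deriv h \<phi>) x\<bar> \<le> C * (norm h)\<^sup>2" for h x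
  proof -
    have lin: "linear (\<lambda>v. dir_deriv h (dir_deriv v \<phi>) x)"
      by (intro linear_dir_deriv2[of UNIV] test_fun_Ck_on assms) auto
    have "dir_deriv h (dir_deriv h \<phi>) x = dir_deriv h (dir_deriv (\<Sum>i\<in>Basis. (h \<bullet> i) *\<^sub>R i) \<phi>) x"
      by (simp add: euclidean_representation)
    also have "\<dots> = (\<Sum>i\<in>Basis. (h \<bullet> i) * dir_deriv h (dir_deriv i \<phi>) x)"
      by (simp add: linear_sum[OF lin] linear_scale[OF lin])
    finally have "\<bar>dir_deriv h (dir_deriv h \<phi>) x\<bar> \<le> (\<Sum>i\<in>Basis. \<bar>(h \<bullet> i) * dir_deriv h (dir_deriv i
      \<phi>) x\<bar>)"
      by (simp add: sum_abs)
    also have "\<dots> \<le> (\<Sum>i\<in>Basis. norm h * (M i * norm h))"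
      unfolding abs_mult using M by (intro sum_mono mult_mono) (auto simp: Basis_le_norm)
    also have "\<dots> = C * (norm h)\<^sup>2"
      unfolding C_def by (simp add: sum_distrib_left sum_distrib_right power2_eq_square ac_simps)
    finally show ?thesis .
  qed
  have "\<bar>\<phi> (x + h) - \<phi> x - dir_deriv h \<phi> x\<bar> \<le> C * (norm h)\<^sup>2" for x h
  proof -
    have "\<exists>t. 0 < t \<and> t < 1 \<and> \<phi> (x + 1 *\<^sub>R h) - \<phi> (x + 0 *\<^sub>R h) =
      (1 - 0) * dir_deriv h \<phi> (x + t *\<^sub>R h)"
      by (intro MVT2 has_real_derivative_along_line test_fun_differentiable assms) auto
    then obtain t where t: "0 < t" "t < 1" "\<phi> (x + h) - \<phi> x = dir_deriv h \<phi> (x + t *\<^sub>R h)" by auto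
    have "\<exists>s. 0 < s \<and> s < t \<and> dir_deriv h \<phi> (x + t *\<^sub>R h) - dir_deriv h \<phi> (x + 0 *\<^sub>R h) =
      (t - 0) * dir_deriv h (dir_deriv h \<phi>) (x + s *\<^sub>R h)"
      using t by (intro MVT2 has_real_derivative_along_line test_fun_differentiable
        test_fun_dir_deriv assms) auto
    then obtain s where s: "\<phi> (x + h) - \<phi> x - dir_deriv h \<phi> x =
      t * dir_deriv h (dir_deriv h \<phi>) (x + s *\<^sub>R h)"
      using t by auto
    have "\<bar>t\<bar> * \<bar>dir_deriv h (dir_deriv h \<phi>) (x + s *\<^sub>R h)\<bar> \<le> 1 * (C * (norm h)\<^sup>2)"
      using t C by (intro mult_mono) auto
    then show ?thesis unfolding s abs_mult by simp
  qed
  moreover have "C \<ge> 0" unfolding C_def by (auto intro: sum_nonneg M)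
  ultimately show thesis using that by blast
qed

section \<open>Mollifiers\<close>

text \<open>These functions are the building blocks of a bump function: they vanish to infinite order at
  \<open>0\<close>,
and the derivative of each is a combination of two others.\<close>

definition flat :: "nat \<Rightarrow> real \<Rightarrow> real"
  where "flat k s = (if s > 0 then exp (- (1 / s)) / s ^ k else 0)"

lemma flat_tendsto_0: "((\<lambda>s. exp (- (1 / s)) / s ^ k) \<longlongrightarrow> 0) (at_right (0::real))"
proof -
  have "((\<lambda>s. inverse s ^ k / exp (inverse s)) \<longlongrightarrow> 0) (at_right (0::real))"
    by (rule filterlim_compose[OF tendsto_power_div_exp_0 filterlim_inverse_at_top_right])
  then show ?thesis
    by (simp add: exp_minus field_simps power_inverse)
qed

lemma flat_has_derivative:
  "(flat k has_real_derivative flat (k + 2) s - real k * flat (k + 1) s) (at s)"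
proof -
  consider "s > 0" | "s < 0" | "s = 0" by linarith
  then show ?thesis
  proof cases
    case 1
    have "((\<lambda>s. exp (- (1 / s)) / s ^ k) has_real_derivative flat (k + 2) s - real k * flat (k +
      1) s) (at s)"
      using 1 by (auto intro!: derivative_eq_intros simp: flat_def)
        (cases k; simp add: field_simps power2_eq_square)
    from has_field_derivative_transform_within_open[OF this, of "{0<..}" "flat k"] 1
    show ?thesis by (auto simp: flat_def)
  next
    case 2
    have "((\<lambda>s. 0) has_real_derivative 0) (at s)" by simp
    from has_field_derivative_transform_within_open[OF this, of "{..<0}" "flat k"] 2
    show ?thesis by (auto simp: flat_def)
  next
    case 3
    have "((\<lambda>h. flat k h / h) \<longlongrightarrow> 0) (at_right 0)"
    proof (rule Lim_transform_eventually[OF flat_tendsto_0[of "k + 1"]])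
      show "\<forall>\<^sub>F s in at_right 0. exp (- (1 / s)) / s ^ (k + 1) = flat k s / s"
        by (auto simp: eventually_at_filter flat_def intro!: always_eventually)
    qed
    moreover have "((\<lambda>h. flat k h / h) \<longlongrightarrow> 0) (at_left 0)"
      by (rule tendsto_eventually) (auto simp: eventually_at_filter flat_def intro!:
        always_eventually)
    ultimately have "((\<lambda>h. flat k h / h) \<longlongrightarrow> 0) (at 0)" by (simp add: filterlim_at_split)
    then show ?thesis using 3 by (simp add: DERIV_def flat_def)
  qed
qed

text \<open>A class closed under differentiation that contains the bump functions
\<open>exp (- 1 / (r\<^sup>2 - |x|\<^sup>2))\<close>.\<close>

inductive_set bump_class :: "real \<Rightarrow> ('a::euclidean_space \<Rightarrow> real) set" for r where
  flat: "(\<lambda>x. flat k (r\<^sup>2 - x \<bullet> x)) \<in> bump_class r"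
| coord: "g \<in> bump_class r \<Longrightarrow> (\<lambda>x. (x \<bullet> v) * g x) \<in> bump_class r"
| add: "g \<in> bump_class r \<Longrightarrow> h \<in> bump_class r \<Longrightarrow> (\<lambda>x. g x + h x) \<in> bump_class r"
| scale: "g \<in> bump_class r \<Longrightarrow> (\<lambda>x. c * g x) \<in> bump_class r"

lemma bump_class_derivative:
  assumes "g \<in> bump_class r"
  shows "(\<forall>x. g differentiable (at x)) \<and> (\<forall>v. dir_deriv v g \<in> bump_class r)"
  using assms
proof induction
  case (flat k)
  have d: "((\<lambda>x. flat k (r\<^sup>2 - x \<bullet> x)) has_derivative
     (\<lambda>v. (- 2) * ((x \<bullet> v) * (flat (k + 2) (r\<^sup>2 - x \<bullet> x) + (- real k) * flat (k + 1) (r\<^sup>2 - x \<bullet>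
       x))))) (at x)" for x :: 'a
  proof -
    have "((\<lambda>x::'a. r\<^sup>2 - x \<bullet> x) has_derivative (\<lambda>v. - 2 * (x \<bullet> v))) (at x)"
      by (auto intro!: derivative_eq_intros simp: inner_commute)
    from diff_chain_at[OF this flat_has_derivative[unfolded has_field_derivative_def]]
    show ?thesis by (simp add: o_def algebra_simps)
  qed
  have "dir_deriv v (\<lambda>x. flat k (r\<^sup>2 - x \<bullet> x)) = (\<lambda>x. (- 2) * ((x \<bullet> v) * (flat (k + 2) (r\<^sup>2 - x \<bullet>
    x) + (- real k) * flat (k + 1) (r\<^sup>2 - x \<bullet> x))))" for v :: 'a
    by (rule ext) (rule dir_derivI[OF d])
  then show ?case
    using d by (auto simp only: differentiable_def intro!: bump_class.intros)
next
  case (coord g v)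
  have d: "((\<lambda>x. (x \<bullet> v) * g x) has_derivative (\<lambda>w. (w \<bullet> v) * g x + (x \<bullet> v) * dir_deriv w g x))
    (at x)" for x
    using has_derivative_dir_deriv[of g x] coord by (auto intro!: derivative_eq_intros)
  have "dir_deriv w (\<lambda>x. (x \<bullet> v) * g x) = (\<lambda>x. (w \<bullet> v) * g x + (x \<bullet> v) * dir_deriv w g x)" for w
    by (rule ext) (rule dir_derivI[OF d])
  then show ?case using d coord by (auto simp: differentiable_def intro!: bump_class.intros)
next
  case (add g h)
  have "dir_deriv w (\<lambda>x. g x + h x) = (\<lambda>x. dir_deriv w g x + dir_deriv w h x)" for w
    using add by (intro ext dir_deriv_add) auto
  then show ?case using add by (auto intro!: bump_class.intros derivative_intros)
next
  case (scale g c)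
  have "dir_deriv w (\<lambda>x. c * g x) = (\<lambda>x. c * dir_deriv w g x)" for w
    using scale dir_deriv_scaleR[of g _ w c] by auto
  then show ?case using scale by (auto intro!: bump_class.intros derivative_intros)
qed

lemma test_fun_bump:
  assumes "r > 0" shows "test_fun (\<lambda>x::'a::euclidean_space. flat 0 (r\<^sup>2 - x \<bullet> x))"
proof -
  have "smooth_on UNIV (\<lambda>x::'a. flat 0 (r\<^sup>2 - x \<bullet> x))"
    by (rule smooth_on_UNIV_coinduct[of _ "bump_class r"]) (auto intro: bump_class.flat simp:
      bump_class_derivative)
  moreover have "flat 0 (r\<^sup>2 - x \<bullet> x) = 0" if "norm x > r" for x :: 'a
    using that assms power_mono[of r "norm x" 2] by (auto simp: flat_def power2_norm_eq_inner)
  ultimately show ?thesis unfolding test_fun_def by blast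
qed

lemma integrable_continuous_compact_support:
  fixes g :: "'a::euclidean_space \<Rightarrow> real"
  assumes "continuous_on UNIV g" "\<And>x. norm x > B \<Longrightarrow> g x = 0"
  shows "integrable lborel g"
proof -
  have "integrable lborel (\<lambda>x. indicator (cball 0 B) x *\<^sub>R g x)"
    using assms(1) by (intro borel_integrable_compact) (auto intro: continuous_on_subset)
  moreover have "(\<lambda>x. indicator (cball 0 B) x *\<^sub>R g x) = g"
    using assms(2) by (intro ext) (force simp: indicator_def)
  ultimately show ?thesis by simp
qed

lemma integrable_mult_test_fun:
  fixes g :: "'a::euclidean_space \<Rightarrow> real"
  assumes "continuous_on UNIV g" "test_fun \<phi>"
  shows "integrable lborel (\<lambda>y. g y * \<phi> y)"
proof -
  obtain B where "\<And>x. norm x > B \<Longrightarrow> \<phi> x = 0" using assms by (auto simp: test_fun_def)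
  then show ?thesis
    using assms by (intro integrable_continuous_compact_support[where B =
      B] continuous_on_mult test_fun_continuous[OF assms(2)]) auto
qed

lemma integrable_test_fun: "test_fun \<phi> \<Longrightarrow> integrable lborel \<phi>"
  using integrable_mult_test_fun[of "\<lambda>_. 1" \<phi>] by simp

definition mollifier :: "real \<Rightarrow> ('a::euclidean_space \<Rightarrow> real) \<Rightarrow> bool"
  where "mollifier d \<rho> \<longleftrightarrow> test_fun \<rho> \<and> (\<forall>x. 0 \<le> \<rho> x) \<and> (\<forall>x. norm x > d \<longrightarrow> \<rho> x =
    0) \<and> integral\<^sup>L lborel \<rho> = 1"

lemma mollifier_exists:
  assumes "d > 0" obtains \<rho> :: "'a::euclidean_space \<Rightarrow> real" where "mollifier d \<rho>"
proof -
  define b where "b = (\<lambda>x::'a. flat 0 (d\<^sup>2 - x \<bullet> x))"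
  have b: "test_fun b" unfolding b_def using assms by (rule test_fun_bump)
  have b0: "0 \<le> b x" for x by (simp add: b_def flat_def)
  have bz: "b x = 0" if "norm x > d" for x
    using that assms power_mono[of d "norm x" 2] by (auto simp: b_def flat_def power2_norm_eq_inner)
  define c where "c = exp (- (1 / (d\<^sup>2 - (d / 2)\<^sup>2)))"
  have "c * measure lborel (ball (0::'a) (d / 2)) = (\<integral>x. c * indicator (ball (0::'a) (d / 2)) x
    \<partial>lborel)" by simp
  also have "\<dots> \<le> integral\<^sup>L lborel b"
  proof (rule integral_mono)
    show "integrable lborel b" using b by (rule integrable_test_fun)
    show "integrable lborel (\<lambda>x. c * indicator (ball (0::'a) (d / 2)) x)"
      using emeasure_lborel_ball_finite[of "0::'a" "d / 2"] by (intro integrable_mult_right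
        integrable_real_indicator) (auto simp: less_top)
    fix x :: 'a
    show "c * indicator (ball 0 (d / 2)) x \<le> b x"
    proof (cases "norm x < d / 2")
      case True
      then have "x \<bullet> x \<le> (d / 2)\<^sup>2"
        using power_mono[of "norm x" "d / 2" 2] by (simp add: power2_norm_eq_inner)
      moreover have "(d / 2)\<^sup>2 < d\<^sup>2" using assms by (simp add: power_divide)
      ultimately have "1 / (d\<^sup>2 - x \<bullet> x) \<le> 1 / (d\<^sup>2 - (d / 2)\<^sup>2)" "d\<^sup>2 - x \<bullet> x > 0"
        by (auto intro!: divide_left_mono)
      then show ?thesis using True by (simp add: b_def c_def flat_def)
    qed (use b0 in auto)
  qed
  finally have "c * measure lborel (ball (0::'a) (d / 2)) \<le> integral\<^sup>L lborel b" .
  moreover have "c * measure lborel (ball (0::'a) (d / 2)) > 0"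
    using assms content_ball_pos[of "d / 2" "0::'a"] by (simp add: c_def)
  ultimately have pos: "integral\<^sup>L lborel b > 0" by simp
  define \<rho> where "\<rho> = (\<lambda>x. (1 / integral\<^sup>L lborel b) * b x)"
  have "test_fun \<rho>" unfolding \<rho>_def by (rule test_fun_scale) (rule b)
  moreover have "integral\<^sup>L lborel \<rho> = 1" unfolding \<rho>_def using pos
    by (subst integral_mult_right_zero) simp
  ultimately show thesis
    using pos b0 bz by (intro that[of \<rho>]) (auto simp: mollifier_def \<rho>_def)
qed

section \<open>Convolution\<close>

definition conv :: "('a::euclidean_space \<Rightarrow> real) \<Rightarrow> ('a \<Rightarrow> real) \<Rightarrow> 'a \<Rightarrow> real"
  where "conv g \<phi> x = (\<integral>y. g (x - y) * \<phi> y \<partial>lborel)"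

lemma integrable_conv:
  assumes "continuous_on UNIV g" "test_fun \<phi>"
  shows "integrable lborel (\<lambda>y. g (x - y) * \<phi> y)"
  by (intro integrable_mult_test_fun assms continuous_on_compose2[OF assms(1)] continuous_intros)
    auto

lemma conv_add:
  assumes "continuous_on UNIV g" "continuous_on UNIV h" "test_fun \<phi>"
  shows "conv (\<lambda>x. g x + h x) \<phi> x = conv g \<phi> x + conv h \<phi> x"
  unfolding conv_def by (simp add: distrib_right integrable_conv assms)

lemma conv_scale: "conv (\<lambda>x. c * g x) \<phi> x = c * conv g \<phi> x"
  unfolding conv_def by (simp add: mult.assoc)

lemma conv_const: "conv (\<lambda>x. c) \<phi> x = c * integral\<^sup>L lborel \<phi>"
  unfolding conv_def by simp

lemma conv_translate: "conv (\<lambda>x. g (x + a)) \<phi> x = conv g \<phi> (x + a)"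
  unfolding conv_def by (simp add: algebra_simps)

lemma conv_mono:
  assumes "continuous_on UNIV g" "continuous_on UNIV h" "mollifier d \<rho>" "\<And>y. dist x y \<le> d \<Longrightarrow>
    g y \<le> h y"
  shows "conv g \<rho> x \<le> conv h \<rho> x"
  unfolding conv_def
proof (intro integral_mono integrable_conv assms(1,2))
  fix y
  show "g (x - y) * \<rho> y \<le> h (x - y) * \<rho> y"
    using assms(3) assms(4)[of "x - y"] by (cases "norm y \<le> d") (auto simp: mollifier_def
      dist_norm intro: mult_right_mono)
qed (use assms in \<open>auto simp: mollifier_def\<close>)

lemma conv_cong:
  assumes "mollifier d \<rho>" "\<And>y. dist x y \<le> d \<Longrightarrow> g y = h y"
  shows "conv g \<rho> x = conv h \<rho> x"
  unfolding conv_def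
proof (rule Bochner_Integration.integral_cong[OF refl])
  fix y
  show "g (x - y) * \<rho> y = h (x - y) * \<rho> y"
    using assms(1) assms(2)[of "x - y"] by (cases "norm y \<le> d") (auto simp: mollifier_def dist_norm)
qed

lemma conv_near:
  assumes "continuous_on UNIV g" "mollifier d \<rho>" "\<And>y. dist x y \<le> d \<Longrightarrow> \<bar>g y - g x\<bar> \<le> e"
  shows "\<bar>conv g \<rho> x - g x\<bar> \<le> e"
proof -
  have "conv g \<rho> x \<le> conv (\<lambda>_. g x + e) \<rho> x" "conv (\<lambda>_. g x - e) \<rho> x \<le> conv g \<rho> x"
    by (intro conv_mono[OF _ _ assms(2)] assms(1) continuous_on_const; use assms(3) in fastforce)+
  then show ?thesis using assms(2) by (simp add: conv_const mollifier_def)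
qed

lemma lborel_integral_reflect:
  fixes F :: "'a::euclidean_space \<Rightarrow> real"
  assumes "F \<in> borel_measurable borel"
  shows "(\<integral>y. F (x - y) \<partial>lborel) = (\<integral>y. F y \<partial>lborel)"
proof -
  have "(lborel :: 'a measure) = distr lborel borel (\<lambda>y. x - y)"
    by (subst lborel_affine[of "-1" x]) (simp_all add: density_1)
  then have "(\<integral>y. F y \<partial>lborel) = integral\<^sup>L (distr lborel borel (\<lambda>y. x - y)) F" by metis
  also have "\<dots> = (\<integral>y. F (x - y) \<partial>lborel)"
    by (rule integral_distr) (use assms in auto)
  finally show ?thesis by simp
qed

text \<open>Derivatives fall on the smooth factor in this form of the convolution, whereas in the
  defining form
positivity and translations of the rough factor are apparent.\<close>

lemma conv_swap:
  assumes "integrable lborel g" "test_fun \<phi>"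
  shows "conv g \<phi> x = (\<integral>y. g y * \<phi> (x - y) \<partial>lborel)"
proof -
  have [measurable]: "g \<in> borel_measurable borel" "\<phi> \<in> borel_measurable borel"
    using assms(1) borel_measurable_continuous_onI[OF test_fun_continuous[OF assms(2)]] by auto
  have "(\<integral>y. g (x - y) * \<phi> (x - (x - y)) \<partial>lborel) = (\<integral>y. g y * \<phi> (x - y) \<partial>lborel)"
    by (rule lborel_integral_reflect) measurable
  then show ?thesis by (simp add: conv_def)
qed

lemma integrable_conv_swap:
  assumes "integrable lborel g" "test_fun \<phi>"
  shows "integrable lborel (\<lambda>y. g y * \<phi> (x - y))"
proof -
  obtain M where M: "\<And>x. \<bar>\<phi> x\<bar> \<le> M" using test_fun_bounded[OF assms(2)] by metis
  have [measurable]: "g \<in> borel_measurable borel" "\<phi> \<in> borel_measurable borel"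
    using assms(1) borel_measurable_continuous_onI[OF test_fun_continuous[OF assms(2)]] by auto
  show ?thesis
  proof (rule Bochner_Integration.integrable_bound[of _ "\<lambda>y. M * g y"])
    have "\<bar>g y * \<phi> (x - y)\<bar> \<le> \<bar>M * g y\<bar>" for y
    proof -
      have "\<bar>g y\<bar> * \<bar>\<phi> (x - y)\<bar> \<le> \<bar>g y\<bar> * \<bar>M\<bar>"
        by (rule mult_left_mono) (use M[of "x - y"] in auto)
      then show ?thesis by (simp add: abs_mult mult.commute)
    qed
    then show "AE y in lborel. norm (g y * \<phi> (x - y)) \<le> norm (M * g y)" by simp
  qed (use assms in auto)
qed

text \<open>The second order Taylor estimate of \<open>\<phi>\<close> is uniform in the base point and is integrated against
\<open>\<bar>g\<bar>\<close>.\<close>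

lemma conv_has_derivative:
  assumes g: "integrable lborel g" and \<phi>: "test_fun \<phi>"
  shows "(conv g \<phi> has_derivative (\<lambda>v. conv g (dir_deriv v \<phi>) x)) (at x)"
proof -
  obtain M where M: "M \<ge> 0" "\<And>x h. \<bar>\<phi> (x + h) - \<phi> x - dir_deriv h \<phi> x\<bar> \<le> M * (norm h)\<^sup>2"
    using test_fun_taylor[OF \<phi>] by metis
  note int = integrable_conv_swap[OF g]
  have lin: "linear (\<lambda>v. dir_deriv v \<phi> y)" for y by (intro linear_dir_deriv
    test_fun_differentiable \<phi>)
  have dd: "test_fun (dir_deriv v \<phi>)" for v by (intro test_fun_dir_deriv \<phi>)
  have "linear (\<lambda>v. conv g (dir_deriv v \<phi>) x)"
    unfolding conv_swap[OF g dd]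
    by (rule linearI) (simp_all add: linear_add[OF lin] linear_scale[OF lin] distrib_left int dd
      mult.left_commute)
  then have bl: "bounded_linear (\<lambda>v. conv g (dir_deriv v \<phi>) x)"
    by (rule linear_conv_bounded_linear[THEN iffD1])
  define C where "C = M * (\<integral>y. \<bar>g y\<bar> \<partial>lborel)"
  have bound: "\<bar>conv g \<phi> (x + h) - conv g \<phi> x - conv g (dir_deriv h \<phi>) x\<bar> \<le> C * (norm h)\<^sup>2" for h
  proof -
    define a b c where "a y = g y * \<phi> (x + h - y)" and "b y = g y * \<phi> (x - y)"
      and "c y = g y * dir_deriv h \<phi> (x - y)" for y
    have iabc: "integrable lborel a" "integrable lborel b" "integrable lborel c"
      unfolding a_def b_def c_def by (intro int \<phi> dd)+
    have "conv g \<phi> (x + h) = integral\<^sup>L lborel a" "conv g \<phi> x = integral\<^sup>L lborel b"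
      "conv g (dir_deriv h \<phi>) x = integral\<^sup>L lborel c"
      unfolding a_def b_def c_def by (intro conv_swap g \<phi> dd)+
    then have "conv g \<phi> (x + h) - conv g \<phi> x - conv g (dir_deriv h \<phi>) x =
      (\<integral>y. a y - b y - c y \<partial>lborel)"
      using iabc by simp
    also have "\<bar>\<dots>\<bar> \<le> (\<integral>y. \<bar>a y - b y - c y\<bar> \<partial>lborel)"
      by (rule integral_abs_bound)
    also have "\<dots> \<le> (\<integral>y. (M * (norm h)\<^sup>2) * \<bar>g y\<bar> \<partial>lborel)"
    proof (rule integral_mono)
      show "integrable lborel (\<lambda>y. \<bar>a y - b y - c y\<bar>)"
        using iabc by simp
      show "integrable lborel (\<lambda>y. (M * (norm h)\<^sup>2) * \<bar>g y\<bar>)"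
        using g by simp
      fix y
      have "a y - b y - c y = g y * (\<phi> ((x - y) + h) - \<phi> (x - y) - dir_deriv h \<phi> (x - y))"
        by (simp add: a_def b_def c_def algebra_simps)
      also have "\<bar>\<dots>\<bar> \<le> \<bar>g y\<bar> * (M * (norm h)\<^sup>2)"
        unfolding abs_mult by (rule mult_left_mono) (use M in auto)
      finally show "\<bar>a y - b y - c y\<bar> \<le> (M * (norm h)\<^sup>2) * \<bar>g y\<bar>"
        by (simp add: mult.commute)
    qed
    also have "\<dots> = C * (norm h)\<^sup>2" by (simp add: C_def)
    finally show ?thesis .
  qed
  show ?thesis
  proof (rule has_derivativeI_sandwich[of 1 _ _ _ _ "\<lambda>y. C * norm (y - x)"])
    fix y assume "y \<noteq> x"
    then show "norm (conv g \<phi> y - conv g \<phi> x - conv g (dir_deriv (y - x) \<phi>) x) / norm (y - x) \<le>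
      C * norm (y - x)"
      using bound[of "y - x"] by (simp add: divide_le_eq power2_eq_square mult.assoc)
  next
    have "((\<lambda>y. C * norm (y - x)) \<longlongrightarrow> C * norm (x - x)) (at x)" by (intro tendsto_intros)
    then show "((\<lambda>y. C * norm (y - x)) \<longlongrightarrow> 0) (at x)" by simp
  qed (use bl in auto)
qed

lemma dir_deriv_conv:
  assumes "integrable lborel g" "test_fun \<phi>"
  shows "dir_deriv v (conv g \<phi>) = conv g (dir_deriv v \<phi>)"
  by (rule ext) (rule dir_derivI[OF conv_has_derivative[OF assms]])

lemma smooth_on_conv:
  assumes "integrable lborel g" "test_fun \<phi>"
  shows "smooth_on UNIV (conv g \<phi>)"
proof (rule smooth_on_UNIV_coinduct[where X = "{conv g \<phi> | \<phi>. test_fun \<phi>}"])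
  show "conv g \<phi> \<in> {conv g \<phi> | \<phi>. test_fun \<phi>}" using assms(2) by blast
next
  fix h x v assume "h \<in> {conv g \<phi> | \<phi>. test_fun \<phi>}"
  then obtain \<phi> where h: "h = conv g \<phi>" and \<phi>: "test_fun \<phi>" by blast
  show "h differentiable (at x)"
    unfolding h differentiable_def using conv_has_derivative[OF assms(1) \<phi>] by blast
  show "dir_deriv v h \<in> {conv g \<phi> | \<phi>. test_fun \<phi>}"
    unfolding h dir_deriv_conv[OF assms(1) \<phi>] using test_fun_dir_deriv[OF \<phi>] by blast
qed

lemma test_fun_conv:
  assumes "continuous_on UNIV g" "\<And>x. norm x > B \<Longrightarrow> g x = 0" "test_fun \<phi>"
  shows "test_fun (conv g \<phi>)"
proof -
  obtain B' where B': "\<And>x. norm x > B' \<Longrightarrow> \<phi> x = 0" using assms(3) by (auto simp: test_fun_def)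
  have "conv g \<phi> x = 0" if "norm x > B + B'" for x
  proof -
    have "g (x - y) * \<phi> y = 0" for y
      using assms(2)[of "x - y"] B'[of y] norm_triangle_ineq2[of x y] that
        by (cases "norm y > B'") auto
    then show ?thesis unfolding conv_def by (simp only: Bochner_Integration.integral_zero)
  qed
  moreover have "smooth_on UNIV (conv g \<phi>)"
    using assms by (intro smooth_on_conv integrable_continuous_compact_support[of g B])
  ultimately show ?thesis unfolding test_fun_def by blast
qed

lemma smooth_on_ball_conv:
  assumes "continuous_on UNIV g" "mollifier d \<rho>"
  shows "smooth_on (ball 0 R) (conv g \<rho>)"
proof -
  define g' where "g' x = indicator (cball 0 (R + d)) x *\<^sub>R g x" for x
  have "integrable lborel g'"
    unfolding g'_def using assms(1) by (intro borel_integrable_compact) (auto intro: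
      continuous_on_subset)
  then have "smooth_on (ball 0 R) (conv g' \<rho>)"
    using assms(2) smooth_on_subset[OF smooth_on_conv] by (auto simp: mollifier_def)
  then show ?thesis
  proof (rule smooth_on_cong[rotated 2])
    fix x :: 'a assume x: "x \<in> ball 0 R"
    show "conv g' \<rho> x = conv g \<rho> x"
    proof (rule conv_cong[OF assms(2)])
      fix y assume "dist x y \<le> d"
      then have "norm y \<le> R + d" using x norm_triangle_ineq2[of y x]
        by (auto simp: dist_norm norm_minus_commute)
      then show "g' y = g y" by (simp add: g'_def)
    qed
  qed simp
qed

section \<open>Random walks and the maximum principle\<close>

text \<open>One step of the random walk that moves by \<open>h b\<^sub>k\<close> or \<open>- h b\<^sub>k\<close>, each with the same
  probability.  A
step corresponds to the time \<open>\<tau> = h\<^sup>2 / (2 card I)\<close> of the flow generated by \<open>diffusion\<close>.\<close>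

definition walk :: "real \<Rightarrow> 'i set \<Rightarrow> ('i \<Rightarrow> 'a::euclidean_space) \<Rightarrow> ('a \<Rightarrow> real) \<Rightarrow> 'a \<Rightarrow> real"
  where "walk h I b \<phi> x = (\<Sum>k\<in>I. \<phi> (x + h *\<^sub>R b k) + \<phi> (x - h *\<^sub>R b k)) / (2 * real (card I))"

definition diffusion :: "'i set \<Rightarrow> ('i \<Rightarrow> 'a::euclidean_space) \<Rightarrow> ('a \<Rightarrow> real) \<Rightarrow> 'a \<Rightarrow> real"
  where "diffusion I b \<phi> x = (\<Sum>k\<in>I. dir_deriv (b k) (dir_deriv (b k) \<phi>) x)"

locale steps =
  fixes I :: "'i set" and b :: "'i \<Rightarrow> 'a::euclidean_space"
  assumes fin: "finite I" and ne: "I \<noteq> {}"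
begin

abbreviation "K \<equiv> real (card I)"
abbreviation "T h \<equiv> walk h I b"
abbreviation "L \<equiv> diffusion I b"
abbreviation "D2 k \<phi> \<equiv> dir_deriv (b k) (dir_deriv (b k) \<phi>)"

lemma K_pos: "K > 0" using fin ne by (simp add: card_gt_0_iff)

lemma walk_mono: "(\<And>x. \<phi> x \<le> \<psi> x) \<Longrightarrow> T h \<phi> x \<le> T h \<psi> x"
  unfolding walk_def using K_pos by (intro divide_right_mono sum_mono add_mono) auto

lemma walk_add: "T h (\<lambda>x. \<phi> x + \<psi> x) x = T h \<phi> x + T h \<psi> x"
  unfolding walk_def by (simp add: sum.distrib add_divide_distrib[symmetric])

lemma walk_const: "T h (\<lambda>x. c) x = c"
  unfolding walk_def using K_pos by simp

lemma walk_scale: "T h (\<lambda>x. c * \<phi> x) x = c * T h \<phi> x"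
  unfolding walk_def by (simp add: sum_distrib_left[symmetric] distrib_left[symmetric])

lemma walk_pow_mono: "(\<And>x. \<phi> x \<le> \<psi> x) \<Longrightarrow> (T h ^^ m) \<phi> x \<le> (T h ^^ m) \<psi> x"
  by (induction m arbitrary: x) (auto intro: walk_mono)

lemma walk_pow_add: "(T h ^^ m) (\<lambda>x. \<phi> x + \<psi> x) = (\<lambda>x. (T h ^^ m) \<phi> x + (T h ^^ m) \<psi> x)"
  by (induction m) (auto simp: walk_add)

lemma walk_pow_const: "(T h ^^ m) (\<lambda>x. c) = (\<lambda>x. c)"
  by (induction m) (auto simp: walk_const)

lemma walk_pow_scale: "(T h ^^ m) (\<lambda>x. c * \<phi> x) = (\<lambda>x. c * (T h ^^ m) \<phi> x)"
  by (induction m) (auto simp: walk_scale)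

lemma walk_pow_lipschitz:
  assumes "\<And>x y. \<bar>\<phi> x - \<phi> y\<bar> \<le> M * norm (x - y)"
  shows "\<bar>(T h ^^ m) \<phi> x - (T h ^^ m) \<phi> y\<bar> \<le> M * norm (x - y)"
proof (induction m arbitrary: x y)
  case (Suc m)
  let ?p = "(T h ^^ m) \<phi>"
  have "\<bar>T h ?p x - T h ?p y\<bar> =
    \<bar>\<Sum>k\<in>I. (?p (x + h *\<^sub>R b k) - ?p (y + h *\<^sub>R b k)) + (?p (x - h *\<^sub>R b k) - ?p (y - h *\<^sub>R b k))\<bar>
      / (2 * K)"
    using K_pos unfolding walk_def diff_divide_distrib[symmetric] sum_subtractf[symmetric]
      abs_divide
    by (simp add: algebra_simps)
  also have "\<dots> \<le> (\<Sum>k\<in>I. M * norm (x - y) + M * norm (x - y)) / (2 * K)"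
  proof (intro divide_right_mono order_trans[OF sum_abs] sum_mono order_trans[OF
    abs_triangle_ineq] add_mono)
    fix k
    show "\<bar>?p (x + h *\<^sub>R b k) - ?p (y + h *\<^sub>R b k)\<bar> \<le> M * norm (x - y)"
      using Suc[of "x + h *\<^sub>R b k" "y + h *\<^sub>R b k"] by simp
    show "\<bar>?p (x - h *\<^sub>R b k) - ?p (y - h *\<^sub>R b k)\<bar> \<le> M * norm (x - y)"
      using Suc[of "x - h *\<^sub>R b k" "y - h *\<^sub>R b k"] by simp
  qed (use K_pos in auto)
  also have "\<dots> = M * norm (x - y)" using K_pos by simp
  finally show ?case by simp
qed (use assms in auto)

lemma walk_near:
  assumes "\<And>x y. \<bar>\<phi> x - \<phi> y\<bar> \<le> M * norm (x - y)" "M \<ge> 0" "h \<ge> 0" "\<And>k. k \<in> I \<Longrightarrow> norm (b k) \<le> B"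
  shows "\<bar>T h \<phi> x - \<phi> x\<bar> \<le> M * h * B"
proof -
  have "T h \<phi> x - \<phi> x = (\<Sum>k\<in>I. (\<phi> (x + h *\<^sub>R b k) - \<phi> x) + (\<phi> (x - h *\<^sub>R b k) - \<phi> x)) / (2 * K)"
    unfolding walk_def using K_pos by (simp add: sum.distrib sum_subtractf field_simps)
  also have "\<bar>\<dots>\<bar> = \<bar>\<Sum>k\<in>I. (\<phi> (x + h *\<^sub>R b k) - \<phi> x) + (\<phi> (x - h *\<^sub>R b k) - \<phi> x)\<bar> / (2 * K)"
    using K_pos by simp
  also have "\<dots> \<le> (\<Sum>k\<in>I. M * h * B + M * h * B) / (2 * K)"
  proof (intro divide_right_mono order_trans[OF sum_abs] sum_mono order_trans[OF
    abs_triangle_ineq] add_mono)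
    fix k assume "k \<in> I"
    then have *: "M * norm (h *\<^sub>R b k) \<le> M * h * B"
      using assms by (simp add: mult.assoc mult_left_mono)
    show "\<bar>\<phi> (x + h *\<^sub>R b k) - \<phi> x\<bar> \<le> M * h * B"
      using assms(1)[of "x + h *\<^sub>R b k" x] * by simp
    show "\<bar>\<phi> (x - h *\<^sub>R b k) - \<phi> x\<bar> \<le> M * h * B"
      using assms(1)[of "x - h *\<^sub>R b k" x] * by simp
  qed (use K_pos in auto)
  also have "\<dots> = M * h * B" using K_pos by simp
  finally show ?thesis .
qed

lemma test_fun_walk: "test_fun \<phi> \<Longrightarrow> test_fun (T h \<phi>)"
proof -
  assume \<phi>: "test_fun \<phi>"
  have "test_fun (\<lambda>x. (1 / (2 * K)) * (\<Sum>k\<in>I. \<phi> (x + h *\<^sub>R b k) + \<phi> (x + - (h *\<^sub>R b k))))"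
    by (intro test_fun_scale test_fun_sum test_fun_add test_fun_translate \<phi>)
  moreover have "(\<lambda>x. (1 / (2 * K)) * (\<Sum>k\<in>I. \<phi> (x + h *\<^sub>R b k) + \<phi> (x + - (h *\<^sub>R b k)))) = T h \<phi>"
    by (rule ext) (simp add: walk_def)
  ultimately show ?thesis by simp
qed

lemma test_fun_walk_pow: "test_fun \<phi> \<Longrightarrow> test_fun ((T h ^^ m) \<phi>)"
  by (induction m) (auto intro: test_fun_walk)

lemma dir_deriv_walk:
  assumes \<phi>: "test_fun \<phi>" shows "dir_deriv v (T h \<phi>) = T h (dir_deriv v \<phi>)"
proof
  fix x
  have *: "((\<lambda>x. \<phi> (x + a)) has_derivative (\<lambda>v. dir_deriv v \<phi> (x + a))) (at x)" for a
    by (intro has_derivative_translate has_derivative_dir_deriv test_fun_differentiable \<phi>)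
  have "((\<lambda>x. (1 / (2 * K)) * (\<Sum>k\<in>I. \<phi> (x + h *\<^sub>R b k) + \<phi> (x + - (h *\<^sub>R b k)))) has_derivative
     (\<lambda>v. (1 / (2 * K)) * (\<Sum>k\<in>I. dir_deriv v \<phi> (x + h *\<^sub>R b k) + dir_deriv v \<phi> (x + - (h *\<^sub>R b
       k))))) (at x)"
    by (intro has_derivative_mult_right has_derivative_sum has_derivative_add *)
  then have "(T h \<phi> has_derivative (\<lambda>v. T h (dir_deriv v \<phi>) x)) (at x)"
    by (simp add: walk_def[abs_def])
  then show "dir_deriv v (T h \<phi>) x = T h (dir_deriv v \<phi>) x" by (rule dir_derivI)
qed

lemma diffusion_walk:
  assumes "test_fun \<phi>" shows "L (T h \<phi>) = T h (L \<phi>)"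
proof
  fix x
  have "L (T h \<phi>) x = (\<Sum>k\<in>I. T h (dir_deriv (b k) (dir_deriv (b k) \<phi>)) x)"
    unfolding diffusion_def by (simp add: dir_deriv_walk assms test_fun_dir_deriv)
  also have "\<dots> = T h (L \<phi>) x"
    unfolding walk_def diffusion_def sum_divide_distrib[symmetric]
    by (subst sum.swap) (simp add: sum.distrib)
  finally show "L (T h \<phi>) x = T h (L \<phi>) x" .
qed

lemma test_fun_diffusion: "test_fun \<phi> \<Longrightarrow> test_fun (L \<phi>)"
  unfolding diffusion_def[abs_def] by (intro test_fun_sum test_fun_dir_deriv)

text \<open>Consistency of the scheme: up to a relative error of order \<open>h\<close>, a step is an Euler step of
  length
\<open>\<tau>\<close> for the heat flow.\<close>

lemma walk_consistent:
  assumes \<phi>: "test_fun \<phi>" and h: "h > 0" and "M \<ge> 0" and B: "\<And>k. k \<in> I \<Longrightarrow> norm (b k) \<le> B"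
    and M: "\<And>k x y. k \<in> I \<Longrightarrow> \<bar>D2 k \<phi> x - D2 k \<phi> y\<bar> \<le> M * norm (x - y)"
  shows "\<bar>T h \<phi> x - \<phi> x - h\<^sup>2 / (2 * K) * L \<phi> x\<bar> \<le> h\<^sup>2 / (2 * K) * (K * (M * h * B))"
proof -
  have summand: "\<bar>\<phi> (x + h *\<^sub>R b k) + \<phi> (x - h *\<^sub>R b k) - 2 * \<phi> x - h\<^sup>2 * D2 k \<phi> x\<bar> \<le>
    h\<^sup>2 * (M * h * B)"
    if k: "k \<in> I" for k
  proof -
    let ?D = "D2 k \<phi>"
    obtain t where t: "0 < t" "t < h" "\<phi> (x + h *\<^sub>R b k) + \<phi> (x - h *\<^sub>R b k) - 2 * \<phi> x =
        h\<^sup>2 / 2 * (?D (x + t *\<^sub>R b k) + ?D (x - t *\<^sub>R b k))"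
      using second_difference[OF test_fun_Ck_on[OF \<phi>] h] by metis
    have tb: "norm (t *\<^sub>R b k) \<le> h * B" using t B[OF k] by (auto intro!: mult_mono)
    have "\<bar>?D (x + t *\<^sub>R b k) - ?D x\<bar> \<le> M * norm (t *\<^sub>R b k)" "\<bar>?D (x - t *\<^sub>R b k) - ?D x\<bar> \<le>
      M * norm (t *\<^sub>R b k)"
      using M[OF k, of "x + t *\<^sub>R b k" x] M[OF k, of "x - t *\<^sub>R b k" x] by simp_all
    then have "\<bar>?D (x + t *\<^sub>R b k) - ?D x\<bar> \<le> M * h * B" "\<bar>?D (x - t *\<^sub>R b k) - ?D x\<bar> \<le> M * h * B"
      using mult_left_mono[OF tb \<open>M \<ge> 0\<close>] by (simp_all add: mult.assoc)
    then have "\<bar>(?D (x + t *\<^sub>R b k) + ?D (x - t *\<^sub>R b k)) / 2 - ?D x\<bar> \<le> M * h * B"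
      by (simp add: abs_le_iff field_simps)
    from mult_left_mono[OF this, of "h\<^sup>2"]
    have "\<bar>h\<^sup>2 * ((?D (x + t *\<^sub>R b k) + ?D (x - t *\<^sub>R b k)) / 2 - ?D x)\<bar> \<le> h\<^sup>2 * (M * h * B)"
      by (simp add: abs_mult)
    then show ?thesis unfolding t(3) by (simp add: algebra_simps add_divide_distrib)
  qed
  have "T h \<phi> x - \<phi> x - h\<^sup>2 / (2 * K) * L \<phi> x =
    (\<Sum>k\<in>I. \<phi> (x + h *\<^sub>R b k) + \<phi> (x - h *\<^sub>R b k) - 2 * \<phi> x - h\<^sup>2 * D2 k \<phi> x) / (2 * K)"
    unfolding walk_def diffusion_def using K_pos
    by (simp add: sum.distrib sum_subtractf sum_distrib_left sum_divide_distrib diff_divide_distrib)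
  also have "\<bar>\<dots>\<bar> \<le> (\<Sum>k\<in>I. h\<^sup>2 * (M * h * B)) / (2 * K)"
  proof -
    have "\<bar>\<Sum>k\<in>I. \<phi> (x + h *\<^sub>R b k) + \<phi> (x - h *\<^sub>R b k) - 2 * \<phi> x - h\<^sup>2 * D2 k \<phi> x\<bar>
        \<le> (\<Sum>k\<in>I. h\<^sup>2 * (M * h * B))"
      by (rule order_trans[OF sum_abs]) (intro sum_mono summand)
    from divide_right_mono[OF this, of "2 * K"] show ?thesis using K_pos by simp
  qed
  finally show ?thesis using K_pos by (simp add: ac_simps)
qed

lemma step_bound: obtains B where "B \<ge> 0" "\<And>k. k \<in> I \<Longrightarrow> norm (b k) \<le> B"
proof (rule that)
  show "0 \<le> (\<Sum>k\<in>I. norm (b k))" by (simp add: sum_nonneg)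
  show "norm (b k) \<le> (\<Sum>k\<in>I. norm (b k))" if "k \<in> I" for k
    using that fin by (intro member_le_sum) auto
qed

lemma second_lipschitz:
  assumes "test_fun \<phi>"
  obtains M where "M \<ge> 0" "\<And>k x y. k \<in> I \<Longrightarrow>
     \<bar>D2 k \<phi> x - D2 k \<phi> y\<bar> \<le> M * norm (x - y)"
proof -
  have "\<forall>k. \<exists>M\<ge>0. \<forall>x y. \<bar>D2 k \<phi> x - D2 k \<phi> y\<bar> \<le> M * norm (x - y)"
    using test_fun_lipschitz[OF test_fun_dir_deriv[OF test_fun_dir_deriv[OF assms]]] by metis
  then obtain M where M: "\<And>k. M k \<ge> 0" "\<And>k x y. \<bar>D2 k \<phi> x - D2 k \<phi> y\<bar> \<le> M k * norm (x - y)"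
    by metis
  show thesis
  proof (rule that[of "\<Sum>k\<in>I. M k"])
    fix k x y assume "k \<in> I"
    then have "M k \<le> (\<Sum>k\<in>I. M k)" using fin M by (intro member_le_sum) auto
    then show "\<bar>D2 k \<phi> x - D2 k \<phi> y\<bar> \<le> (\<Sum>k\<in>I. M k) * norm (x - y)"
      using M(2)[of k x y] by (meson mult_right_mono norm_ge_zero order_trans)
  qed (auto intro: sum_nonneg M)
qed

lemma diffusion_lipschitz:
  assumes "\<And>k x y. k \<in> I \<Longrightarrow>
     \<bar>D2 k \<phi> x - D2 k \<phi> y\<bar> \<le> M * norm (x - y)"
  shows "\<bar>L \<phi> x - L \<phi> y\<bar> \<le> (K * M) * norm (x - y)"
proof -
  have "\<bar>L \<phi> x - L \<phi> y\<bar> \<le> (\<Sum>k\<in>I. \<bar>D2 k \<phi> x - D2 k \<phi> y\<bar>)"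
    unfolding diffusion_def sum_subtractf[symmetric] by (rule sum_abs)
  also have "\<dots> \<le> (\<Sum>k\<in>I. M * norm (x - y))" by (intro sum_mono assms)
  finally show ?thesis by simp
qed

lemma walk_pow_growth:
  assumes le: "\<And>x. T h \<phi> x \<le> \<phi> x + \<tau> * c" 
  shows "(T h ^^ m) \<phi> x \<le> \<phi> x + real m * \<tau> * c"
proof (induction m arbitrary: x)
  case (Suc m)
  have "(T h ^^ Suc m) \<phi> x \<le> T h (\<lambda>x. \<phi> x + real m * \<tau> * c) x"
    using Suc by (auto intro: walk_mono)
  also have "\<dots> = T h \<phi> x + real m * \<tau> * c" by (simp add: walk_add walk_const)
  also have "\<dots> \<le> \<phi> x + real (Suc m) * \<tau> * c" using le[of x] by (simp add: algebra_simps)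
  finally show ?case .
qed simp

text \<open>Each of the \<open>m\<close> steps adds \<open>\<tau> L \<phi>\<close>, averaged over the walk so far.  During the time \<open>m \<tau>\<close> this
average moves by at most \<open>m \<tau> C\<close>, where \<open>C\<close> bounds the second derivatives of \<open>L \<phi>\<close>.\<close>

lemma walk_pow_expansion:
  assumes \<phi>: "test_fun \<phi>"
  obtains C D where "C \<ge> 0" "D \<ge> 0" "\<And>h m x. h > 0 \<Longrightarrow>
    (T h ^^ m) \<phi> x \<le> \<phi> x + (real m * (h\<^sup>2 / (2 * K))) * (L \<phi> x + (real m * (h\<^sup>2 / (2 * K))) * C +
      h * D)"
proof -
  obtain B where B: "B \<ge> 0" "\<And>k. k \<in> I \<Longrightarrow> norm (b k) \<le> B" using step_bound by blast
  obtain M where M: "M \<ge> 0" "\<And>k x y. k \<in> I \<Longrightarrow>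
     \<bar>D2 k \<phi> x - D2 k \<phi> y\<bar> \<le> M * norm (x - y)"
    using second_lipschitz[OF \<phi>] by blast
  have L\<phi>: "test_fun (L \<phi>)" by (rule test_fun_diffusion) fact
  have "\<forall>k. \<exists>C\<ge>0. \<forall>x. \<bar>D2 k (L \<phi>) x\<bar> \<le> C"
    using test_fun_bounded[OF test_fun_dir_deriv[OF test_fun_dir_deriv[OF L\<phi>]]] by metis
  then obtain c where c: "\<And>k. c k \<ge> 0" "\<And>k x. \<bar>D2 k (L \<phi>) x\<bar> \<le> c k" by metis
  define C where "C = (\<Sum>k\<in>I. c k)"
  have C0: "C \<ge> 0" unfolding C_def by (intro sum_nonneg c)
  have step: "T h (L \<phi>) x \<le> L \<phi> x + (h\<^sup>2 / (2 * K)) * C" if "h > 0" for h x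
  proof -
    have "\<phi>' (x + h *\<^sub>R b k) + \<phi>' (x - h *\<^sub>R b k) - 2 * \<phi>' x \<le> h\<^sup>2 * c k" if eq: "\<phi>' = L \<phi>" for k \<phi>'
    proof -
      let ?D = "D2 k \<phi>'"
      obtain t where t: "\<phi>' (x + h *\<^sub>R b k) + \<phi>' (x - h *\<^sub>R b k) - 2 * \<phi>' x =
          h\<^sup>2 / 2 * (?D (x + t *\<^sub>R b k) + ?D (x - t *\<^sub>R b k))"
        using second_difference[OF test_fun_Ck_on[OF L\<phi>] \<open>h > 0\<close>] eq by metis
      have "?D (x + t *\<^sub>R b k) + ?D (x - t *\<^sub>R b k) \<le> c k + c k"
        using c(2)[of k "x + t *\<^sub>R b k"] c(2)[of k "x - t *\<^sub>R b k"] unfolding eq by linarith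
      from mult_left_mono[OF this, of "h\<^sup>2 / 2"] show ?thesis unfolding t by simp
    qed
    then have "(\<Sum>k\<in>I. L \<phi> (x + h *\<^sub>R b k) + L \<phi> (x - h *\<^sub>R b k) - 2 * L \<phi> x) \<le> (\<Sum>k\<in>I. h\<^sup>2 * c k)"
      by (intro sum_mono) auto
    then have "(\<Sum>k\<in>I. L \<phi> (x + h *\<^sub>R b k) + L \<phi> (x - h *\<^sub>R b k)) \<le> (2 * K) * L \<phi> x + h\<^sup>2 * C"
      by (simp add: sum_subtractf C_def sum_distrib_left)
    from divide_right_mono[OF this, of "2 * K"] show ?thesis
      unfolding walk_def using K_pos by (simp add: add_divide_distrib)
  qed
  define D where "D = K * (M * B)"
  have D0: "D \<ge> 0" using B M K_pos by (simp add: D_def)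
  have "(T h ^^ m) \<phi> x \<le> \<phi> x + (real m * (h\<^sup>2 / (2 * K))) * (L \<phi> x + (real m * (h\<^sup>2 / (2 * K))) *
    C + h * D)"
    if h: "h > 0" for h m x
  proof -
    define \<tau> where "\<tau> = h\<^sup>2 / (2 * K)"
    have \<tau>: "\<tau> \<ge> 0" using K_pos by (simp add: \<tau>_def)
    have one: "T h \<phi> x \<le> \<phi> x + \<tau> * (L \<phi> x + h * D)" for x
      using walk_consistent[OF \<phi> h M(1) B(2) M(2), of x] unfolding \<tau>_def[symmetric] D_def
      by (simp add: algebra_simps abs_le_iff)
    have "(T h ^^ m) \<phi> x \<le> \<phi> x + real m * \<tau> * (L \<phi> x + real m * \<tau> * C + h * D)"
    proof (induction m arbitrary: x)
      case (Suc m)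
      have "(T h ^^ Suc m) \<phi> x = (T h ^^ m) (T h \<phi>) x" by (simp add: funpow_swap1)
      also have "\<dots> \<le> (T h ^^ m) (\<lambda>x. \<phi> x + \<tau> * (L \<phi> x + h * D)) x"
        by (rule walk_pow_mono) (rule one)
      also have "\<dots> = (T h ^^ m) \<phi> x + \<tau> * ((T h ^^ m) (L \<phi>) x + h * D)"
        by (simp add: walk_pow_add walk_pow_scale walk_pow_const)
      also have "\<dots> \<le> (\<phi> x + real m * \<tau> * (L \<phi> x + real m * \<tau> * C + h * D)) + \<tau> * ((L \<phi> x + real m
        * \<tau> * C) + h * D)"
        using step[OF h] unfolding \<tau>_def[symmetric]
        by (intro add_mono Suc mult_left_mono \<tau> walk_pow_growth order_refl) auto
      also have "\<dots> \<le> \<phi> x + real (Suc m) * \<tau> * (L \<phi> x + real (Suc m) * \<tau> * C + h * D)"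
      proof -
        have "0 \<le> \<tau> * \<tau> * C" using \<tau> C0 by simp
        then have "0 \<le> real (Suc m) * (\<tau> * \<tau> * C)" by simp
        then show ?thesis by (simp add: algebra_simps)
      qed
      finally show ?case .
    qed simp
    then show ?thesis unfolding \<tau>_def .
  qed
  with C0 D0 show thesis by (rule that)
qed

lemma dir_deriv2_walk_pow:
  assumes "test_fun \<phi>"
  shows "dir_deriv u (dir_deriv v ((T h ^^ m) \<phi>)) = (T h ^^ m) (dir_deriv u (dir_deriv v \<phi>))"
proof -
  have "dir_deriv v ((T h ^^ m) \<phi>) = (T h ^^ m) (dir_deriv v \<phi>)" if "test_fun \<phi>" for v \<phi>
    using that by (induction m) (auto simp: dir_deriv_walk test_fun_walk_pow)
  then show ?thesis using assms by (simp add: test_fun_dir_deriv)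
qed

text \<open>The maximum principle: a stationary subsolution \<open>g\<close> stays below the discrete heat flow that
  starts
above it.  At a maximum point \<open>z\<close> of \<open>g - T\<^sup>m\<^sup>+\<^sup>1 V\<close> the viscosity inequality bounds \<open>L (T\<^sup>m\<^sup>+\<^sup>1
  V)\<close> from
below, so the last step lowered the flow at \<open>z\<close> by at most \<open>\<tau> (\<beta> + O(h))\<close>, and the maximum of
\<open>g - T\<^sup>m V\<close> rises by no more than that.  A positive maximum is attained, because \<open>g\<close> has compact
support and the flow is nonnegative.\<close>

lemma below_walk_pow:
  assumes g: "continuous_on UNIV g" "\<And>x. norm x > R \<Longrightarrow> g x = 0"
    and visc: "\<And>V x. test_fun V \<Longrightarrow> (\<And>y. g y - V y \<le> g x - V x) \<Longrightarrow> - \<beta> \<le> L V x"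
    and "\<beta> \<ge> 0" and V: "test_fun V" "\<And>x. 0 \<le> V x" and "e \<ge> 0" and gV: "\<And>x. g x \<le> V x + e"
  obtains D where "D \<ge> 0"
    "\<And>h m x. h > 0 \<Longrightarrow> g x \<le> (T h ^^ m) V x + e + (real m * (h\<^sup>2 / (2 * K))) * (\<beta> + h * D)"
proof -
  obtain B where B: "B \<ge> 0" "\<And>k. k \<in> I \<Longrightarrow> norm (b k) \<le> B" using step_bound by blast
  obtain M where M: "M \<ge> 0" "\<And>k x y. k \<in> I \<Longrightarrow>
     \<bar>D2 k V x - D2 k V y\<bar> \<le> M * norm (x - y)"
    using second_lipschitz[OF V(1)] by blast
  define D where "D = 2 * (K * (M * B))"
  have D0: "D \<ge> 0" using B M K_pos by (simp add: D_def)
  have "g x \<le> (T h ^^ m) V x + e + (real m * (h\<^sup>2 / (2 * K))) * (\<beta> + h * D)" if h: "h > 0" for h m x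
  proof (induction m arbitrary: x)
    case 0
    then show ?case using gV by simp
  next
    case (Suc m)
    define \<tau> where "\<tau> = h\<^sup>2 / (2 * K)"
    have \<tau>: "\<tau> \<ge> 0" using K_pos by (simp add: \<tau>_def)
    define P where "P = (T h ^^ m) V"
    define P' where "P' = (T h ^^ Suc m) V"
    have P: "test_fun P" "test_fun P'" unfolding P_def P'_def by (intro test_fun_walk_pow V)+
    have P'_eq: "P' = T h P" by (simp add: P_def P'_def)
    have P'0: "0 \<le> P' x" for x
      using walk_pow_mono[of "\<lambda>_. 0" V "Suc m" h x] V(2) unfolding P'_def walk_pow_const by simp
    have PM: "\<bar>D2 k P x - D2 k P y\<bar> \<le> M * norm (x - y)"
      if "k \<in> I" for k x y
      unfolding P_def dir_deriv2_walk_pow[OF V(1)] by (intro walk_pow_lipschitz M that)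
    define c where "c = e + real (Suc m) * \<tau> * (\<beta> + h * D)"
    have c0: "c \<ge> 0" unfolding c_def using \<open>e \<ge> 0\<close> \<open>\<beta> \<ge> 0\<close> \<tau> D0 h by simp
    have "g x \<le> P' x + c"
    proof (rule ccontr)
      assume "\<not> g x \<le> P' x + c"
      then have x: "g x - P' x > c" by simp
      have xR: "norm x \<le> R"
        using x P'0[of x] c0 g(2)[of x] by (cases "norm x > R") auto
      have "\<exists>z\<in>cball 0 R. \<forall>y\<in>cball 0 R. g y - P' y \<le> g z - P' z"
        using xR order_trans[OF norm_ge_zero xR] by (intro continuous_attains_sup
          continuous_intros continuous_on_subset[OF g(1)] test_fun_continuous P) auto
      then obtain z where "\<forall>y\<in>cball 0 R. g y - P' y \<le> g z - P' z" by blast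
      then have z: "norm y \<le> R \<Longrightarrow> g y - P' y \<le> g z - P' z" for y by simp
      have zc: "g z - P' z > c" using z[OF xR] x by simp
      have max: "g y - P' y \<le> g z - P' z" for y
      proof (cases "norm y \<le> R")
        case False
        then have "g y - P' y \<le> 0" using g(2)[of y] P'0[of y] by simp
        then show ?thesis using zc c0 by linarith
      qed (rule z)
      have "- \<beta> \<le> L P' z" by (rule visc[OF P(2) max])
      also have "L P' z = T h (L P) z" unfolding P'_eq by (simp add: diffusion_walk P)
      also have "\<dots> \<le> L P z + (K * M) * h * B"
        using walk_near[OF diffusion_lipschitz[OF PM] _ _ B(2), of h z] h M(1) K_pos
          by (simp add: abs_le_iff)
      finally have *: "- \<beta> - K * M * h * B \<le> L P z" by simp
      have "P' z \<ge> P z + \<tau> * (L P z - K * (M * h * B))"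
        using walk_consistent[OF P(1) h M(1) B(2) PM, of z] unfolding P'_eq \<tau>_def[symmetric]
        by (simp add: abs_le_iff algebra_simps)
      moreover have "\<tau> * (- \<beta> - h * D) \<le> \<tau> * (L P z - K * (M * h * B))"
        using * by (intro mult_left_mono \<tau>) (simp add: D_def algebra_simps)
      moreover have "g z \<le> P z + e + real m * \<tau> * (\<beta> + h * D)"
        using Suc[of z] unfolding P_def \<tau>_def .
      ultimately have "g z - P' z \<le> e + real m * \<tau> * (\<beta> + h * D) - \<tau> * (- \<beta> - h * D)" by linarith
      also have "\<dots> = c" by (simp add: c_def algebra_simps)
      finally show False using zc by simp
    qed
    then show ?case unfolding P'_def c_def \<tau>_def by simp
  qed
  with D0 show thesis by (rule that)
qed

lemma continuous_on_walk:
  assumes "continuous_on UNIV g" shows "continuous_on UNIV (T h g)"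
  unfolding walk_def[abs_def] using K_pos
  by (intro continuous_intros continuous_on_compose2[OF assms]) auto

lemma continuous_on_walk_pow: "continuous_on UNIV g \<Longrightarrow> continuous_on UNIV ((T h ^^ m) g)"
  by (induction m) (auto intro: continuous_on_walk)

lemma conv_sum:
  assumes "\<And>k. continuous_on UNIV (F k)" "test_fun \<phi>" "finite J"
  shows "conv (\<lambda>x. \<Sum>k\<in>J. F k x) \<phi> x = (\<Sum>k\<in>J. conv (F k) \<phi> x)"
  using assms(3)
proof induction
  case (insert j J)
  then show ?case using conv_add[of "F j" "\<lambda>x. \<Sum>k\<in>J. F k x" \<phi> x] assms
    by (simp add: continuous_on_sum)
qed (simp add: conv_def)

lemma conv_walk:
  assumes "continuous_on UNIV g" "test_fun \<phi>"
  shows "conv (T h g) \<phi> = T h (conv g \<phi>)"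
proof
  fix x
  have cont: "continuous_on UNIV (\<lambda>x. g (x + a))" for a
    by (intro continuous_on_compose2[OF assms(1)] continuous_intros) auto
  have "conv (T h g) \<phi> x = conv (\<lambda>x. (1 / (2 * K)) * (\<Sum>k\<in>I. g (x + h *\<^sub>R b k) + g (x + - (h *\<^sub>R b
    k)))) \<phi> x"
    by (simp add: walk_def[abs_def])
  also have "\<dots> = (1 / (2 * K)) * (\<Sum>k\<in>I. conv (\<lambda>x. g (x + h *\<^sub>R b k) + g (x + - (h *\<^sub>R b k))) \<phi> x)"
    unfolding conv_scale by (subst conv_sum[OF _ assms(2) fin]) (intro continuous_on_add cont,
      rule refl)
  also have "\<dots> = (1 / (2 * K)) * (\<Sum>k\<in>I. conv g \<phi> (x + h *\<^sub>R b k) + conv g \<phi> (x + - (h *\<^sub>R b k)))"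
    by (simp only: conv_add[OF cont cont assms(2)] conv_translate)
  finally show "conv (T h g) \<phi> x = T h (conv g \<phi>) x" by (simp add: walk_def)
qed

lemma conv_walk_pow:
  assumes "continuous_on UNIV g" "test_fun \<phi>"
  shows "conv ((T h ^^ m) g) \<phi> = (T h ^^ m) (conv g \<phi>)"
  by (induction m) (simp_all add: conv_walk continuous_on_walk_pow assms)

text \<open>A linear viscosity inequality survives mollification.  The previous lemma applies to a
mollification \<open>V\<close> of \<open>g\<close> with \<open>\<bar>V - g\<bar> \<le> e\<close>, and gives \<open>g \<le> T\<^sup>m g + 2 e + t (\<beta> + O(h))\<close> with \<open>t =
  m \<tau>\<close>.
Convolution with \<open>\<rho>\<close> is monotone and commutes with \<open>T\<close>, so \<open>G =
  g * \<rho>\<close> satisfies the same inequality;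
as \<open>G\<close> is smooth, \<open>T\<^sup>m G\<close> is at most \<open>G + t (L G + t C + O(h))\<close>.  Let \<open>h\<close>
  and \<open>e\<close> tend to \<open>0\<close>, divide by
\<open>t\<close>, and let \<open>t\<close> tend to \<open>0\<close>.\<close>

lemma diffusion_conv_lower:
  assumes g: "continuous_on UNIV g" "\<And>x. norm x > R \<Longrightarrow> g x = 0" "\<And>x. 0 \<le> g x"
    and visc: "\<And>V x. test_fun V \<Longrightarrow> (\<And>y. g y - V y \<le> g x - V x) \<Longrightarrow> - \<beta> \<le> L V x"
    and "\<beta> \<ge> 0" and \<rho>: "mollifier d \<rho>"
  shows "- \<beta> \<le> L (conv g \<rho>) x"
proof -
  define G where "G = conv g \<rho>"
  have t\<rho>: "test_fun \<rho>" using \<rho> by (simp add: mollifier_def)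
  have G: "test_fun G" unfolding G_def by (rule test_fun_conv[OF g(1,2) t\<rho>])
  obtain C D where CD: "C \<ge> 0" "D \<ge> 0" "\<And>h m x. h > 0 \<Longrightarrow>
    (T h ^^ m) G x \<le> G x + (real m * (h\<^sup>2 / (2 * K))) * (L G x + (real m * (h\<^sup>2 / (2 * K))) * C +
      h * D)"
    using walk_pow_expansion[OF G] by blast
  have uc: "\<exists>s>0. \<forall>x y. dist x y < s \<longrightarrow> \<bar>g y - g x\<bar> < e" if "e > 0" for e
  proof -
    have "uniformly_continuous_on (cball 0 (R + 1)) g"
      by (intro compact_uniformly_continuous continuous_on_subset[OF g(1)]) auto
    then have "\<exists>s>0. \<forall>x\<in>cball 0 (R + 1). \<forall>y\<in>cball 0 (R + 1). dist y x < s \<longrightarrow> dist (g y) (g x) < e"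
      using \<open>e > 0\<close> unfolding uniformly_continuous_on_def by (elim allE[of _ e]) simp
    then obtain s where s: "s > 0" "\<And>x y. x \<in> cball 0 (R + 1) \<Longrightarrow> y \<in> cball 0 (R + 1) \<Longrightarrow>
      dist y x < s \<Longrightarrow> dist (g y) (g x) < e"
      by blast
    have "\<bar>g y - g x\<bar> < e" if xy: "dist x y < min s 1" for x y
    proof (cases "norm x \<le> R + 1 \<and> norm y \<le> R + 1")
      case True
      then show ?thesis using s(2)[of x y] xy by (auto simp: dist_commute dist_real_def)
    next
      case False
      have "norm x \<le> norm y + dist x y" "norm y \<le> norm x + dist x y"
        using norm_triangle_sub[of x y] norm_triangle_sub[of y x]
          by (auto simp: dist_norm norm_minus_commute)
      then have "norm x > R" "norm y > R" using False xy by auto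
      then show ?thesis using g(2) \<open>e > 0\<close> by simp
    qed
    then show ?thesis using s(1) by (intro exI[of _ "min s 1"]) auto
  qed
  have step1: "0 \<le> t * (L G x + t * C) + 2 * e + t * \<beta>" if "t > 0" "e > 0" for t e
  proof -
    obtain s where s: "s > 0" "\<And>x y. dist x y < s \<Longrightarrow> \<bar>g y - g x\<bar> < e" using uc[OF \<open>e > 0\<close>] by blast
    obtain \<eta> :: "'a \<Rightarrow> real" where \<eta>: "mollifier (s / 2) \<eta>" using mollifier_exists[of "s / 2"] s(1)
      by auto
    define V where "V = conv g \<eta>"
    have t\<eta>: "test_fun \<eta>" using \<eta> by (simp add: mollifier_def)
    have V: "test_fun V" unfolding V_def by (rule test_fun_conv[OF g(1,2) t\<eta>])
    have near: "\<bar>V x - g x\<bar> \<le> e" for x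
      unfolding V_def by (rule conv_near[OF g(1) \<eta>]) (use s in \<open>force intro: less_imp_le\<close>)
    have V0: "0 \<le> V x" for x
      unfolding V_def conv_def using g(3) \<eta> by (intro integral_nonneg_AE AE_I2 mult_nonneg_nonneg)
        (auto simp: mollifier_def)
    have gV: "g x \<le> V x + e" for x using near[of x] by linarith
    have Vg: "V x \<le> g x + e" for x using near[of x] by linarith
    obtain D' where D': "D' \<ge> 0"
      "\<And>h m x. h > 0 \<Longrightarrow> g x \<le> (T h ^^ m) V x + e + (real m * (h\<^sup>2 / (2 * K))) * (\<beta> + h * D')"
      using below_walk_pow[OF g(1,2) visc \<open>\<beta> \<ge> 0\<close> V V0 less_imp_le[OF \<open>e > 0\<close>] gV] by blast
    \<comment> \<open>the step size for which \<open>n + 1\<close> steps take exactly the time \<open>t\<close>\<close>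
    define h where "h n = sqrt (2 * K * t / real (Suc n))" for n
    have h: "h n > 0" for n using K_pos \<open>t > 0\<close> by (simp add: h_def)
    have mt: "real (Suc n) * ((h n)\<^sup>2 / (2 * K)) = t" for n
      using K_pos \<open>t > 0\<close> by (simp add: h_def)
    have "0 \<le> t * (L G x + t * C) + 2 * e + t * \<beta> + h n * (t * D + t * D')" for n
    proof -
      let ?m = "Suc n"
      have "g y \<le> (T (h n) ^^ ?m) g y + (2 * e + t * (\<beta> + h n * D'))" for y
      proof -
        have "(T (h n) ^^ ?m) V y \<le> (T (h n) ^^ ?m) (\<lambda>x. g x + e) y"
          by (rule walk_pow_mono) (rule Vg)
        also have "\<dots> = (T (h n) ^^ ?m) g y + e"
          unfolding walk_pow_add walk_pow_const ..
        finally show ?thesis using D'(2)[of "h n" y ?m, OF h] unfolding mt by linarith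
      qed
      then have "conv g \<rho> x \<le> conv (\<lambda>y. (T (h n) ^^ ?m) g y + (2 * e + t * (\<beta> + h n * D'))) \<rho> x"
        by (intro conv_mono[OF g(1) _ \<rho>] continuous_on_add continuous_on_walk_pow g
          continuous_on_const)
      also have "\<dots> = (T (h n) ^^ ?m) G x + (2 * e + t * (\<beta> + h n * D'))"
        using \<rho> by (subst conv_add) (auto simp: conv_walk_pow[OF g(1) t\<rho>] G_def conv_const
          mollifier_def
            intro!: continuous_on_walk_pow g simp del: funpow.simps)
      also have "(T (h n) ^^ ?m) G x \<le> G x + t * (L G x + t * C + h n * D)"
        using CD(3)[of "h n" ?m x, OF h] unfolding mt .
      finally have "G x \<le> G x + t * (L G x + t * C + h n * D) + (2 * e + t * (\<beta> + h n * D'))"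
        unfolding G_def by simp
      then show ?thesis by (simp add: algebra_simps)
    qed
    moreover have "(\<lambda>n. t * (L G x + t * C) + 2 * e + t * \<beta> + h n * (t * D + t * D')) \<longlonglongrightarrow>
       t * (L G x + t * C) + 2 * e + t * \<beta> + 0 * (t * D + t * D')"
    proof (intro tendsto_intros)
      have "(\<lambda>n. sqrt ((2 * K * t) * (1 / real (Suc n)))) \<longlonglongrightarrow> sqrt ((2 * K * t) * 0)"
        by (intro tendsto_intros LIMSEQ_Suc[OF lim_1_over_n])
      then show "h \<longlonglongrightarrow> 0" by (simp add: h_def[abs_def])
    qed
    ultimately show ?thesis using LIMSEQ_le_const by fastforce
  qed
  have step2: "- \<beta> \<le> L G x + t * C" if "t > 0" for t
  proof -
    have "0 \<le> t * (L G x + t * C) + t * \<beta> + e" if "e > 0" for e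
      using step1[OF \<open>t > 0\<close>, of "e / 2"] that by simp
    then have "0 \<le> t * (L G x + t * C) + t * \<beta>" by (rule field_le_epsilon)
    then have "0 \<le> t * (L G x + t * C + \<beta>)" by (simp add: algebra_simps)
    then show ?thesis using that by (simp add: zero_le_mult_iff)
  qed
  have "- \<beta> \<le> L G x + e" if "e > 0" for e
  proof -
    have "e / (C + 1) * C \<le> e" using CD(1) that by (simp add: field_simps)
    then show ?thesis using step2[of "e / (C + 1)"] CD(1) that by simp
  qed
  then show ?thesis unfolding G_def by (rule field_le_epsilon)
qed

end

section \<open>Decreasing limits of subsolutions\<close>

text \<open>On a small sphere around \<open>z0\<close> the limit \<open>u\<close> is strictly below \<open>q + e \<bar>z - z0\<bar>\<^sup>2\<close>;
  by compactness, so
is some \<open>v j\<close>.  At the centre \<open>v j \<ge> u = q\<close>.  Hence \<open>v j - (q + e \<bar>z - z0\<bar>\<^sup>2)\<close> has an interior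
  maximum on
the ball, where the second derivatives are ordered.\<close>

lemma decreasing_limit_touching:
  fixes q :: "complex ^ 'n \<Rightarrow> real"
  assumes N: "open N" "z0 \<in> N" "Ck_on 2 N q" "u z0 = ereal (q z0)" "\<And>z. z \<in> N \<Longrightarrow> u z \<le> ereal (q z)"
    and v: "\<And>j. Ck_on 2 N (v j)" "\<And>z. z \<in> N \<Longrightarrow> decseq (\<lambda>j. v j z)"
      "\<And>z. z \<in> N \<Longrightarrow> (\<lambda>j. ereal (v j z)) \<longlonglongrightarrow> u z"
    and "e > 0"
  shows "\<exists>z j. dist z z0 < e \<and> z \<in> N \<and> (\<forall>\<xi>. levi (v j) z \<xi> \<le> levi q z \<xi> + e * (\<xi> \<bullet> \<xi>))"
proof -
  obtain r0 where "r0 > 0" "cball z0 r0 \<subseteq> N" using N(1,2) open_contains_cball by blast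
  define r where "r = min r0 (e / 2)"
  have r: "r > 0" "r < e" "cball z0 r \<subseteq> N"
    using \<open>r0 > 0\<close> \<open>cball z0 r0 \<subseteq> N\<close> \<open>e > 0\<close> by (auto simp: r_def)
  define Q where "Q y = e * (y \<bullet> y) + y \<bullet> ((- 2 * e) *\<^sub>R z0) + e * (z0 \<bullet> z0)" for y
  have Q: "Q y = e * (dist z0 y)\<^sup>2" for y
    unfolding dist_norm power2_norm_eq_inner by (simp add: Q_def algebra_simps inner_commute)
  have ckQ: "Ck_on 2 U Q" for U
    unfolding Q_def[abs_def] by (rule smooth_on_imp_Ck_on[OF smooth_on_quadratic])
  define S where "S j = N \<inter> (\<lambda>y. v j y - q y) -` {..< e * r\<^sup>2}" for j
  have cont: "continuous_on N q" "continuous_on N (v j)" for j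
    using N(3) v(1) by (auto intro: Ck_on_imp_continuous_on)
  have "open (S j)" for j
    unfolding S_def by (intro continuous_open_preimage N(1) continuous_on_diff cont) simp
  moreover have "sphere z0 r \<subseteq> (\<Union>j\<in>UNIV. S j)"
  proof
    fix y assume "y \<in> sphere z0 r"
    then have y: "y \<in> N" using r(3) by (auto simp: subset_eq)
    have "u y < ereal (q y + e * r\<^sup>2)"
      using N(5)[OF y] r(1) \<open>e > 0\<close> by (metis ereal_less_eq(3) less_add_same_cancel1 mult_pos_pos
        order_le_less_trans ereal_less(2) less_ereal.simps(1) zero_less_power)
    from order_tendstoD(2)[OF v(3)[OF y] this]
    obtain j where "ereal (v j y) < ereal (q y + e * r\<^sup>2)" by (auto simp: eventually_sequentially)
    then show "y \<in> (\<Union>j\<in>UNIV. S j)" using y by (auto simp: S_def algebra_simps)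
  qed
  ultimately obtain J where J: "finite J" "sphere z0 r \<subseteq> (\<Union>j\<in>J. S j)"
    using compactE_image[OF compact_sphere, of UNIV S z0 r] by metis
  define j where "j = Max (insert 0 J)"
  have sph: "v j y - q y < e * r\<^sup>2" if "dist z0 y = r" for y
  proof -
    have "y \<in> sphere z0 r" using that by simp
    then obtain i where i: "i \<in> J" "y \<in> S i" using J(2) by blast
    then have "i \<le> j" using J(1) by (simp add: j_def)
    moreover have "y \<in> N" "v i y - q y < e * r\<^sup>2" using i by (auto simp: S_def)
    ultimately show ?thesis using v(2)[of y] by (fastforce simp: decseq_def)
  qed
  have at0: "q z0 \<le> v j z0"
    using decseq_ge[of "\<lambda>j. ereal (v j z0)" "u z0" j] v(2,3)[OF N(2)] N(4) by (simp add: decseq_def)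
  have "\<exists>z\<in>cball z0 r. \<forall>y\<in>cball z0 r. v j y - (q y + Q y) \<le> v j z - (q z + Q z)"
    using r by (intro continuous_attains_sup continuous_intros continuous_on_subset[OF cont(1)] 
        continuous_on_subset[OF cont(2)] Ck_on_imp_continuous_on[OF ckQ]) auto
  then obtain z where z: "z \<in> cball z0 r" "\<And>y. y \<in> cball z0 r \<Longrightarrow>
    v j y - (q y + Q y) \<le> v j z - (q z + Q z)" by blast
  have "0 \<le> v j z - (q z + Q z)" using z(2)[of z0] at0 r(1) by (simp add: Q)
  then have "dist z0 z \<noteq> r" using sph[of z] by (auto simp: Q)
  then have zin: "z \<in> ball z0 r" using z(1) by simp
  have sub: "ball z0 r \<subseteq> N" using r(3) by (auto simp: subset_eq)
  have "levi (v j) z \<xi> \<le> levi (\<lambda>y. q y + Q y) z \<xi>" for \<xi>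
  proof (rule levi_mono_local[OF open_ball _ _ zin])
    show "Ck_on 2 (ball z0 r) (v j)" by (rule Ck_on_subset[OF v(1) sub])
    show "Ck_on 2 (ball z0 r) (\<lambda>y. q y + Q y)"
      by (intro Ck_on_add open_ball Ck_on_subset[OF N(3) sub] ckQ)
  qed (use z(2) in auto)
  also have "levi (\<lambda>y. q y + Q y) z \<xi> = levi q z \<xi> + e * (\<xi> \<bullet> \<xi>)" for \<xi>
  proof -
    have "levi Q z \<xi> = e * (\<xi> \<bullet> \<xi>)" unfolding Q_def[abs_def] by (rule levi_quadratic)
    then show ?thesis using levi_add[OF N(1,3) ckQ subsetD[OF sub zin]] by simp
  qed
  finally show ?thesis
    using zin sub r(2) by (intro exI[of _ z] exI[of _ j]) (auto simp: dist_commute)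
qed

context cone_operator
begin

definition hess_ge :: "real \<Rightarrow> (complex ^ 'n \<Rightarrow> real) \<Rightarrow> complex ^ 'n \<Rightarrow> bool"
  where "hess_ge c w z \<longleftrightarrow> (\<forall>V. unitary V \<longrightarrow> levi_diag V w z \<in> superlevel c)"

lemma F_op_hessian_ge_iff:
  assumes "open U" "Ck_on 2 U w" "z \<in> U"
  shows "F_op \<Gamma> f (complex_hessian w z) \<ge> ereal c \<longleftrightarrow> hess_ge c w z"
  using F_op_ge_iff[OF hermitian_complex_hessian[OF assms]]
  by (simp add: hess_ge_def diag_in_hessian[OF assms])

lemma superlevel_limit:
  assumes "\<And>n. y n \<in> superlevel (c n)" "y \<longlonglongrightarrow> l" "c \<longlonglongrightarrow> d"
  shows "l \<in> superlevel d"
proof -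
  have y: "y n \<in> closure \<Gamma>" "c n \<le> f (y n)" for n using assms(1) by (auto simp: superlevel_def)
  have l: "l \<in> closure \<Gamma>" using closed_sequentially[OF closed_closure] y(1) assms(2) by blast
  have "(\<lambda>n. f (y n)) \<longlonglongrightarrow> f l"
    using continuous_on_tendsto_compose[OF continuous_f assms(2) l] y(1) by simp
  then have "d \<le> f l" using assms(3) y(2) by (intro LIMSEQ_le[of c]) auto
  with l show ?thesis by (simp add: superlevel_def)
qed

text \<open>Let \<open>e\<close> tend to \<open>0\<close> in the previous lemma; the touching points converge to \<open>z0\<close>,
  and the inequality
passes to the limit because \<open>closure \<Gamma>\<close> is closed and \<open>f\<close>, \<open>\<psi>\<close> and the second derivatives of \<open>q\<close>
are continuous.\<close>

lemma decreasing_limit_hess_ge: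
  assumes N: "open N" "z0 \<in> N" "Ck_on 2 N q" "u z0 = ereal (q z0)" "\<And>z. z \<in> N \<Longrightarrow> u z \<le> ereal (q z)"
    and v: "\<And>j. Ck_on 2 N (v j)" "\<And>z. z \<in> N \<Longrightarrow> decseq (\<lambda>j. v j z)"
      "\<And>z. z \<in> N \<Longrightarrow> (\<lambda>j. ereal (v j z)) \<longlonglongrightarrow> u z"
    and hess: "\<And>j z. z \<in> N \<Longrightarrow> hess_ge (\<psi> z) (v j) z" and \<psi>: "continuous_on N \<psi>"
  shows "hess_ge (\<psi> z0) q z0"
proof -
  have "\<exists>z. dist z z0 < 1 / real (Suc n) \<and> z \<in> N \<and> (\<exists>j. \<forall>\<xi>. levi (v j) z \<xi> \<le>
    levi q z \<xi> + 1 / real (Suc n) * (\<xi> \<bullet> \<xi>))" for n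
    using decreasing_limit_touching[of N z0 q u v "1 / real (Suc n)"] N v by fastforce
  then obtain z where z: "\<And>n. dist (z n) z0 < 1 / real (Suc n)" "\<And>n. z n \<in> N"
    "\<And>n. \<exists>j. \<forall>\<xi>. levi (v j) (z n) \<xi> \<le> levi q (z n) \<xi> + 1 / real (Suc n) * (\<xi> \<bullet> \<xi>)" by metis
  have lim: "z \<longlonglongrightarrow> z0"
  proof (rule metric_tendsto_imp_tendsto[OF LIMSEQ_Suc[OF lim_1_over_n]])
    show "\<forall>\<^sub>F n in sequentially. dist (z n) z0 \<le> dist (1 / real (Suc n)) 0"
      using z(1) by (auto intro!: always_eventually less_imp_le)
  qed
  show ?thesis
    unfolding hess_ge_def
  proof (intro allI impI)
    fix V :: "complex ^ 'n ^ 'n" assume V: "unitary V"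
    define y where "y n = levi_diag V q (z n) + (1 / real (Suc n)) *\<^sub>R 1" for n
    have "y n \<in> superlevel (\<psi> (z n))" for n
    proof -
      obtain j where j: "\<And>\<xi>. levi (v j) (z n) \<xi> \<le> levi q (z n) \<xi> + 1 / real (Suc n) * (\<xi> \<bullet> \<xi>)"
        using z(3) by blast
      have "levi_diag V (v j) (z n) \<in> superlevel (\<psi> (z n))"
        using hess[OF z(2)] V by (simp add: hess_ge_def)
      then show ?thesis
        by (rule superlevel_mono) (use j[of "cnj_column V _"] cnj_column_unit[OF V] in \<open>simp add:
          y_def levi_diag_def\<close>)
    qed
    moreover have "y \<longlonglongrightarrow> levi_diag V q z0"
    proof (intro vec_tendstoI)
      fix i
      have "(\<lambda>n. levi q (z n) (cnj_column V i) + 1 / real (Suc n)) \<longlonglongrightarrow> levi q z0 (cnj_column V i) + 0"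
        using z(2) N(2)
        by (intro tendsto_add LIMSEQ_Suc[OF lim_1_over_n] continuous_on_tendsto_compose[OF
          continuous_on_levi[OF N(3)] lim]) auto
      then show "(\<lambda>n. y n $ i) \<longlonglongrightarrow> levi_diag V q z0 $ i" by (simp add: y_def levi_diag_def)
    qed
    moreover have "(\<lambda>n. \<psi> (z n)) \<longlonglongrightarrow> \<psi> z0"
      using z(2) N(2) by (intro continuous_on_tendsto_compose[OF \<psi> lim]) auto
    ultimately show "levi_diag V q z0 \<in> superlevel (\<psi> z0)" by (rule superlevel_limit)
  qed
qed

text \<open>Viscosity subsolutions with a constant right-hand side, tested with functions that are
  smooth on
the whole space and touch \<open>w\<close> from above near \<open>x\<close>.\<close>

definition subsol_on :: "(complex ^ 'n) set \<Rightarrow> real \<Rightarrow> (complex ^ 'n \<Rightarrow> real) \<Rightarrow> bool"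
  where "subsol_on S c w \<longleftrightarrow> (\<forall>x\<in>S. \<forall>q. smooth_on UNIV q \<longrightarrow> q x = w x \<longrightarrow>
    (\<exists>s>0. \<forall>y\<in>ball x s. w y \<le> q y) \<longrightarrow> hess_ge c q x)"

end

section \<open>Mollification of continuous subsolutions\<close>

lemma conv_quadratic:
  fixes \<rho> :: "'a::euclidean_space \<Rightarrow> real"
  assumes "mollifier d \<rho>"
  shows "\<exists>c' d'. conv (\<lambda>x. a * (x \<bullet> x) + x \<bullet> c + m) \<rho> = (\<lambda>x. a * (x \<bullet> x) + x \<bullet> c' + d')"
proof -
  have t: "test_fun \<rho>" and one: "integral\<^sup>L lborel \<rho> = 1" using assms by (auto simp: mollifier_def)
  have i1: "integrable lborel (\<lambda>y. g y * \<rho> y)" if "continuous_on UNIV g" for g :: "'a \<Rightarrow> real"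
    using that t by (rule integrable_mult_test_fun)
  define p where "p = (\<Sum>i\<in>Basis. (\<integral>y. (y \<bullet> i) * \<rho> y \<partial>lborel) *\<^sub>R i)"
  have p: "(\<integral>y. (x \<bullet> y) * \<rho> y \<partial>lborel) = x \<bullet> p" for x
  proof -
    have "(\<integral>y. (x \<bullet> y) * \<rho> y \<partial>lborel) = (\<integral>y. (\<Sum>i\<in>Basis. (x \<bullet> i) * ((y \<bullet> i) * \<rho> y)) \<partial>lborel)"
    proof (intro Bochner_Integration.integral_cong refl)
      fix y
      have "(x \<bullet> y) * \<rho> y = (\<Sum>i\<in>Basis. (x \<bullet> i) * (y \<bullet> i)) * \<rho> y"
        by (rule arg_cong[OF euclidean_inner])
      then show "(x \<bullet> y) * \<rho> y = (\<Sum>i\<in>Basis. (x \<bullet> i) * ((y \<bullet> i) * \<rho> y))"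
        by (simp add: sum_distrib_right mult.assoc)
    qed
    also have "\<dots> = (\<Sum>i\<in>Basis. (x \<bullet> i) * (\<integral>y. (y \<bullet> i) * \<rho> y \<partial>lborel))"
      by (subst Bochner_Integration.integral_sum) (auto intro!: integrable_mult_right i1
        continuous_intros)
    also have "\<dots> = x \<bullet> p" by (simp add: p_def inner_sum_right ac_simps)
    finally show ?thesis .
  qed
  define D where "D = (\<integral>y. (a * (y \<bullet> y) - c \<bullet> y + m) * \<rho> y \<partial>lborel)"
  have "conv (\<lambda>x. a * (x \<bullet> x) + x \<bullet> c + m) \<rho> x = a * (x \<bullet> x) + x \<bullet> (c - (2 * a) *\<^sub>R p) + D" for x
  proof -
    have "conv (\<lambda>x. a * (x \<bullet> x) + x \<bullet> c + m) \<rho> x =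
      (\<integral>y. (a * (x \<bullet> x) + x \<bullet> c) * \<rho> y - (2 * a) * ((x \<bullet> y) * \<rho> y) + (a * (y \<bullet> y) - c \<bullet> y + m) * \<rho>
        y \<partial>lborel)"
      unfolding conv_def
      by (intro Bochner_Integration.integral_cong refl) (simp add: algebra_simps inner_commute)
    also have "\<dots> = (\<integral>y. (a * (x \<bullet> x) + x \<bullet> c) * \<rho> y - (2 * a) * ((x \<bullet> y) * \<rho> y) \<partial>lborel) + D"
      unfolding D_def
      by (intro Bochner_Integration.integral_add Bochner_Integration.integrable_diff
        integrable_mult_right i1 continuous_intros integrable_test_fun t)
    also have "(\<integral>y. (a * (x \<bullet> x) + x \<bullet> c) * \<rho> y - (2 * a) * ((x \<bullet> y) * \<rho> y) \<partial>lborel) =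
        (\<integral>y. (a * (x \<bullet> x) + x \<bullet> c) * \<rho> y \<partial>lborel) - (\<integral>y. (2 * a) * ((x \<bullet> y) * \<rho> y) \<partial>lborel)"
      by (intro Bochner_Integration.integral_diff integrable_mult_right i1 continuous_intros
        integrable_test_fun t)
    also have "\<dots> = (a * (x \<bullet> x) + x \<bullet> c) - (2 * a) * (x \<bullet> p)"
      by (simp add: one p)
    finally show ?thesis by (simp add: algebra_simps)
  qed
  then show ?thesis by blast
qed

context cone_operator
begin

text \<open>Localization and linearization.  A steep quadratic \<open>Q\<close> that is below \<open>w\<close> near \<open>p\<close>
  and above it near
the boundary of the ball turns \<open>w\<close> into \<open>g = max (w - Q) 0\<close>, a function of compact support on the
whole space.  Where \<open>g\<close> vanishes, a test function has a nonnegative Hessian and \<open>Q\<close> alone satisfies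
the inequality; so \<open>g\<close> is a global subsolution of the operator shifted by the Hessian of \<open>Q\<close>.  A
half-space containing the superlevel set has a normal \<open>\<alpha> \<ge> 0\<close>, because the set is closed under
  adding
nonnegative vectors; it turns this into \<open>\<Sum>i. \<alpha>\<^sub>i levi (\<xi>\<^sub>i) \<ge> - \<beta>\<close>, a linear inequality with \<open>2 n\<close>
directions, which mollification preserves.  Near \<open>p\<close> the mollifications of \<open>w\<close> and \<open>g\<close> differ by a
quadratic with the same second derivatives as \<open>Q\<close>.\<close>

lemma mollify_subsol:
  assumes w: "continuous_on UNIV w" and sub: "subsol_on (ball p R) c w" and "R > 0"
    and A: "(\<chi> i. A) \<in> superlevel c" "A > 0"
    and \<rho>: "mollifier d \<rho>" "d \<le> R / 8"
  shows "hess_ge c (conv w \<rho>) p"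
proof -
  have t\<rho>: "test_fun \<rho>" using \<rho> by (simp add: mollifier_def)
  have "compact (w ` cball p R)"
    by (intro compact_continuous_image continuous_on_subset[OF w]) auto
  then obtain M0 where M0: "\<And>x. x \<in> cball p R \<Longrightarrow> \<bar>w x\<bar> \<le> M0"
    by (metis bounded_iff compact_imp_bounded image_eqI real_norm_def)
  define M where "M = max M0 0"
  have M: "M \<ge> 0" "\<And>x. x \<in> cball p R \<Longrightarrow> \<bar>w x\<bar> \<le> M"
    using M0 unfolding M_def by (auto intro: order_trans[OF _ max.cobounded1])
  \<comment> \<open>chosen such that \<open>Q = a |x - p|\<^sup>2 - m\<close> is at most \<open>- M\<close>
    for \<open>|x - p| \<le> R / 4\<close> and at least \<open>M\<close> for \<open>|x - p| \<ge> R / 2\<close>\<close>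
  define a where "a = 16 * M / R\<^sup>2 + A"
  define m where "m = 2 * M + A * R\<^sup>2 / 16"
  have aA: "A \<le> a" using M(1) by (simp add: a_def)
  have aR: "a * R\<^sup>2 = 16 * M + A * R\<^sup>2" using \<open>R > 0\<close> by (simp add: a_def field_simps)
  define Q where "Q x = a * (x \<bullet> x) + x \<bullet> ((- 2 * a) *\<^sub>R p) + (a * (p \<bullet> p) - m)" for x
  have Q: "Q x = a * (dist p x)\<^sup>2 - m" for x
    unfolding dist_norm power2_norm_eq_inner by (simp add: Q_def algebra_simps inner_commute)
  have Qs: "smooth_on UNIV Q" unfolding Q_def[abs_def] by (rule smooth_on_quadratic)
  have Qc: "continuous_on S Q" for S
    by (rule continuous_on_subset[OF smooth_on_imp_continuous_on[OF Qs]]) simp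
  have Ql: "levi Q x \<xi> = a * (\<xi> \<bullet> \<xi>)" for x \<xi> unfolding Q_def[abs_def] by (rule levi_quadratic)
  have a0: "a > 0" using A(2) aA by simp
  have inner: "Q x \<le> w x" if "dist p x \<le> R / 4" for x
  proof -
    have "a * (dist p x)\<^sup>2 \<le> a * (R / 4)\<^sup>2"
      using that a0 by (intro mult_left_mono power_mono) auto
    also have "\<dots> = M + A * R\<^sup>2 / 16" using aR by (simp add: power_divide)
    finally have "Q x \<le> - M" unfolding Q m_def by simp
    then show ?thesis using M(2)[of x] that \<open>R > 0\<close> by (auto simp: abs_le_iff)
  qed
  have outer: "w x \<le> Q x" if "R / 2 \<le> dist p x" "dist p x \<le> R" for x
  proof -
    have "4 * M + A * R\<^sup>2 / 4 = a * (R / 2)\<^sup>2" using aR by (simp add: power_divide)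
    also have "\<dots> \<le> a * (dist p x)\<^sup>2"
      using that a0 \<open>R > 0\<close> by (intro mult_left_mono power_mono) auto
    finally have "4 * M + A * R\<^sup>2 / 4 \<le> a * (dist p x)\<^sup>2" .
    moreover have "0 \<le> A * R\<^sup>2" using A(2) by simp
    ultimately have "M \<le> Q x" unfolding Q m_def using M(1) by linarith
    then show ?thesis using M(2)[of x] that by (auto simp: abs_le_iff)
  qed
  define g where "g x = (if x \<in> cball p (R / 2) then max (w x - Q x) 0 else 0)" for x
  have gc: "continuous_on UNIV g"
  proof -
    have "continuous_on (cball p (R / 2) \<union> {x. R / 2 \<le> dist p x}) g"
      unfolding g_def[abs_def]
    proof (rule continuous_on_cases)
      show "closed {x. R / 2 \<le> dist p x}" by (intro closed_Collect_le continuous_intros)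
      show "continuous_on (cball p (R / 2)) (\<lambda>x. max (w x - Q x) 0)"
        by (intro continuous_intros continuous_on_subset[OF w] Qc) auto
    qed (use outer \<open>R > 0\<close> in auto)
    moreover have "cball p (R / 2) \<union> {x. R / 2 \<le> dist p x} = UNIV" by auto
    ultimately show ?thesis by simp
  qed
  have g0: "0 \<le> g x" for x by (simp add: g_def)
  have gz: "g x = 0" if "norm x > norm p + R / 2" for x
    using that norm_triangle_sub[of x p] by (auto simp: g_def dist_norm norm_minus_commute)
  have ge: "w x \<le> g x + Q x" if "dist p x \<le> R" for x
    using outer[of x] that by (auto simp: g_def)
  have visc: "levi_diag V q x + a *\<^sub>R 1 \<in> superlevel c"
    if q: "test_fun q" and max: "\<And>y. g y - q y \<le> g x - q x" and V: "unitary V" for V q x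
  proof -
    have qs: "smooth_on UNIV q" using q by (simp add: test_fun_def)
    show ?thesis
    proof (cases "g x > 0")
      case True
      then have x: "dist p x \<le> R / 2" "g x = w x - Q x" by (auto simp: g_def split: if_splits)
      define h where "h y = q y + Q y + (g x - q x)" for y
      have hs: "smooth_on UNIV h"
        unfolding h_def[abs_def] by (intro smooth_on_add qs Qs smooth_on_const) auto
      have "\<forall>y\<in>ball x (R / 2). w y \<le> h y"
      proof
        fix y assume "y \<in> ball x (R / 2)"
        then have "dist p y \<le> R" using x(1) dist_triangle[of p y x] by simp
        from ge[OF this] show "w y \<le> h y" using max[of y] by (simp add: h_def)
      qed
      moreover have "h x = w x" using x(2) by (simp add: h_def)
      moreover have "x \<in> ball p R" using x(1) \<open>R > 0\<close> by simp
      ultimately have "hess_ge c h x"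
        using sub hs \<open>R > 0\<close> unfolding subsol_on_def by (metis half_gt_zero)
      then have "levi_diag V h x \<in> superlevel c" using V by (simp add: hess_ge_def)
      moreover have "levi h x \<xi> = levi q x \<xi> + a * (\<xi> \<bullet> \<xi>)" for \<xi>
      proof -
        have "levi h x \<xi> = levi (\<lambda>y. q y + Q y) x \<xi> + levi (\<lambda>_. g x - q x) x \<xi>"
          unfolding h_def[abs_def] by (intro levi_add_smooth smooth_on_add qs Qs smooth_on_const)
            auto
        moreover have "levi (\<lambda>_. g x - q x) x \<xi> = 0"
          using levi_quadratic[of 0 0 "g x - q x" x \<xi>] by simp
        ultimately show ?thesis by (simp add: levi_add_smooth[OF qs Qs] Ql)
      qed
      ultimately show ?thesis
        by (elim superlevel_mono) (simp add: levi_diag_def cnj_column_unit[OF V])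
    next
      case False
      then have gx: "g x = 0" using g0[of x] by simp
      have "0 \<le> levi q x \<xi>" for \<xi>
      proof -
        have "levi (\<lambda>_. 0) x \<xi> \<le> levi q x \<xi>"
        proof (rule levi_mono_local[of UNIV])
          show "0 - q y \<le> 0 - q x" for y using max[of y] g0[of y] gx by simp
        qed (auto intro: smooth_on_imp_Ck_on qs Ck_on_const)
        then show ?thesis using levi_quadratic[of 0 0 0 x \<xi>] by simp
      qed
      then show ?thesis
        by (intro superlevel_mono[OF A(1)]) (simp add: levi_diag_def add_increasing aA)
    qed
  qed
  define G where "G = conv g \<rho>"
  have G: "test_fun G" unfolding G_def by (rule test_fun_conv[OF gc gz t\<rho>])
  have key: "levi_diag V G p + a *\<^sub>R 1 \<in> superlevel c" if V: "unitary V" for V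
  proof (rule ccontr)
    assume "levi_diag V G p + a *\<^sub>R 1 \<notin> superlevel c"
    from separating_hyperplane_closed_point[OF convex_superlevel closed_superlevel this]
    obtain \<alpha> \<beta>0 where sep: "\<alpha> \<bullet> (levi_diag V G p + a *\<^sub>R 1) < \<beta>0" "\<And>y. y \<in> superlevel c \<Longrightarrow>
      \<beta>0 < \<alpha> \<bullet> y" by blast
    have \<alpha>0: "0 \<le> \<alpha> $ i" for i
    proof (rule ccontr)
      assume "\<not> 0 \<le> \<alpha> $ i"
      then have neg: "\<alpha> $ i < 0" by simp
      \<comment> \<open>moving this far along the axis \<open>i\<close> would leave the half-space\<close>
      define t where "t = (\<bar>\<alpha> \<bullet> (\<chi> i. A)\<bar> + \<bar>\<beta>0\<bar> + 1) / (- (\<alpha> $ i))"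
      have t0: "t \<ge> 0" unfolding t_def by (rule divide_nonneg_pos) (use neg in auto)
      have "(\<chi> i. A) + t *\<^sub>R axis i 1 \<in> superlevel c"
        by (rule superlevel_mono[OF A(1)]) (use t0 in \<open>simp add: axis_def\<close>)
      from sep(2)[OF this] have "\<beta>0 < \<alpha> \<bullet> (\<chi> i. A) + t * \<alpha> $ i"
        by (simp add: inner_add_right inner_axis)
      also have "t * \<alpha> $ i = - (\<bar>\<alpha> \<bullet> (\<chi> i. A)\<bar> + \<bar>\<beta>0\<bar> + 1)" using neg by (simp add: t_def)
      finally show False by linarith
    qed
    define s where "s = (\<Sum>i\<in>UNIV. \<alpha> $ i)"
    have inner_1: "\<alpha> \<bullet> (r *\<^sub>R 1) = r * s" for r
      by (simp add: inner_vec_def s_def sum_distrib_left mult.commute)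
    have s0: "s \<ge> 0" unfolding s_def by (intro sum_nonneg \<alpha>0)
    \<comment> \<open>the factor \<open>sqrt \<alpha>\<^sub>i / 2\<close> because second derivatives scale quadratically
      and \<open>levi\<close> carries \<open>1 / 4\<close>\<close>
    define b where "b = (\<lambda>(i, \<epsilon>). (sqrt (\<alpha> $ i) / 2) *\<^sub>R (if \<epsilon> then \<i> *s cnj_column V i else
      cnj_column V i))"
    interpret steps "UNIV :: ('n \<times> bool) set" b by standard auto
    have L: "diffusion UNIV b q x = \<alpha> \<bullet> levi_diag V q x" if q: "test_fun q" for q x
    proof -
      have sc: "dir_deriv (r *\<^sub>R v) (dir_deriv (r *\<^sub>R v) q) x =
        r\<^sup>2 * dir_deriv v (dir_deriv v q) x" for r v
      proof -
        note lin = linear_dir_deriv2[OF open_UNIV test_fun_Ck_on[OF q] UNIV_I]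
        show ?thesis
          by (simp add: linear_scale[OF lin(1)] linear_scale[OF lin(2)] power2_eq_square)
      qed
      have "diffusion UNIV b q x = (\<Sum>i\<in>UNIV. \<Sum>\<epsilon>\<in>UNIV. dir_deriv (b (i, \<epsilon>)) (dir_deriv (b (i, \<epsilon>))
        q) x)"
        unfolding diffusion_def by (simp add: sum.cartesian_product split_def)
      also have "\<dots> = (\<Sum>i\<in>UNIV. \<alpha> $ i * levi q x (cnj_column V i))"
        by (intro sum.cong refl)
           (simp add: UNIV_bool b_def sc levi_def power_divide \<alpha>0 algebra_simps add_divide_distrib)
      finally show ?thesis by (simp add: inner_vec_def levi_diag_def)
    qed
    have "- (a * s - \<beta>0) \<le> diffusion UNIV b (conv g \<rho>) p"
    proof (rule diffusion_conv_lower[OF gc gz g0 _ _ \<rho>(1)])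
      fix q x assume q: "test_fun q" "\<And>y. g y - q y \<le> g x - q x"
      from sep(2)[OF visc[OF q V]] show "- (a * s - \<beta>0) \<le> diffusion UNIV b q x"
        unfolding L[OF q(1)] inner_add_right inner_1 by simp
    next
      have "\<beta>0 < \<alpha> \<bullet> (\<chi> i. A)" by (rule sep(2)[OF A(1)])
      also have "\<dots> = A * s" using inner_1[of A] by (simp add: inner_vec_def)
      also have "\<dots> \<le> a * s" using aA s0 by (rule mult_right_mono)
      finally show "0 \<le> a * s - \<beta>0" by simp
    qed
    then show False
      using sep(1) unfolding G_def[symmetric] L[OF G] inner_add_right inner_1 by simp
  qed
  have decomp: "conv w \<rho> x = conv g \<rho> x + conv Q \<rho> x" if "x \<in> ball p (R / 8)" for x
  proof -
    have "conv w \<rho> x = conv (\<lambda>y. g y + Q y) \<rho> x"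
    proof (rule conv_cong[OF \<rho>(1)])
      fix y assume "dist x y \<le> d"
      then have "dist p y \<le> R / 4" using that \<rho>(2) dist_triangle[of p y x] by simp
      then show "w y = g y + Q y" using inner[of y] \<open>R > 0\<close> by (simp add: g_def)
    qed
    also have "\<dots> = conv g \<rho> x + conv Q \<rho> x" by (rule conv_add[OF gc Qc t\<rho>])
    finally show ?thesis .
  qed
  obtain c' d' where cQ: "conv Q \<rho> = (\<lambda>x. a * (x \<bullet> x) + x \<bullet> c' + d')"
    using conv_quadratic[OF \<rho>(1)] unfolding Q_def[abs_def] by blast
  have cQs: "smooth_on UNIV (conv Q \<rho>)" unfolding cQ by (rule smooth_on_quadratic)
  have "levi (conv w \<rho>) p \<xi> = levi G p \<xi> + a * (\<xi> \<bullet> \<xi>)" for \<xi>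
  proof -
    have "levi (conv w \<rho>) p \<xi> = levi (\<lambda>x. G x + conv Q \<rho> x) p \<xi>"
      by (rule levi_cong[of "ball p (R / 8)"]) (use decomp \<open>R > 0\<close> in \<open>auto simp: G_def\<close>)
    also have "\<dots> = levi G p \<xi> + levi (conv Q \<rho>) p \<xi>"
      using G cQs by (intro levi_add_smooth) (auto simp: test_fun_def)
    finally show ?thesis unfolding cQ levi_quadratic .
  qed
  then have "levi_diag V (conv w \<rho>) p = levi_diag V G p + a *\<^sub>R 1" if "unitary V" for V
    using cnj_column_unit[OF that] by (simp add: vec_eq_iff levi_diag_def)
  then show ?thesis using key by (simp add: hess_ge_def)
qed

end

section \<open>Lipschitz envelopes\<close>

definition usc_on :: "'a::metric_space set \<Rightarrow> ('a \<Rightarrow> real) \<Rightarrow> bool"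
  where "usc_on K h \<longleftrightarrow> (\<forall>z\<in>K. \<forall>a>h z. \<exists>s>0. \<forall>y\<in>K. dist z y < s \<longrightarrow> h y < a)"

text \<open>If no maximum existed, the open sets where \<open>h\<close> is smaller than one of its values would cover
  \<open>K\<close>;
the largest of finitely many such values would be smaller than itself.\<close>

lemma usc_on_attains_max:
  assumes "compact K" "K \<noteq> {}" "usc_on K h"
  shows "\<exists>z\<in>K. \<forall>y\<in>K. h y \<le> h z"
proof (rule ccontr)
  assume neg: "\<not> ?thesis"
  have "\<forall>z\<in>K. \<exists>s>0. \<exists>y\<in>K. \<forall>x\<in>K. dist z x < s \<longrightarrow> h x < h y"
    using neg assms(3) unfolding usc_on_def by (meson not_le)
  then obtain s y where sy: "\<And>z. z \<in> K \<Longrightarrow> s z > 0" "\<And>z. z \<in> K \<Longrightarrow> y z \<in> K"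
    "\<And>z x. z \<in> K \<Longrightarrow> x \<in> K \<Longrightarrow> dist z x < s z \<Longrightarrow> h x < h (y z)" by metis
  have "K \<subseteq> (\<Union>z\<in>K. ball z (s z))" using sy(1) by auto
  then obtain J where J: "J \<subseteq> K" "finite J" "K \<subseteq> (\<Union>z\<in>J. ball z (s z))"
    using compactE_image[OF assms(1), of K "\<lambda>z. ball z (s z)"] by (metis open_ball)
  have "J \<noteq> {}" using J assms(2) by auto
  then have "Max ((\<lambda>z. h (y z)) ` J) \<in> (\<lambda>z. h (y z)) ` J" using J by (intro Max_in) auto
  then obtain z where z_Max: "z \<in> J" "Max ((\<lambda>z. h (y z)) ` J) = h (y z)" by blast
  have z: "z \<in> J" "h (y x) \<le> h (y z)" if "x \<in> J" for x
    unfolding z_Max(2)[symmetric] using J(2) that z_Max(1) by auto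
  have "y z \<in> K" using z_Max(1) J sy by auto
  then obtain x where x: "x \<in> J" "dist x (y z) < s x" using J(3) by auto
  then have "h (y z) < h (y x)" using sy(3)[of x "y z"] J(1) \<open>y z \<in> K\<close> by auto
  then show False using z(2)[OF x(1)] by simp
qed

text \<open>The Pasch-Hausdorff envelope: the least \<open>k\<close>-Lipschitz function that is above \<open>h\<close> on \<open>K\<close>.\<close>

definition envelope :: "'a::metric_space set \<Rightarrow> ('a \<Rightarrow> real) \<Rightarrow> real \<Rightarrow> 'a \<Rightarrow> real"
  where "envelope K h k x = (SUP y\<in>K. h y - k * dist x y)"

lemma envelope_attained:
  assumes "compact K" "K \<noteq> {}" "usc_on K h"
  shows "\<exists>y\<in>K. envelope K h k x = h y - k * dist x y" "\<And>y. y \<in> K \<Longrightarrow>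
    h y - k * dist x y \<le> envelope K h k x"
proof -
  have "usc_on K (\<lambda>y. h y - k * dist x y)"
    unfolding usc_on_def
  proof (intro ballI allI impI)
    fix z a assume z: "z \<in> K" "h z - k * dist x z < a"
    define e where "e = (a - (h z - k * dist x z)) / 2"
    have e: "e > 0" using z by (simp add: e_def)
    obtain s where s: "s > 0" "\<And>y. y \<in> K \<Longrightarrow> dist z y < s \<Longrightarrow> h y < h z + e"
      using assms(3) z(1) e unfolding usc_on_def by (metis less_add_same_cancel1)
    have "isCont (\<lambda>y. k * dist x y) z" by (intro continuous_intros)
    then obtain s' where s': "s' > 0" "\<And>y. dist y z < s' \<Longrightarrow> dist (k * dist x y) (k * dist x z) < e"
      using e unfolding continuous_at_eps_delta by blast
    show "\<exists>s>0. \<forall>y\<in>K. dist z y < s \<longrightarrow> h y - k * dist x y < a"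
    proof (intro exI[of _ "min s s'"] conjI ballI impI)
      fix y assume y: "y \<in> K" "dist z y < min s s'"
      then have "h y < h z + e" "\<bar>k * dist x y - k * dist x z\<bar> < e"
        using s(2)[of y] s'(2)[of y] by (auto simp: dist_commute dist_real_def)
      then have "h y - k * dist x y < (h z - k * dist x z) + 2 * e" by linarith
      then show "h y - k * dist x y < a" unfolding e_def by (simp add: field_simps)
    qed (use s s' in auto)
  qed
  from usc_on_attains_max[OF assms(1,2) this]
  obtain z where z: "z \<in> K" "\<And>y. y \<in> K \<Longrightarrow> h y - k * dist x y \<le> h z - k * dist x z" by blast
  have eq: "envelope K h k x = h z - k * dist x z"
    unfolding envelope_def by (rule cSup_eq_maximum) (use z in auto)
  show "\<exists>y\<in>K. envelope K h k x = h y - k * dist x y" using eq z(1) by blast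
  show "\<And>y. y \<in> K \<Longrightarrow> h y - k * dist x y \<le> envelope K h k x" using eq z(2) by simp
qed

lemma envelope_lipschitz:
  assumes "compact K" "K \<noteq> {}" "usc_on K h" "k \<ge> 0"
  shows "\<bar>envelope K h k x - envelope K h k x'\<bar> \<le> k * dist x x'"
proof -
  have "envelope K h k x \<le> envelope K h k x' + k * dist x x'" for x x'
  proof -
    obtain y where y: "y \<in> K" "envelope K h k x = h y - k * dist x y"
      using envelope_attained(1)[OF assms(1-3)] by blast
    have "k * dist x' y \<le> k * (dist x x' + dist x y)"
      using assms(4) dist_triangle[of x' y x] by (intro mult_left_mono) (auto simp: dist_commute)
    then show ?thesis using envelope_attained(2)[OF assms(1-3) y(1), of k x'] y(2)
      by (simp add: algebra_simps)
  qed
  from this[of x x'] this[of x' x] show ?thesis by (simp add: abs_le_iff dist_commute)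
qed

lemma continuous_on_envelope:
  assumes "compact K" "K \<noteq> {}" "usc_on K h" "k \<ge> 0"
  shows "continuous_on UNIV (envelope K h k)"
proof -
  have "k-lipschitz_on UNIV (envelope K h k)"
    by (rule lipschitz_onI) (use envelope_lipschitz[OF assms] assms(4) in \<open>auto simp:
      dist_real_def\<close>)
  then show ?thesis by (rule lipschitz_on_continuous_on)
qed

lemma envelope_mono:
  assumes K: "compact K" "K \<noteq> {}" "usc_on K h" "usc_on K h'" "\<And>y. y \<in> K \<Longrightarrow> h y \<le> h' y" "k' \<le> k"
  shows "envelope K h k x \<le> envelope K h' k' x"
proof -
  obtain y where y: "y \<in> K" "envelope K h k x = h y - k * dist x y"
    using envelope_attained(1)[OF K(1-3)] by blast
  have "h y - k * dist x y \<le> h' y - k' * dist x y"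
    using K(5)[OF y(1)] K(6) by (intro diff_mono mult_right_mono) auto
  then show ?thesis using envelope_attained(2)[OF K(1,2,4) y(1), of k' x] y(2) by simp
qed

context cone_operator
begin

lemma viscosity_of_decreasing_limit:
  assumes "open \<Omega>" "continuous_on \<Omega> \<psi>" "u \<in> USC \<Omega>"
    and approx: "\<And>U. open U \<Longrightarrow> compact (closure U) \<Longrightarrow> closure U \<subseteq> \<Omega> \<Longrightarrow>
      \<exists>v :: nat \<Rightarrow> complex ^ 'n \<Rightarrow> real.
        (\<forall>j. Gamma_subharmonic_on \<Gamma> U (v j)) \<and>
        (\<forall>z\<in>U. decseq (\<lambda>j. v j z)) \<and>
        (\<forall>z\<in>U. (\<lambda>j. ereal (v j z)) \<longlonglongrightarrow> u z) \<and>
        (\<forall>j. \<forall>z\<in>U. F_op \<Gamma> f (complex_hessian (v j) z) \<ge> ereal (\<psi> z))"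
  shows "viscosity_subsolution (F_op \<Gamma> f) \<psi> \<Omega> u"
  unfolding viscosity_subsolution_def
proof (intro conjI ballI allI impI assms(3))
  fix z0 q assume z0: "z0 \<in> \<Omega>" and "upper_test_function \<Omega> u z0 q"
  then obtain N where N: "open N" "z0 \<in> N" "N \<subseteq> \<Omega>" "Ck_on 2 N q"
    "u z0 = ereal (q z0)" "\<And>z. z \<in> N \<Longrightarrow> u z \<le> ereal (q z)"
    unfolding upper_test_function_def by blast
  obtain r where r: "r > 0" "cball z0 r \<subseteq> N" using N(1,2) open_contains_cball by blast
  define B where "B = ball z0 r"
  have B: "open B" "z0 \<in> B" "B \<subseteq> N" "compact (closure B)" "closure B \<subseteq> \<Omega>"
    using r N(3) by (auto simp: B_def)
  obtain v :: "nat \<Rightarrow> complex ^ 'n \<Rightarrow> real" where v: "\<And>j. Gamma_subharmonic_on \<Gamma> B (v j)"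
    "\<And>z. z \<in> B \<Longrightarrow> decseq (\<lambda>j. v j z)" "\<And>z. z \<in> B \<Longrightarrow> (\<lambda>j. ereal (v j z)) \<longlonglongrightarrow> u z"
    "\<And>j z. z \<in> B \<Longrightarrow> F_op \<Gamma> f (complex_hessian (v j) z) \<ge> ereal (\<psi> z)"
    using approx[OF B(1,4,5)] by blast
  have ck: "Ck_on 2 B (v j)" for j
    using v(1) by (simp add: Gamma_subharmonic_on_def smooth_on_imp_Ck_on)
  have ckq: "Ck_on 2 B q" by (rule Ck_on_subset[OF N(4) B(3)])
  have "hess_ge (\<psi> z0) q z0"
  proof (rule decreasing_limit_hess_ge[OF B(1,2) ckq N(5) _ ck v(2,3)])
    show "hess_ge (\<psi> z) (v j) z" if "z \<in> B" for j z
      using F_op_hessian_ge_iff[OF B(1) ck that] v(4)[OF that] by blast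
    show "continuous_on B \<psi>" using assms(2) B(3) N(3) continuous_on_subset by blast
  qed (use N(6) B(3) in auto)
  then show "ereal (\<psi> z0) \<le> F_op \<Gamma> f (complex_hessian q z0)"
    using F_op_hessian_ge_iff[OF B(1) ckq B(2)] by blast
qed

text \<open>If \<open>q\<close> touches the envelope from above at \<open>x\<close> and the supremum is attained at \<open>y0\<close>, then the
translate of \<open>q\<close> by \<open>x - y0\<close>, raised by \<open>k \<bar>x - y0\<bar>\<close>, touches \<open>h\<close> from above at \<open>y0\<close>
  and has there the
second derivatives of \<open>q\<close> at \<open>x\<close>.  At \<open>y0\<close> the maximum \<open>h\<close> equals \<open>u\<close> or the quadratic; the first
  case
is the viscosity inequality for \<open>u\<close>, and in the second the Hessian dominates \<open>A\<close> times the
  identity.\<close>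

lemma envelope_subsol:
  assumes visc: "viscosity_subsolution (F_op \<Gamma> f) \<psi> \<Omega> u"
    and K: "compact K" "K \<noteq> {}" "K \<subseteq> \<Omega>" "usc_on K h"
    and h: "\<And>y. y \<in> K \<Longrightarrow> ereal (h y) = max (u y) (ereal (A * (y \<bullet> y) - m))"
    and A: "(\<chi> i. A) \<in> superlevel c"
    and near: "\<And>x y. x \<in> S \<Longrightarrow> y \<in> K \<Longrightarrow> envelope K h k x = h y - k * dist x y \<Longrightarrow>
      y \<in> interior K \<and> c \<le> \<psi> y"
  shows "subsol_on S c (envelope K h k)"
  unfolding subsol_on_def
proof (intro ballI allI impI)
  fix x q assume x: "x \<in> S" and q: "smooth_on UNIV q" "q x = envelope K h k x"
    and "\<exists>s>0. \<forall>y\<in>ball x s. envelope K h k y \<le> q y"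
  then obtain s where s: "s > 0" "\<And>y. y \<in> ball x s \<Longrightarrow> envelope K h k y \<le> q y" by blast
  obtain y0 where y0: "y0 \<in> K" "envelope K h k x = h y0 - k * dist x y0"
    using envelope_attained(1)[OF K(1,2,4)] by blast
  then have int: "y0 \<in> interior K" "c \<le> \<psi> y0" using near[OF x] by auto
  then obtain s2 where s2: "s2 > 0" "ball y0 s2 \<subseteq> K" using mem_interior by metis
  define N where "N = ball y0 (min s s2)"
  have N: "open N" "y0 \<in> N" "N \<subseteq> K" using s s2 by (auto simp: N_def)
  define q' where "q' y = q (y + (x - y0)) + k * dist x y0" for y
  have qt: "smooth_on UNIV (\<lambda>y. q (y + (x - y0)))" by (rule smooth_on_translate[OF q(1)])
  have q's: "smooth_on UNIV q'"
    unfolding q'_def[abs_def] by (rule smooth_on_add[OF open_UNIV qt smooth_on_const])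
  have q'0: "q' y0 = h y0" using q(2) y0(2) by (simp add: q'_def)
  have hq': "h y \<le> q' y" if "y \<in> N" for y
  proof -
    have "h y - k * dist (y + (x - y0)) y \<le> envelope K h k (y + (x - y0))"
      by (rule envelope_attained(2)[OF K(1,2,4)]) (use N(3) that in auto)
    also have "\<dots> \<le> q (y + (x - y0))"
      using that by (intro s) (simp add: N_def dist_norm algebra_simps)
    finally show ?thesis by (simp add: q'_def dist_norm)
  qed
  have "levi q' y0 \<xi> = levi q x \<xi>" for \<xi>
  proof -
    have "levi q' y0 \<xi> = levi (\<lambda>y. q (y + (x - y0))) y0 \<xi> + levi (\<lambda>_. k * dist x y0) y0 \<xi>"
      unfolding q'_def[abs_def] by (rule levi_add_smooth[OF qt smooth_on_const])
    then show ?thesis by (simp add: levi_const levi_translate[OF q(1)])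
  qed
  then have eq: "levi_diag V q x = levi_diag V q' y0" for V by (simp add: levi_diag_def)
  have ck: "Ck_on 2 N q'" using q's by (meson smooth_on_imp_Ck_on smooth_on_subset subset_UNIV)
  show "hess_ge c q x"
  proof (cases "u y0 = ereal (h y0)")
    case True
    have uq': "u z \<le> ereal (q' z)" if "z \<in> N" for z
    proof -
      have "u z \<le> ereal (h z)" using h[of z] N(3) that by auto
      also have "\<dots> \<le> ereal (q' z)" using hq'[OF that] by simp
      finally show ?thesis .
    qed
    have touch: "u y0 = ereal (q' y0)" using True q'0 by simp
    have test: "upper_test_function \<Omega> u y0 q'"
      unfolding upper_test_function_def
      using N(1,2) order_trans[OF N(3) K(3)] ck touch uq' by blast
    have "y0 \<in> \<Omega>" using K(3) y0(1) by blast
    then have "F_op \<Gamma> f (complex_hessian q' y0) \<ge> ereal (\<psi> y0)"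
      using visc test unfolding viscosity_subsolution_def by (elim conjE) simp
    then have "hess_ge (\<psi> y0) q' y0" using F_op_hessian_ge_iff[OF N(1) ck N(2)] by blast
    then show ?thesis using superlevel_antimono[OF int(2)] unfolding hess_ge_def eq by blast
  next
    case False
    then have *: "h y0 = A * (y0 \<bullet> y0) - m"
      using h[OF y0(1)] by (simp add: max_def split: if_splits)
    have "levi (\<lambda>y. A * (y \<bullet> y) + y \<bullet> 0 + (- m)) y0 \<xi> \<le> levi q' y0 \<xi>" for \<xi>
    proof (rule levi_mono_local[OF N(1) _ ck N(2)])
      show "Ck_on 2 N (\<lambda>y. A * (y \<bullet> y) + y \<bullet> 0 + (- m))" by (rule smooth_on_imp_Ck_on[OF
        smooth_on_quadratic])
      fix y assume y: "y \<in> N"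
      have "ereal (A * (y \<bullet> y) - m) \<le> ereal (h y)" unfolding h[OF subsetD[OF N(3) y]]
        by (rule max.cobounded2)
      then show "A * (y \<bullet> y) + y \<bullet> 0 + (- m) - q' y \<le> A * (y0 \<bullet> y0) + y0 \<bullet> 0 + (- m) - q' y0"
        using hq'[OF y] q'0 * by simp
    qed
    then have le: "A * (\<xi> \<bullet> \<xi>) \<le> levi q' y0 \<xi>" for \<xi> unfolding levi_quadratic .
    show ?thesis
      unfolding hess_ge_def eq
    proof (intro allI impI)
      fix V :: "complex ^ 'n ^ 'n" assume "unitary V"
      then show "levi_diag V q' y0 \<in> superlevel c"
        using le[of "cnj_column V _"] by (intro superlevel_mono[OF A]) (simp add: levi_diag_def
          cnj_column_unit)
    qed
  qed
qed

text \<open>The function \<open>u\<close> may be \<open>-\<infinity>\<close>; the maximum with a quadratic is real valued.\<close>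

lemma USC_truncation:
  assumes "u \<in> USC \<Omega>" "K \<subseteq> \<Omega>"
  obtains h where "usc_on K h" "\<And>y. y \<in> K \<Longrightarrow> ereal (h y) = max (u y) (ereal (A * (y \<bullet> y) - m))"
proof -
  define h where "h y = real_of_ereal (max (u y) (ereal (A * (y \<bullet> y) - m)))" for y
  have h: "ereal (h y) = max (u y) (ereal (A * (y \<bullet> y) - m))" if "y \<in> K" for y
  proof -
    have "u y \<noteq> \<infinity>" using assms that by (auto simp: USC_def)
    then show ?thesis unfolding h_def by (cases "u y") (auto simp: max_def)
  qed
  have "usc_on K h"
    unfolding usc_on_def
  proof (intro ballI allI impI)
    fix z a assume z: "z \<in> K" "h z < a"
    then have za: "u z < ereal a" "A * (z \<bullet> z) - m < a"
      using h[OF z(1)] by (metis ereal_less_eq(3) leD max.strict_boundedE less_ereal.simps(1))+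
    have "openin (top_of_set \<Omega>) {z\<in>\<Omega>. u z < ereal a}" using assms(1) by (simp add: USC_def)
    then obtain s1 where s1: "s1 > 0" "\<And>y. y \<in> \<Omega> \<Longrightarrow> dist y z < s1 \<Longrightarrow> u y < ereal a"
      using z(1) za(1) assms(2) unfolding openin_euclidean_subtopology_iff by blast
    have "isCont (\<lambda>y. A * (y \<bullet> y) - m) z" by (intro continuous_intros)
    then obtain s2 where s2: "s2 > 0" "\<And>y. dist y z < s2 \<Longrightarrow> dist (A * (y \<bullet> y) - m) (A * (z \<bullet> z) -
      m) < a - (A * (z \<bullet> z) - m)"
      using za(2) unfolding continuous_at_eps_delta by (meson diff_gt_0_iff_gt)
    show "\<exists>s>0. \<forall>y\<in>K. dist z y < s \<longrightarrow> h y < a"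
    proof (intro exI[of _ "min s1 s2"] conjI ballI impI)
      fix y assume y: "y \<in> K" "dist z y < min s1 s2"
      then have "u y < ereal a" using s1(2)[of y] assms(2) by (auto simp: dist_commute)
      moreover have "A * (y \<bullet> y) - m < a" using s2(2)[of y] y(2)
        by (auto simp: dist_commute dist_real_def)
      ultimately have "ereal (h y) < ereal a" unfolding h[OF y(1)] by simp
      then show "h y < a" by simp
    qed (use s1 s2 in auto)
  qed
  with h show thesis using that by blast
qed

end

section \<open>Smooth approximation\<close>

lemma lipschitz_conv_near:
  assumes "continuous_on UNIV w" "\<And>x y. \<bar>w x - w y\<bar> \<le> k * dist x y" "k \<ge> 0" "mollifier d \<rho>" "k * d
    \<le> e"
  shows "\<bar>conv w \<rho> x - w x\<bar> \<le> e"
proof (rule conv_near[OF assms(1,4)])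
  fix y assume "dist x y \<le> d"
  then have "k * dist x y \<le> k * d" using assms(3) by (intro mult_left_mono)
  then show "\<bar>w y - w x\<bar> \<le> e" using assms(2)[of y x] assms(5) by (simp add: dist_commute)
qed

context cone_operator
begin

text \<open>Concavity of \<open>f\<close>: moving from a point of the closed cone towards \<open>(A, \<dots>, A)\<close> enters the open
  cone and
gains \<open>t (P - c)\<close> in the right-hand side.\<close>

lemma superlevel_convex_combination:
  assumes y: "y \<in> superlevel c" and A: "A > 0" "P \<le> f (\<chi> i. A)" and t: "0 < t" "t \<le> 1"
  shows "(1 - t) *\<^sub>R y + t *\<^sub>R (\<chi> i. A) \<in> \<Gamma>"
    "(1 - t) *\<^sub>R y + t *\<^sub>R (\<chi> i. A) \<in> superlevel ((1 - t) * c + t * P)"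
proof -
  have A\<Gamma>: "(\<chi> i. A) \<in> \<Gamma>" by (rule positive_orthant_subset) (use A in auto)
  have yc: "y \<in> closure \<Gamma>" "c \<le> f y" using y by (auto simp: superlevel_def)
  have "y - t *\<^sub>R (y - (\<chi> i. A)) \<in> interior \<Gamma>"
    by (rule mem_interior_closure_convex_shrink[OF convex_cone _ yc(1) t])
       (use A\<Gamma> open_cone in \<open>simp add: interior_open\<close>)
  then show in\<Gamma>: "(1 - t) *\<^sub>R y + t *\<^sub>R (\<chi> i. A) \<in> \<Gamma>"
    using interior_subset by (auto simp: algebra_simps)
  have "(1 - t) * f y + t * f (\<chi> i. A) \<le> f ((1 - t) *\<^sub>R y + t *\<^sub>R (\<chi> i. A))"
    using concave_onD[OF concave_f, of t y "\<chi> i. A"] yc(1) subsetD[OF closure_subset A\<Gamma>] t by simp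
  moreover have "(1 - t) * c + t * P \<le> (1 - t) * f y + t * f (\<chi> i. A)"
    using yc t A by (intro add_mono mult_left_mono) auto
  ultimately show "(1 - t) *\<^sub>R y + t *\<^sub>R (\<chi> i. A) \<in> superlevel ((1 - t) * c + t * P)"
    using in\<Gamma> closure_subset by (auto simp: superlevel_def)
qed

text \<open>Let \<open>h j\<close> be the maximum of \<open>u\<close> and \<open>A |y|\<^sup>2 - j\<close> on a compact neighbourhood \<open>K\<close> of \<open>closure
  U\<close>, \<open>w j\<close>
its envelope with constant \<open>k j\<close>, and \<open>W j\<close> a mollification of \<open>w j\<close> within \<open>2\<^sup>-\<^sup>j\<close>.  The points
  where
the envelope is attained have distance at most \<open>s j\<close>, by the choice of \<open>k j\<close>, so the right-hand side
drops by at most \<open>2 \<epsilon> j\<close>.  Adding \<open>3 \<cdot> 2\<^sup>-\<^sup>j\<close> makes the sequence \<open>p j\<close> decreasing, since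
\<open>4 \<cdot> 2\<^sup>-\<^sup>j\<^sup>-\<^sup>1 = 2 \<cdot> 2\<^sup>-\<^sup>j\<close>.  The approximants are \<open>v j = p j + t j (g - p j)\<close> with a quadratic \<open>g
  \<ge> p j\<close>: they
decrease along with \<open>p j\<close> and \<open>t j\<close>, and the weight \<open>t j\<close> is tuned to the loss \<open>2 \<epsilon> j\<close>.\<close>

lemma viscosity_imp_smooth_approximation:
  assumes \<Omega>: "bounded \<Omega>" and \<psi>: "continuous_on (closure \<Omega>) \<psi>" "\<And>z. z \<in> closure \<Omega> \<Longrightarrow> 0 \<le> \<psi> z"
    and visc: "viscosity_subsolution (F_op \<Gamma> f) \<psi> \<Omega> u"
    and A: "A > 0" and P0: "\<And>z. z \<in> \<Omega> \<Longrightarrow> \<psi> z \<le> P0" "P0 < f (\<chi> i. A)"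
    and U: "open U" "compact (closure U)" "closure U \<subseteq> \<Omega>" "U \<noteq> {}" and "open \<Omega>"
  shows "\<exists>v :: nat \<Rightarrow> complex ^ 'n \<Rightarrow> real.
        (\<forall>j. Gamma_subharmonic_on \<Gamma> U (v j)) \<and>
        (\<forall>z\<in>U. decseq (\<lambda>j. v j z)) \<and>
        (\<forall>z\<in>U. (\<lambda>j. ereal (v j z)) \<longlonglongrightarrow> u z) \<and>
        (\<forall>j. \<forall>z\<in>U. F_op \<Gamma> f (complex_hessian (v j) z) \<ge> ereal (\<psi> z))"
proof -
  define P where "P = f (\<chi> i. A)"
  define \<gamma> where "\<gamma> = P - P0"
  have \<gamma>: "\<gamma> > 0" using P0(2) by (simp add: \<gamma>_def P_def)
  have u: "u \<in> USC \<Omega>" using visc by (simp add: viscosity_subsolution_def)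
  obtain e0 where e0: "e0 > 0" "(\<Union>x\<in>closure U. cball x e0) \<subseteq> \<Omega>"
    using compact_subset_open_imp_cball_epsilon_subset[OF U(2) \<open>open \<Omega>\<close> U(3)] by blast
  define K where "K = {x + y | x y. x \<in> closure U \<and> y \<in> cball 0 e0}"
  have cb: "cball x e0 \<subseteq> K" if "x \<in> closure U" for x
  proof
    fix y assume "y \<in> cball x e0"
    then have "y = x + (y - x)" "y - x \<in> cball 0 e0" by (auto simp: dist_norm norm_minus_commute)
    then show "y \<in> K" using that unfolding K_def by blast
  qed
  have K\<Omega>: "K \<subseteq> \<Omega>"
  proof
    fix y assume "y \<in> K"
    then obtain x z where "x \<in> closure U" "y = x + z" "norm z \<le> e0" by (auto simp: K_def)
    then have "y \<in> cball x e0" by (simp add: dist_norm)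
    then show "y \<in> \<Omega>" using e0(2) \<open>x \<in> closure U\<close> by blast
  qed
  have Kc: "compact K" unfolding K_def using compact_sums[OF U(2) compact_cball[of 0 e0]] by simp
  have UK: "closure U \<subseteq> K" using cb e0(1) by (meson centre_in_cball less_imp_le subset_eq)
  have Kne: "K \<noteq> {}" using UK U(4) closure_subset by blast
  have "\<forall>j::nat. \<exists>h. usc_on K h \<and> (\<forall>y\<in>K. ereal (h y) = max (u y) (ereal (A * (y \<bullet> y) - real j)))"
    using USC_truncation[OF u K\<Omega>] by metis
  then obtain h where h: "\<And>j. usc_on K (h j)"
    "\<And>j y. y \<in> K \<Longrightarrow> ereal (h j y) = max (u y) (ereal (A * (y \<bullet> y) - real j))" by metis
  have h_mono: "h j y \<le> h i y" if "i \<le> j" "y \<in> K" for i j y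
  proof -
    have "ereal (h j y) \<le> ereal (h i y)" unfolding h(2)[OF that(2)] using that(1)
      by (intro max.mono) auto
    then show ?thesis by simp
  qed
  obtain z0 where z0: "\<And>y. y \<in> K \<Longrightarrow> h 0 y \<le> h 0 z0" using usc_on_attains_max[OF Kc Kne h(1)] by blast
  define M where "M = max 0 (h 0 z0)"
  have M0: "M \<ge> 0" by (simp add: M_def)
  have hM: "h j y \<le> M" if "y \<in> K" for j y
    using h_mono[of 0 j y] z0[OF that] that by (simp add: M_def)
  have h_ge: "- real j \<le> h j y" if "y \<in> K" for j y
  proof -
    have "ereal (A * (y \<bullet> y) - real j) \<le> ereal (h j y)" unfolding h(2)[OF that]
      by (rule max.cobounded2)
    moreover have "0 \<le> A * (y \<bullet> y)" using A by simp
    ultimately show ?thesis by simp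
  qed
  have hu: "u y \<le> ereal (h j y)" if "y \<in> K" for j y
    unfolding h(2)[OF that] by (rule max.cobounded1)
  \<comment> \<open>a gain of \<open>t j * \<gamma>\<close> from the quadratic has to outweigh a loss of \<open>2 * \<epsilon> j\<close>\<close>
  define t where "t j = 1 / (real j + 2)" for j
  have t: "0 < t j" "t j \<le> 1" "t (Suc j) \<le> t j" for j by (auto simp: t_def field_simps)
  have tlim: "t \<longlonglongrightarrow> 0"
  proof -
    have "(\<lambda>n. 1 / real n) \<longlonglongrightarrow> 0" by (rule lim_1_over_n)
    from LIMSEQ_ignore_initial_segment[OF this, of 2] show ?thesis
      by (simp add: t_def[abs_def] add.commute)
  qed
  define \<epsilon> where "\<epsilon> j = \<gamma> * t j / 4" for j
  have \<epsilon>: "\<epsilon> j > 0" for j using \<gamma> t by (simp add: \<epsilon>_def)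
  have "uniformly_continuous_on (closure \<Omega>) \<psi>"
    using \<psi>(1) \<Omega> by (intro compact_uniformly_continuous) (simp_all add: compact_eq_bounded_closed
      bounded_closure)
  then have "\<exists>s>0. \<forall>x\<in>closure \<Omega>. \<forall>y\<in>closure \<Omega>. dist y x < s \<longrightarrow> dist (\<psi> y) (\<psi> x) < \<epsilon> j" for j
    using \<epsilon>[of j] unfolding uniformly_continuous_on_def by (elim allE[of _ "\<epsilon> j"]) simp
  then obtain \<sigma> where \<sigma>: "\<And>j. \<sigma> j > 0"
    "\<And>j x y. x \<in> closure \<Omega> \<Longrightarrow> y \<in> closure \<Omega> \<Longrightarrow> dist y x < \<sigma> j \<Longrightarrow> dist (\<psi> y) (\<psi> x) < \<epsilon> j" by metis
  \<comment> \<open>two steps of length \<open>s j\<close> from \<open>closure U\<close> stay inside \<open>K\<close>\<close>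
  define s where "s j = min (\<sigma> j) (e0 / 2)" for j
  have s: "0 < s j" "s j \<le> \<sigma> j" "s j \<le> e0 / 2" for j using \<sigma>(1) e0(1) by (auto simp: s_def)
  \<comment> \<open>The sum makes \<open>k\<close> increasing while each term is as large as needed.  As \<open>h j\<close> has
    values between \<open>- j\<close> and \<open>M\<close>, the bound \<open>k j * s j > M + j\<close> keeps maximizers within \<open>s j\<close>.\<close>
  define k where "k j = 1 + real j + (\<Sum>i\<le>j. (M + real i) / s i)" for j
  have sum0: "0 \<le> (\<Sum>i\<le>j. (M + real i) / s i)" for j using M0 s
    by (intro sum_nonneg divide_nonneg_pos) auto
  have k: "k j > 0" "k j \<le> k (Suc j)" "real j \<le> k j" for j
    using sum0[of j] M0 s(1)[of "Suc j"] by (auto simp: k_def)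
  have ks: "M + real j < k j * s j" for j
  proof -
    have "(M + real j) / s j \<le> (\<Sum>i\<le>j. (M + real i) / s i)"
      using M0 s by (intro member_le_sum divide_nonneg_pos) auto
    then have "(M + real j) / s j < k j" by (simp add: k_def)
    then show ?thesis using s(1)[of j] by (simp add: divide_less_eq)
  qed
  define w where "w j = envelope K (h j) (k j)" for j
  have wc: "continuous_on UNIV (w j)" for j
    unfolding w_def by (rule continuous_on_envelope[OF Kc Kne h(1) less_imp_le[OF k(1)]])
  have wl: "\<bar>w j x - w j y\<bar> \<le> k j * dist x y" for j x y
    unfolding w_def by (rule envelope_lipschitz[OF Kc Kne h(1) less_imp_le[OF k(1)]])
  have w_mono: "w (Suc j) x \<le> w j x" for j x
    unfolding w_def by (rule envelope_mono[OF Kc Kne h(1) h(1) _ k(2)]) (rule h_mono, auto)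
  have w_ge: "h j x \<le> w j x" if "x \<in> K" for j x
    using envelope_attained(2)[OF Kc Kne h(1) that, of j "k j" x] by (simp add: w_def)
  have w_le: "w j x \<le> M" for j x
  proof -
    obtain y where "y \<in> K" "w j x = h j y - k j * dist x y"
      using envelope_attained(1)[OF Kc Kne h(1)] unfolding w_def by blast
    then show ?thesis using hM[of y j] k(1)[of j] by (smt (verit) mult_nonneg_nonneg zero_le_dist)
  qed
  have near: "dist x y < s j" if "x \<in> K" "y \<in> K" "w j x = h j y - k j * dist x y" for x y j
  proof -
    have "k j * dist x y \<le> M + real j" using w_ge[OF that(1), of j] h_ge[OF that(1), of j] hM[OF
      that(2), of j] that(3) by linarith
    also have "\<dots> < k j * s j" by (rule ks)
    finally show ?thesis using k(1)[of j] by simp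
  qed
  define d where "d j = min (s j / 8) ((1/2) ^ j / k j)" for j
  have d: "d j > 0" "d j \<le> s j / 8" "k j * d j \<le> (1/2) ^ j" for j
  proof -
    show "d j > 0" using s(1)[of j] k(1)[of j] by (simp add: d_def)
    show "d j \<le> s j / 8" unfolding d_def by (rule min.cobounded1)
    have "k j * d j \<le> k j * ((1/2) ^ j / k j)" using k(1)[of j]
      by (intro mult_left_mono) (auto simp: d_def)
    then show "k j * d j \<le> (1/2) ^ j" using k(1)[of j] by simp
  qed
  have "\<forall>j. \<exists>\<rho> :: complex ^ 'n \<Rightarrow> real. mollifier (d j) \<rho>" using mollifier_exists d(1) by metis
  then obtain \<rho> :: "nat \<Rightarrow> complex ^ 'n \<Rightarrow> real" where \<rho>: "\<And>j. mollifier (d j) (\<rho> j)" by metis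
  define W where "W j = conv (w j) (\<rho> j)" for j
  have Ww: "\<bar>W j x - w j x\<bar> \<le> (1/2) ^ j" for j x
    unfolding W_def by (rule lipschitz_conv_near[OF wc wl less_imp_le[OF k(1)] \<rho> d(3)])
  have hessW: "hess_ge (max 0 (\<psi> x - 2 * \<epsilon> j)) (W j) x" if x: "x \<in> closure U" for x j
    unfolding W_def
  proof (rule mollify_subsol[OF wc _ s(1) _ A \<rho> d(2)])
    let ?c = "max 0 (\<psi> x - 2 * \<epsilon> j)"
    have x\<Omega>: "x \<in> \<Omega>" using x U(3) by blast
    have "(\<chi> i. A) \<in> closure \<Gamma>"
      by (rule nonneg_orthant_subset) (use A in auto)
    moreover have "?c \<le> f (\<chi> i. A)"
      using P0(1)[OF x\<Omega>] P0(2) \<epsilon>[of j] f_nonneg[OF calculation] by simp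
    ultimately show Ac: "(\<chi> i. A) \<in> superlevel ?c" by (simp add: superlevel_def)
    show "subsol_on (ball x (s j)) ?c (w j)"
      unfolding w_def
    proof (rule envelope_subsol[OF visc Kc Kne K\<Omega> h(1) h(2) Ac])
      fix p y assume p: "p \<in> ball x (s j)" and y: "y \<in> K" "envelope K (h j) (k j) p =
        h j y - k j * dist p y"
      have xp: "dist x p < s j" using p by simp
      have pK: "p \<in> K" using cb[OF x] xp s(3)[of j] e0(1) by (auto simp: subset_eq)
      have py: "dist p y < s j" by (rule near[OF pK y(1)]) (use y(2) in \<open>simp add: w_def\<close>)
      have "dist x y < e0" using dist_triangle[of x y p] xp py s(3)[of j] by linarith
      then have "y \<in> interior K" using cb[OF x] by (intro interiorI[of "ball x e0"]) auto
      moreover have "?c \<le> \<psi> y"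
      proof -
        have cl: "x \<in> closure \<Omega>" "p \<in> closure \<Omega>" "y \<in> closure \<Omega>"
          using x\<Omega> pK y(1) K\<Omega> closure_subset by blast+
        have "dist (\<psi> p) (\<psi> x) < \<epsilon> j" using xp s(2)[of j] by (intro \<sigma> cl) (simp add: dist_commute)
        moreover have "dist (\<psi> y) (\<psi> p) < \<epsilon> j" using py s(2)[of j]
          by (intro \<sigma> cl) (simp add: dist_commute)
        ultimately have "\<psi> x - 2 * \<epsilon> j \<le> \<psi> y" unfolding dist_real_def by linarith
        then show ?thesis using \<psi>(2)[OF cl(3)] by simp
      qed
      ultimately show "y \<in> interior K \<and> ?c \<le> \<psi> y" ..
    qed
  qed
  obtain R where R: "U \<subseteq> ball 0 R"
    using bounded_subset_ballD[OF bounded_subset[OF compact_imp_bounded[OF U(2)] closure_subset]]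
      by metis
  have Ws: "smooth_on U (W j)" for j
    unfolding W_def by (rule smooth_on_subset[OF smooth_on_ball_conv[OF wc \<rho>] R])
  define p where "p j x = W j x + 3 * (1/2) ^ j" for j x
  define g where "g x = A * (x \<bullet> x) + x \<bullet> 0 + (M + 4)" for x :: "complex ^ 'n"
  define v where "v j x = (1 - t j) * p j x + t j * g x" for j x
  have half: "(1/2 :: real) ^ j \<le> 1" "(1/2 :: real) ^ j > 0" for j by (auto simp: power_le_one)
  have p_mono: "p (Suc j) x \<le> p j x" for j x
    using Ww[of "Suc j" x] Ww[of j x] w_mono[of j x] unfolding p_def abs_le_iff by simp
  have p_ge: "w j x \<le> p j x" for j x using Ww[of j x] half[of j] unfolding p_def abs_le_iff by simp
  have p_le: "p j x \<le> w j x + 4 * (1/2) ^ j" for j x using Ww[of j x]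
    unfolding p_def abs_le_iff by simp
  have pg: "p j x \<le> g x" for j x
  proof -
    have "0 \<le> A * (x \<bullet> x)" using A by simp
    then show ?thesis using p_le[of j x] w_le[of j x] half[of j] unfolding g_def by simp
  qed
  have v_eq: "v j x = p j x + t j * (g x - p j x)" for j x by (simp add: v_def algebra_simps)
  have v_mono: "v (Suc j) x \<le> v j x" for j x
  proof -
    have "v (Suc j) x \<le> (1 - t (Suc j)) * p j x + t (Suc j) * g x"
      unfolding v_def using p_mono t by (intro add_right_mono mult_left_mono) auto
    also have "\<dots> = p j x + t (Suc j) * (g x - p j x)" by (simp add: algebra_simps)
    also have "\<dots> \<le> v j x" unfolding v_eq using t pg by (intro add_left_mono mult_right_mono) auto
    finally show ?thesis .
  qed
  have v_ge: "p j x \<le> v j x" for j x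
    unfolding v_eq using t(1)[of j] pg[of j x] by simp
  have ps: "smooth_on U (p j)" for j
    unfolding p_def[abs_def] by (intro smooth_on_add U Ws smooth_on_const)
  have gs: "smooth_on U g" unfolding g_def[abs_def] by (rule smooth_on_quadratic)
  have tp: "smooth_on U (\<lambda>x. (1 - t j) * p j x)" and tg: "smooth_on U (\<lambda>x. t j * g x)" for j
    using smooth_on_scaleR[OF U(1) ps, of "1 - t j" j] smooth_on_scaleR[OF U(1) gs, of "t j"]
      by simp_all
  have vs: "smooth_on U (v j)" for j
    unfolding v_def[abs_def] by (rule smooth_on_add[OF U(1) tp tg])
  have levi_v: "levi_diag V (v j) x = (1 - t j) *\<^sub>R levi_diag V (W j) x + t j *\<^sub>R (\<chi> i. A)"
    if x: "x \<in> U" and V: "unitary V" for V j x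
  proof -
    note ck = smooth_on_imp_Ck_on
    have "levi (v j) x \<xi> = (1 - t j) * levi (W j) x \<xi> + t j * (A * (\<xi> \<bullet> \<xi>))" for \<xi>
    proof -
      have "levi (v j) x \<xi> = levi (\<lambda>x. (1 - t j) * p j x) x \<xi> + levi (\<lambda>x. t j * g x) x \<xi>"
        unfolding v_def[abs_def] by (rule levi_add[OF U(1) ck[OF tp] ck[OF tg] x])
      moreover have "levi (\<lambda>x. (1 - t j) * p j x) x \<xi> = (1 - t j) * levi (p j) x \<xi>"
        by (rule levi_scale[OF U(1) ck[OF ps] x])
      moreover have "levi (p j) x \<xi> = levi (W j) x \<xi>"
        using levi_add[OF U(1) ck[OF Ws] ck[OF smooth_on_const] x, of j "3 * (1/2) ^ j" \<xi>]
        by (simp add: p_def[abs_def] levi_const)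
      moreover have "levi (\<lambda>x. t j * g x) x \<xi> = t j * levi g x \<xi>"
        by (rule levi_scale[OF U(1) ck[OF gs] x])
      moreover have "levi g x \<xi> = A * (\<xi> \<bullet> \<xi>)" unfolding g_def[abs_def] by (rule levi_quadratic)
      ultimately show ?thesis by simp
    qed
    then show ?thesis by (simp add: vec_eq_iff levi_diag_def cnj_column_unit[OF V])
  qed
  have good: "levi_diag V (v j) x \<in> \<Gamma> \<and> levi_diag V (v j) x \<in> superlevel (\<psi> x)"
    if x: "x \<in> U" and V: "unitary V" for V j x
  proof -
    let ?c = "max 0 (\<psi> x - 2 * \<epsilon> j)"
    have "x \<in> closure U" using x closure_subset by blast
    then have y: "levi_diag V (W j) x \<in> superlevel ?c"
      using hessW V by (simp add: hess_ge_def)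
    have "\<psi> x \<le> P0" using P0(1) U(3) x closure_subset by blast
    then have "t j * \<gamma> \<le> t j * (P - \<psi> x)"
      using t(1)[of j] by (intro mult_left_mono) (auto simp: \<gamma>_def)
    moreover have "t j * \<gamma> = 4 * \<epsilon> j" by (simp add: \<epsilon>_def)
    moreover have "(1 - t j) * (2 * \<epsilon> j) \<le> 1 * (2 * \<epsilon> j)"
      using t[of j] \<epsilon>[of j] by (intro mult_right_mono) auto
    moreover have "(1 - t j) * (\<psi> x - 2 * \<epsilon> j) \<le> (1 - t j) * ?c"
      using t[of j] by (intro mult_left_mono) auto
    ultimately have "\<psi> x \<le> (1 - t j) * ?c + t j * P"
      using \<epsilon>[of j] by (simp add: algebra_simps)
    then show ?thesis
      using superlevel_convex_combination[OF y A _ t(1,2), of P j] superlevel_antimono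
      unfolding levi_v[OF x V] P_def by blast
  qed
  have lim: "(\<lambda>j. ereal (v j x)) \<longlonglongrightarrow> u x" if x: "x \<in> U" for x
  proof -
    have xK: "x \<in> K" using x UK closure_subset by blast
    have lower: "u x \<le> ereal (v j x)" for j
    proof -
      have "h j x \<le> v j x" using w_ge[OF xK, of j] p_ge[of j x] v_ge[of j x] by linarith
      then show ?thesis using hu[OF xK, of j] by (meson ereal_less_eq(3) order_trans)
    qed
    show ?thesis
    proof (rule order_tendstoI)
      fix b assume "b < u x"
      then show "\<forall>\<^sub>F j in sequentially. b < ereal (v j x)"
        using lower by (auto intro!: always_eventually elim: less_le_trans)
    next
      fix b assume "u x < b"
      then obtain a where a: "u x < ereal a" "ereal a < b" using ereal_dense2 by blast
      then obtain a' where a': "u x < ereal a'" "a' < a" using ereal_dense2[OF a(1)] by auto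
      obtain m :: nat where m: "A * (x \<bullet> x) - a' < real m" using reals_Archimedean2 by blast
      have "ereal (h m x) < ereal a'" unfolding h(2)[OF xK] using a'(1) m by simp
      then obtain r where r: "r > 0" "\<And>y. y \<in> K \<Longrightarrow> dist x y < r \<Longrightarrow> h m y < a'"
        using h(1)[of m] xK unfolding usc_on_def by force
      \<comment> \<open>from \<open>n\<close> on, points at distance at least \<open>r\<close> contribute at most \<open>a'\<close> to the envelope\<close>
      obtain n :: nat where n: "(M - a') / r < real n" using reals_Archimedean2 by blast
      have w_a': "w j x \<le> a'" if j: "j \<ge> m" "j \<ge> n" for j
      proof -
        obtain y where y: "y \<in> K" "w j x = h j y - k j * dist x y"
          using envelope_attained(1)[OF Kc Kne h(1)] unfolding w_def by blast
        show ?thesis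
        proof (cases "dist x y < r")
          case True
          have "h j y \<le> h m y" by (rule h_mono[OF j(1) y(1)])
          moreover have "0 \<le> k j * dist x y" using k(1)[of j] by simp
          ultimately show ?thesis using r(2)[OF y(1) True] y(2) by linarith
        next
          case False
          have "(M - a') / r < k j" using n j(2) k(3)[of j] by linarith
          then have "M - a' < k j * r" using r(1) by (simp add: divide_less_eq)
          also have "\<dots> \<le> k j * dist x y" using False k(1)[of j] by (intro mult_left_mono) auto
          finally show ?thesis using hM[OF y(1), of j] y(2) by linarith
        qed
      qed
      have "(\<lambda>j. (1 - t j) * (a' + 4 * (1/2) ^ j) + t j * g x) \<longlonglongrightarrow> (1 - 0) * (a' + 4 * 0) + 0 * g x"
        by (intro tendsto_intros tlim LIMSEQ_power_zero) simp
      then have "(\<lambda>j. (1 - t j) * (a' + 4 * (1/2) ^ j) + t j * g x) \<longlonglongrightarrow> a'" by simp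
      from order_tendstoD(2)[OF this a'(2)]
      have "\<forall>\<^sub>F j in sequentially. (1 - t j) * (a' + 4 * (1/2) ^ j) + t j * g x < a" .
      then show "\<forall>\<^sub>F j in sequentially. ereal (v j x) < b"
        using eventually_ge_at_top[of m] eventually_ge_at_top[of n]
      proof eventually_elim
        case (elim j)
        have "v j x \<le> (1 - t j) * (a' + 4 * (1/2) ^ j) + t j * g x"
          unfolding v_def using p_le[of j x] w_a'[OF elim(2,3)] t(2)[of j]
          by (intro add_right_mono mult_left_mono) auto
        then have "ereal (v j x) < ereal a" using elim(1) by simp
        then show ?case using a(2) by (rule less_trans)
      qed
    qed
  qed
  show ?thesis
  proof (intro exI[of _ v] conjI allI ballI)
    note ck = smooth_on_imp_Ck_on[OF vs]
    show "Gamma_subharmonic_on \<Gamma> U (v j)" for j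
      unfolding Gamma_subharmonic_on_def
    proof (intro conjI ballI vs)
      fix z assume z: "z \<in> U"
      show "complex_hessian (v j) z \<in> M_cone \<Gamma>"
      proof (rule M_coneI)
        show "hermitian (complex_hessian (v j) z)" by (rule hermitian_complex_hessian[OF U(1) ck z])
        show "diag_in V (complex_hessian (v j) z) \<in> \<Gamma>" if "unitary V" for V
          using good[OF z that] by (simp add: diag_in_hessian[OF U(1) ck z])
      qed
    qed
    show "decseq (\<lambda>j. v j z)" for z by (rule decseq_SucI) (rule v_mono)
    show "(\<lambda>j. ereal (v j z)) \<longlonglongrightarrow> u z" if "z \<in> U" for z by (rule lim[OF that])
    show "ereal (\<psi> z) \<le> F_op \<Gamma> f (complex_hessian (v j) z)" if "z \<in> U" for j z
      unfolding F_op_hessian_ge_iff[OF U(1) ck that] hess_ge_def using good[OF that] by blast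
  qed
qed

end

theorem corollary1p2:
  fixes \<Omega> :: "(complex ^ 'n) set"
    and \<psi> :: "complex ^ 'n \<Rightarrow> real"
    and \<Gamma> :: "(real ^ 'n) set"
    and f :: "real ^ 'n \<Rightarrow> real"
    and L :: ereal
    and u :: "complex ^ 'n \<Rightarrow> ereal"
  assumes "open \<Omega>" and "connected \<Omega>" and "\<Omega> \<noteq> {}" and "bounded \<Omega>"
    and "continuous_on (closure \<Omega>) \<psi>" and "\<And>z. z \<in> closure \<Omega> \<Longrightarrow> 0 \<le> \<psi> z"
    and "admissible_cone \<Gamma>" and "admissible_fun \<Gamma> f"
    and "((\<lambda>R::real. ereal (f (\<chi> i. R))) \<longlongrightarrow> L) at_top"
    and "L > (SUP z\<in>\<Omega>. ereal (\<psi> z))"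
    and "u \<in> USC \<Omega>"
  shows "viscosity_subsolution (F_op \<Gamma> f) \<psi> \<Omega> u \<longleftrightarrow>
    (\<forall>U. open U \<and> compact (closure U) \<and> closure U \<subseteq> \<Omega> \<longrightarrow>
      (\<exists>v :: nat \<Rightarrow> complex ^ 'n \<Rightarrow> real.
        (\<forall>j. Gamma_subharmonic_on \<Gamma> U (v j)) \<and>
        (\<forall>z\<in>U. decseq (\<lambda>j. v j z)) \<and>
        (\<forall>z\<in>U. (\<lambda>j. ereal (v j z)) \<longlonglongrightarrow> u z) \<and>
        (\<forall>j. \<forall>z\<in>U. F_op \<Gamma> f (complex_hessian (v j) z) \<ge> ereal (\<psi> z))))"
    (is "?visc \<longleftrightarrow> ?approx")
proof
  interpret cone_operator \<Gamma> f by standard (fact assms(7), fact assms(8))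
  assume ?approx
  then show ?visc
    using assms(1,11) continuous_on_subset[OF assms(5) closure_subset]
    by (intro viscosity_of_decreasing_limit) auto
next
  interpret cone_operator \<Gamma> f by standard (fact assms(7), fact assms(8))
  assume visc: ?visc
  have "\<forall>\<^sub>F R in at_top. ereal (f (\<chi> i. R)) > (SUP z\<in>\<Omega>. ereal (\<psi> z)) \<and> R > 0"
    by (intro eventually_conj order_tendstoD(1)[OF assms(9,10)] eventually_gt_at_top)
  then obtain A :: real where A: "(SUP z\<in>\<Omega>. ereal (\<psi> z)) < ereal (f (\<chi> i. A))" "A > 0"
    by (auto simp: eventually_at_top_linorder)
  obtain P0 where P0: "(SUP z\<in>\<Omega>. ereal (\<psi> z)) < ereal P0" "P0 < f (\<chi> i. A)"
    using ereal_dense2[OF A(1)] by auto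
  have \<psi>P0: "\<psi> z \<le> P0" if "z \<in> \<Omega>" for z
  proof -
    have "ereal (\<psi> z) \<le> (SUP z\<in>\<Omega>. ereal (\<psi> z))" using that by (rule SUP_upper)
    then show ?thesis using P0(1) by (metis ereal_less_eq(3) less_imp_le order_trans)
  qed
  show ?approx
  proof (intro allI impI)
    fix U :: "(complex ^ 'n) set" assume U: "open U \<and> compact (closure U) \<and> closure U \<subseteq> \<Omega>"
    let ?Q = "\<lambda>v :: nat \<Rightarrow> complex ^ 'n \<Rightarrow> real. (\<forall>j. Gamma_subharmonic_on \<Gamma> U (v j)) \<and>
        (\<forall>z\<in>U. decseq (\<lambda>j. v j z)) \<and> (\<forall>z\<in>U. (\<lambda>j. ereal (v j z)) \<longlonglongrightarrow> u z) \<and>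
        (\<forall>j. \<forall>z\<in>U. F_op \<Gamma> f (complex_hessian (v j) z) \<ge> ereal (\<psi> z))"
    show "\<exists>v. ?Q v"
    proof (cases "U = {}")
      case True
      then show ?thesis
        by (intro exI[of _ "\<lambda>_ _. 0"]) (simp add: Gamma_subharmonic_on_def smooth_on_const)
    next
      case False
      show ?thesis
        by (rule viscosity_imp_smooth_approximation[OF assms(4,5,6) visc A(2) \<psi>P0 P0(2)])
           (use U False assms(1) in auto)
    qed
  qed
qed

end
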